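(* Let $\mathscr{C}$ be a $2d$-Calabi-Yau $(d+2)$-angulated category that is $K$-linear, Hom-finite and Krull-Schmidt. Let $T$ and $U$ be two basic Oppermann-Thomas cluster tilting objects of $\mathscr{C}$, with $\mathscr{T}=\mathrm{add}(T)$ and $\mathscr{U}=\mathrm{add}(U)$. Suppose also that $d$ is odd, and that $U$ is mutable at the indecomposable summand $u$ with mutation $u^*$ such that $u$ and $u^*$ form an exchange pair. Then for $t\in\mathscr{T}$, $$c_{\mathscr{T}}(u,\mathscr{U})([t])=(-1)^d\Big[\dim_K\mathrm{Hom}_{\mathscr{C}/[\Sigma^d\mathscr{U}]}(\Sigma^dt,\Sigma^du^* )+(-1)^d\dim_K\mathrm{Hom}_{\mathscr{C}/[\Sigma^d\mathscr{U}]}(\Sigma^du^*,\Sigma^{2d}t)\Big].$$ Moreover, at least one of $\mathrm{Hom}_{\mathscr{C}/[\Sigma^d\mathscr{U}]}(\Sigma^dt,\Sigma^du^* )$ and $\mathrm{Hom}_{\mathscr{C}/[\Sigma^d\mathscr{U}]}(\Sigma^du^*,\Sigma^{2d}t)$ is zero.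
   Context: Throughout, $K$ is an algebraically closed field and $d$ is a positive integer. **$(d+2)$-angulated categories (Geiss-Keller-Oppermann).** Let $\mathscr{C}$ be an additive category with an automorphism $\Sigma^d$ (not assumed to be the $d$-th power of another functor). A $\Sigma^d$-sequence is a diagram $c^0\xrightarrow{\gamma^0}c^1\xrightarrow{\gamma^1}\cdots\to c^{d+1}\xrightarrow{\gamma^{d+1}}\Sigma^d(c^0)$. A $(d+2)$-angulated category is such a $\mathscr{C}$ together with a class of $\Sigma^d$-sequences, called $(d+2)$-angles, such that: (N1) the class is closed under sums and summands, contains $c\xrightarrow{\mathrm{id}}c\to0\to\cdots\to0\to\Sigma^d(c)$ for each $c$, and each morphism $c^0\to c^1$ is the first morphism of some $(d+2)$-angle; (N2) a $\Sigma^d$-sequence $c^0\xrightarrow{\gamma^0}c^1\xrightarrow{\gamma^1}\cdots\to c^{d+1}\xrightarrow{\gamma^{d+1}}\Sigma^d(c^0)$ is a $(d+2)$-angle if and only if its left rotation $c^1\xrightarrow{\gamma^1}c^2\to\cdots\to c^{d+1}\xrightarrow{\gamma^{d+1}}\Sigma^d(c^0)\xrightarrow{(-1)^d\Sigma^d(\gamma^0)}\Sigma^d(c^1)$ is; (N3) given $(d+2)$-angles $b^\bullet$ and $c^\bullet$ with morphisms $\beta^i,\gamma^i$, and $\varphi^0:b^0\to c^0$, $\varphi^1:b^1\to c^1$ with $\varphi^1\beta^0=\gamma^0\varphi^0$, there are $\varphi^i:b^i\to c^i$ ($2\le i\le d+1$) completing $\varphi^0,\varphi^1,\Sigma^d(\varphi^0)$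 to a morphism of $\Sigma^d$-sequences; (N4) (octahedral axiom) in (N3) the $\varphi^i$ can be chosen so that the mapping cone $b^1\oplus c^0\to b^2\oplus c^1\to\cdots\to\Sigma^d b^0\oplus c^{d+1}\to\Sigma^d b^1\oplus\Sigma^d c^0$, with morphisms $\begin{pmatrix}-\beta^{i+1}&0\\ \varphi^{i+1}&\gamma^i\end{pmatrix}$ for $0\le i\le d$ and last morphism $\begin{pmatrix}-\Sigma^d\beta^0&0\\ \Sigma^d\varphi^0&\gamma^{d+1}\end{pmatrix}$, is a $(d+2)$-angle. $\mathscr{C}$ is $2d$-Calabi-Yau if it has a Serre functor (an auto-equivalence $S$ with isomorphisms $\mathrm{Hom}_{\mathscr{C}}(Y,SX)\cong D\,\mathrm{Hom}_{\mathscr{C}}(X,Y)$ natural in $X,Y$, where $D=\mathrm{Hom}_K(-,K)$) isomorphic to $\Sigma^{2d}:=(\Sigma^d)^2$. **Oppermann-Thomas cluster tilting.** An object $T$ is an Oppermann-Thomas cluster tilting object if, with $\mathscr{T}=\mathrm{add}(T)$: (i) $\mathrm{Hom}_{\mathscr{C}}(\mathscr{T},\Sigma^d\mathscr{T})=0$; (ii) for every $c\in\mathscr{C}$ there is a $(d+2)$-angle $t_d\to t_{d-1}\to\cdots\to t_0\to c\to\Sigma^d(t_d)$ with all $t_i\in\mathscr{T}$. It is basic if its indecomposable summands are pairwise non-isomorphic. $\mathrm{Indec}(\mathscr{T})$ is the set of indecomposables of $\mathscr{T}$ up to isomorphism. **Quotient category.** $[\Sigma^d\mathscr{U}]$ is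 the ideal of $\mathscr{C}$ consisting of the morphisms that factor through an object of $\Sigma^d\mathscr{U}$, and $\mathscr{C}/[\Sigma^d\mathscr{U}]$ is the quotient category. **Mutation and exchange pairs.** Let $U$ be a basic Oppermann-Thomas cluster tilting object with indecomposable summands $u_1,\dots,u_m$. $U$ is mutable at $u\in\{u_1,\dots,u_m\}$ with mutation $u^*$ if $u^*$ is an indecomposable object of $\mathscr{C}$ such that the object with indecomposable summands $(\{u_1,\dots,u_m\}\setminus\{u\})\cup\{u^*\}$ is also an Oppermann-Thomas cluster tilting object. In that case $u,u^*$ form an exchange pair if $\mathrm{Ext}^d(u,u^* )=\mathrm{Hom}_{\mathscr{C}}(u,\Sigma^du^* )$ and $\mathrm{Ext}^d(u^*,u)=\mathrm{Hom}_{\mathscr{C}}(u^*,\Sigma^du)$ both have dimension $1$ over $K$ and there exist two $(d+2)$-angles $u^*\to e_d\to\cdots\to e_1\to u\xrightarrow{\delta}\Sigma^du^*$ and $u\to f_d\to\cdots\to f_1\to u^*\xrightarrow{\epsilon}\Sigma^du$ in which each $e_i$ and $f_i$ is a direct sum of indecomposables from $\mathrm{Indec}(\mathscr{U})\setminus\{u\}$. **Index and $c$-vector.** $K_0^{\mathrm{split}}(\mathscr{T})$ is the abelian group generated by objects of $\mathscr{T}$ modulo $[t]=[t_0]+[t_1]$ for $t\cong t_0\oplus t_1$; it is free on $[t]$, $t\in\mathrm{Indec}(\mathscr{T})$. The index of $c\in\mathscr{C}$ is $\mathrm{Ind}_{\mathscr{T}}(c)=\sum_{i=0}^d(-1)^i[t_i]\in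 K_0^{\mathrm{split}}(\mathscr{T})$ for any $(d+2)$-angle as in (ii); it is well defined. For an abelian group $A$, $A^*=\mathrm{Hom}(A,\mathbb{Z})$. For $u\in\mathrm{Indec}(\mathscr{U})$ the homological $c$-vector of $(u,\mathscr{U})$ with respect to $\mathscr{T}$ is the element $c_{\mathscr{T}}(u,\mathscr{U})\in K_0^{\mathrm{split}}(\mathscr{T})^*$ determined by $c_{\mathscr{T}}(u,\mathscr{U})(\mathrm{Ind}_{\mathscr{T}}(v))=\delta_{uv}$ (Kronecker delta) for all $v\in\mathrm{Indec}(\mathscr{U})$; it exists and is unique because the $\mathrm{Ind}_{\mathscr{T}}(v)$, $v\in\mathrm{Indec}(\mathscr{U})$, form a basis of $K_0^{\mathrm{split}}(\mathscr{T})$. *)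

theory Defs
  imports
    "HOL-Algebra.Algebraic_Closure"
    "HOL-Algebra.Free_Abelian_Groups"
    "Jordan_Normal_Form.Missing_VectorSpace"
begin

(* frees the name X, which HOL-Algebra uses for the polynomial variable *)
no_notation var (\<open>X\<index>\<close>)

section \<open>Linear categories\<close>

text \<open>
  The objects are all elements of the type \<open>'o\<close>.  The morphism spaces are modules in the sense of
  HOL-Algebra; they need not be disjoint, so composition, and the action of a functor on morphisms,
  take the objects involved as arguments: \<open>Comp C X Y Z g f\<close> is $g \circ f$ for
  $f : X \to Y$ and $g : Y \to Z$.
\<close>

record ('k, 'o, 'm) lincat =
  Hom :: "'o \<Rightarrow> 'o \<Rightarrow> ('k, 'm) module"
  Comp :: "'o \<Rightarrow> 'o \<Rightarrow> 'o \<Rightarrow> 'm \<Rightarrow> 'm \<Rightarrow> 'm"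
  Ident :: "'o \<Rightarrow> 'm"

abbreviation Arr :: "('k, 'o, 'm, 'z) lincat_scheme \<Rightarrow> 'o \<Rightarrow> 'o \<Rightarrow> 'm set" where
  "Arr C X Y \<equiv> carrier (Hom C X Y)"

abbreviation Zero :: "('k, 'o, 'm, 'z) lincat_scheme \<Rightarrow> 'o \<Rightarrow> 'o \<Rightarrow> 'm" where
  "Zero C X Y \<equiv> \<zero>\<^bsub>Hom C X Y\<^esub>"

locale linear_category =
  fixes K :: "'k ring" and C :: "('k, 'o, 'm, 'z) lincat_scheme"
  assumes Hom_vectorspace: "vectorspace K (Hom C X Y)"
    and Comp_linear_right:
      "g \<in> Arr C Y Z \<Longrightarrow> (\<lambda>f. Comp C X Y Z g f) \<in> module_hom K (Hom C X Y) (Hom C X Z)"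
    and Comp_linear_left:
      "f \<in> Arr C X Y \<Longrightarrow> (\<lambda>g. Comp C X Y Z g f) \<in> module_hom K (Hom C Y Z) (Hom C X Z)"
    and Comp_assoc:
      "\<lbrakk>f \<in> Arr C W X; g \<in> Arr C X Y; h \<in> Arr C Y Z\<rbrakk> \<Longrightarrow>
        Comp C W X Z (Comp C X Y Z h g) f = Comp C W Y Z h (Comp C W X Y g f)"
    and Ident_closed: "Ident C X \<in> Arr C X X"
    and Ident_right: "f \<in> Arr C X Y \<Longrightarrow> Comp C X X Y f (Ident C X) = f"
    and Ident_left: "f \<in> Arr C X Y \<Longrightarrow> Comp C X Y Y (Ident C Y) f = f"

definition hom_dim :: "'k ring \<Rightarrow> ('k, 'o, 'm, 'z) lincat_scheme \<Rightarrow> 'o \<Rightarrow> 'o \<Rightarrow> nat" where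
  "hom_dim K C X Y = vectorspace.dim K (Hom C X Y)"

definition hom_finite :: "'k ring \<Rightarrow> ('k, 'o, 'm, 'z) lincat_scheme \<Rightarrow> bool" where
  "hom_finite K C \<longleftrightarrow> (\<forall>X Y. vectorspace.fin_dim K (Hom C X Y))"

definition inverse_arrows ::
    "('k, 'o, 'm, 'z) lincat_scheme \<Rightarrow> 'o \<Rightarrow> 'o \<Rightarrow> 'm \<Rightarrow> 'm \<Rightarrow> bool" where
  "inverse_arrows C X Y f g \<longleftrightarrow> f \<in> Arr C X Y \<and> g \<in> Arr C Y X \<and>
     Comp C X Y X g f = Ident C X \<and> Comp C Y X Y f g = Ident C Y"

definition isomorphic :: "('k, 'o, 'm, 'z) lincat_scheme \<Rightarrow> 'o \<Rightarrow> 'o \<Rightarrow> bool" where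
  "isomorphic C X Y \<longleftrightarrow> (\<exists>f g. inverse_arrows C X Y f g)"

subsection \<open>Direct sums and the Krull-Schmidt property\<close>

definition zero_object :: "('k, 'o, 'm, 'z) lincat_scheme \<Rightarrow> 'o \<Rightarrow> bool" where
  "zero_object C X \<longleftrightarrow> Ident C X = Zero C X X"

definition biproduct ::
    "('k, 'o, 'm, 'z) lincat_scheme \<Rightarrow> 'o \<Rightarrow> 'o \<Rightarrow> 'o \<Rightarrow> 'm \<Rightarrow> 'm \<Rightarrow> 'm \<Rightarrow> 'm \<Rightarrow> bool" where
  "biproduct C P X Y i1 i2 p1 p2 \<longleftrightarrow>
     i1 \<in> Arr C X P \<and> i2 \<in> Arr C Y P \<and> p1 \<in> Arr C P X \<and> p2 \<in> Arr C P Y \<and>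
     Comp C X P X p1 i1 = Ident C X \<and> Comp C Y P Y p2 i2 = Ident C Y \<and>
     Comp C Y P X p1 i2 = Zero C Y X \<and> Comp C X P Y p2 i1 = Zero C X Y \<and>
     Comp C P X P i1 p1 \<oplus>\<^bsub>Hom C P P\<^esub> Comp C P Y P i2 p2 = Ident C P"

definition is_sum :: "('k, 'o, 'm, 'z) lincat_scheme \<Rightarrow> 'o \<Rightarrow> 'o \<Rightarrow> 'o \<Rightarrow> bool" where
  "is_sum C P X Y \<longleftrightarrow> (\<exists>i1 i2 p1 p2. biproduct C P X Y i1 i2 p1 p2)"

text \<open>\<open>P\<close> is a direct sum of the objects in the list \<open>Xs\<close>, a zero object if \<open>Xs\<close> is empty.\<close>

definition is_list_sum :: "('k, 'o, 'm, 'z) lincat_scheme \<Rightarrow> 'o \<Rightarrow> 'o list \<Rightarrow> bool" where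
  "is_list_sum C P Xs \<longleftrightarrow> (\<exists>\<iota> \<pi>.
     (\<forall>i<length Xs. \<iota> i \<in> Arr C (Xs ! i) P \<and> \<pi> i \<in> Arr C P (Xs ! i)) \<and>
     (\<forall>i<length Xs. \<forall>j<length Xs. Comp C (Xs ! j) P (Xs ! i) (\<pi> i) (\<iota> j) =
        (if i = j then Ident C (Xs ! i) else Zero C (Xs ! j) (Xs ! i))) \<and>
     (\<Oplus>\<^bsub>Hom C P P\<^esub> i \<in> {..<length Xs}. Comp C P (Xs ! i) P (\<iota> i) (\<pi> i)) = Ident C P)"

locale additive_category = linear_category +
  assumes zero_exists: "\<exists>Z. zero_object C Z"
    and sum_exists: "\<exists>P. is_sum C P X Y"

definition indecomposable :: "('k, 'o, 'm, 'z) lincat_scheme \<Rightarrow> 'o \<Rightarrow> bool" where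
  "indecomposable C X \<longleftrightarrow> \<not> zero_object C X \<and>
     (\<forall>Y Z. is_sum C X Y Z \<longrightarrow> zero_object C Y \<or> zero_object C Z)"

definition indec_summand :: "('k, 'o, 'm, 'z) lincat_scheme \<Rightarrow> 'o \<Rightarrow> 'o \<Rightarrow> bool" where
  "indec_summand C X P \<longleftrightarrow> indecomposable C X \<and> (\<exists>Y. is_sum C P X Y)"

definition basic :: "('k, 'o, 'm, 'z) lincat_scheme \<Rightarrow> 'o \<Rightarrow> bool" where
  "basic C X \<longleftrightarrow> (\<exists>Xs. is_list_sum C X Xs \<and> (\<forall>Y \<in> set Xs. indecomposable C Y) \<and>
     (\<forall>i<length Xs. \<forall>j<length Xs. i \<noteq> j \<longrightarrow> \<not> isomorphic C (Xs ! i) (Xs ! j)))"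

text \<open>\<open>add(T)\<close>: the summands of finite direct sums of copies of \<open>T\<close>.\<close>

definition add_of :: "('k, 'o, 'm, 'z) lincat_scheme \<Rightarrow> 'o \<Rightarrow> 'o set" where
  "add_of C T = {X. \<exists>n P Y. is_list_sum C P (replicate n T) \<and> is_sum C P X Y}"

text \<open>
  \<open>Indec\<close> is represented without choosing representatives, as the isomorphism-closed set of all
  indecomposables in a set of objects; wherever it is used, elements are compared up to isomorphism.
\<close>

definition Indec :: "('k, 'o, 'm, 'z) lincat_scheme \<Rightarrow> 'o set \<Rightarrow> 'o set" where
  "Indec C A = {X \<in> A. indecomposable C X}"

definition end_ring :: "('k, 'o, 'm, 'z) lincat_scheme \<Rightarrow> 'o \<Rightarrow> 'm ring" where
  "end_ring C X = \<lparr>carrier = Arr C X X, monoid.mult = Comp C X X X, one = Ident C X,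
     ring.zero = Zero C X X, ring.add = (\<oplus>\<^bsub>Hom C X X\<^esub>)\<rparr>"

text \<open>Locality of a ring that is not assumed to be commutative.\<close>

definition is_local :: "'a ring \<Rightarrow> bool" where
  "is_local R \<longleftrightarrow> \<one>\<^bsub>R\<^esub> \<noteq> \<zero>\<^bsub>R\<^esub> \<and>
     (\<forall>a \<in> carrier R - Units R. \<forall>b \<in> carrier R - Units R. a \<oplus>\<^bsub>R\<^esub> b \<notin> Units R)"

definition krull_schmidt :: "('k, 'o, 'm, 'z) lincat_scheme \<Rightarrow> bool" where
  "krull_schmidt C \<longleftrightarrow>
     (\<forall>X. \<exists>Xs. is_list_sum C X Xs \<and> (\<forall>Y \<in> set Xs. is_local (end_ring C Y)))"

subsection \<open>Functors and Serre functors\<close>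

record ('o, 'm) endofunctor =
  fobj :: "'o \<Rightarrow> 'o"
  farr :: "'o \<Rightarrow> 'o \<Rightarrow> 'm \<Rightarrow> 'm"

definition linear_functor ::
    "'k ring \<Rightarrow> ('k, 'o, 'm, 'z) lincat_scheme \<Rightarrow> ('o, 'm) endofunctor \<Rightarrow> bool" where
  "linear_functor K C F \<longleftrightarrow>
     (\<forall>X Y. farr F X Y \<in> module_hom K (Hom C X Y) (Hom C (fobj F X) (fobj F Y))) \<and>
     (\<forall>X. farr F X X (Ident C X) = Ident C (fobj F X)) \<and>
     (\<forall>X Y Z. \<forall>f \<in> Arr C X Y. \<forall>g \<in> Arr C Y Z.
        farr F X Z (Comp C X Y Z g f) =
        Comp C (fobj F X) (fobj F Y) (fobj F Z) (farr F Y Z g) (farr F X Y f))"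

definition id_functor :: "('o, 'm) endofunctor" where
  "id_functor = \<lparr>fobj = id, farr = (\<lambda>X Y. id)\<rparr>"

definition comp_functor ::
    "('o, 'm) endofunctor \<Rightarrow> ('o, 'm) endofunctor \<Rightarrow> ('o, 'm) endofunctor" where
  "comp_functor G F = \<lparr>fobj = fobj G \<circ> fobj F,
     farr = (\<lambda>X Y. farr G (fobj F X) (fobj F Y) \<circ> farr F X Y)\<rparr>"

definition automorphism ::
    "'k ring \<Rightarrow> ('k, 'o, 'm, 'z) lincat_scheme \<Rightarrow> ('o, 'm) endofunctor \<Rightarrow> bool" where
  "automorphism K C F \<longleftrightarrow> linear_functor K C F \<and> bij (fobj F) \<and>
     (\<forall>X Y. bij_betw (farr F X Y) (Arr C X Y) (Arr C (fobj F X) (fobj F Y)))"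

definition naturally_isomorphic ::
    "('k, 'o, 'm, 'z) lincat_scheme \<Rightarrow> ('o, 'm) endofunctor \<Rightarrow> ('o, 'm) endofunctor \<Rightarrow> bool" where
  "naturally_isomorphic C F G \<longleftrightarrow> (\<exists>\<eta>.
     (\<forall>X. \<exists>\<theta>. inverse_arrows C (fobj F X) (fobj G X) (\<eta> X) \<theta>) \<and>
     (\<forall>X Y. \<forall>f \<in> Arr C X Y.
        Comp C (fobj F X) (fobj F Y) (fobj G Y) (\<eta> Y) (farr F X Y f) =
        Comp C (fobj F X) (fobj G X) (fobj G Y) (farr G X Y f) (\<eta> X)))"

definition autoequivalence ::
    "'k ring \<Rightarrow> ('k, 'o, 'm, 'z) lincat_scheme \<Rightarrow> ('o, 'm) endofunctor \<Rightarrow> bool" where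
  "autoequivalence K C F \<longleftrightarrow> linear_functor K C F \<and>
     (\<exists>G. linear_functor K C G \<and> naturally_isomorphic C (comp_functor G F) id_functor \<and>
        naturally_isomorphic C (comp_functor F G) id_functor)"

definition regular_module :: "'k ring \<Rightarrow> ('k, 'k) module" where
  "regular_module K = \<lparr>carrier = carrier K, monoid.mult = monoid.mult K, one = \<one>\<^bsub>K\<^esub>,
     ring.zero = \<zero>\<^bsub>K\<^esub>, ring.add = ring.add K, module.smult = monoid.mult K\<rparr>"

text \<open>
  The dual of a vector space.  Functionals are extensional functions, so that distinct elements
  of the carrier differ on \<open>V\<close>.  The fields \<open>mult\<close> and \<open>one\<close>, which the record type \<open>module\<close>
  inherits from rings, play no role, here and in \<open>quotient_module\<close> below.
\<close>

definition dual_space :: "'k ring \<Rightarrow> ('k, 'm) module \<Rightarrow> ('k, 'm \<Rightarrow> 'k) module" where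
  "dual_space K V = (ring.func_space K (carrier V))
     \<lparr>carrier := module_hom K V (regular_module K) \<inter> extensional (carrier V)\<rparr>"

text \<open>
  A Serre functor: an auto-equivalence $S$ with linear isomorphisms
  $\eta_{X,Y} : \mathrm{Hom}(Y, S X) \to D\,\mathrm{Hom}(X, Y)$.  The last two clauses are their
  naturality in $X$ (along $f : X \to X'$) and in $Y$ (along $k : Y' \to Y$), with both sides
  evaluated at a morphism $h$.
\<close>

definition serre_functor ::
    "'k ring \<Rightarrow> ('k, 'o, 'm, 'z) lincat_scheme \<Rightarrow> ('o, 'm) endofunctor \<Rightarrow> bool" where
  "serre_functor K C S \<longleftrightarrow> autoequivalence K C S \<and> (\<exists>\<eta>.
     (\<forall>X Y. \<eta> X Y \<in> module_hom K (Hom C Y (fobj S X)) (dual_space K (Hom C X Y)) \<and>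
        bij_betw (\<eta> X Y) (Arr C Y (fobj S X)) (carrier (dual_space K (Hom C X Y)))) \<and>
     (\<forall>X X' Y. \<forall>f \<in> Arr C X X'. \<forall>g \<in> Arr C Y (fobj S X). \<forall>h \<in> Arr C X' Y.
        \<eta> X' Y (Comp C Y (fobj S X) (fobj S X') (farr S X X' f) g) h =
        \<eta> X Y g (Comp C X X' Y h f)) \<and>
     (\<forall>X Y Y'. \<forall>k \<in> Arr C Y' Y. \<forall>g \<in> Arr C Y (fobj S X). \<forall>h \<in> Arr C X Y'.
        \<eta> X Y' (Comp C Y' Y (fobj S X) g k) h = \<eta> X Y g (Comp C X Y' Y k h)))"

subsection \<open>Quotient by an ideal of morphisms\<close>

definition quotient_module :: "('k, 'm) module \<Rightarrow> 'm set \<Rightarrow> ('k, 'm set) module" where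
  "quotient_module M N = \<lparr>carrier = a_rcosets\<^bsub>M\<^esub> N, monoid.mult = (\<lambda>A B. N), one = N,
     ring.zero = N, ring.add = (\<lambda>A B. A <+>\<^bsub>M\<^esub> B),
     module.smult = (\<lambda>a A. \<Union>x\<in>A. N +>\<^bsub>M\<^esub> (a \<odot>\<^bsub>M\<^esub> x))\<rparr>"

definition factoring_through ::
    "('k, 'o, 'm, 'z) lincat_scheme \<Rightarrow> 'o set \<Rightarrow> 'o \<Rightarrow> 'o \<Rightarrow> 'm set" where
  "factoring_through C A X Y =
     {Comp C X W Y g f | W f g. W \<in> A \<and> f \<in> Arr C X W \<and> g \<in> Arr C W Y}"

definition quotient_category ::
    "('k, 'o, 'm, 'z) lincat_scheme \<Rightarrow> ('o \<Rightarrow> 'o \<Rightarrow> 'm set) \<Rightarrow> ('k, 'o, 'm set) lincat" where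
  "quotient_category C I = \<lparr>Hom = (\<lambda>X Y. quotient_module (Hom C X Y) (I X Y)),
     Comp = (\<lambda>X Y Z G F. \<Union>g\<in>G. \<Union>f\<in>F. I X Z +>\<^bsub>Hom C X Z\<^esub> Comp C X Y Z g f),
     Ident = (\<lambda>X. I X X +>\<^bsub>Hom C X X\<^esub> Ident C X)\<rparr>"

section \<open>$(d+2)$-angulated categories\<close>

text \<open>
  A $\Sigma^d$-sequence $c^0 \to c^1 \to \cdots \to c^{d+1} \to \Sigma^d(c^0)$ is given by functions
  \<open>c\<close> and \<open>\<gamma>\<close> on the natural numbers, with \<open>c (d + 2)\<close> the last object $\Sigma^d(c^0)$ and
  \<open>\<gamma> i : c i \<rightarrow> c (i + 1)\<close>.  Only the values \<open>c i\<close> for \<open>i \<le> d + 2\<close> and \<open>\<gamma> i\<close> for \<open>i \<le> d + 1\<close>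
  are meaningful; the other values are arbitrary, and closure of the class of \<open>(d + 2)\<close>-angles
  under sums and summands (with a zero sequence) makes it independent of them.  The field
  \<open>shift\<close> is $\Sigma^d$ itself.
\<close>

record ('k, 'o, 'm) angcat = "('k, 'o, 'm) lincat" +
  shift :: "('o, 'm) endofunctor"
  angle :: "(nat \<Rightarrow> 'o) \<Rightarrow> (nat \<Rightarrow> 'm) \<Rightarrow> bool"

abbreviation Sob :: "('k, 'o, 'm, 'z) angcat_scheme \<Rightarrow> 'o \<Rightarrow> 'o" where
  "Sob C \<equiv> fobj (shift C)"

abbreviation Sarr :: "('k, 'o, 'm, 'z) angcat_scheme \<Rightarrow> 'o \<Rightarrow> 'o \<Rightarrow> 'm \<Rightarrow> 'm" where
  "Sarr C \<equiv> farr (shift C)"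

definition sigma_seq ::
    "nat \<Rightarrow> ('k, 'o, 'm, 'z) angcat_scheme \<Rightarrow> (nat \<Rightarrow> 'o) \<Rightarrow> (nat \<Rightarrow> 'm) \<Rightarrow> bool" where
  "sigma_seq d C c \<gamma> \<longleftrightarrow> c (d + 2) = Sob C (c 0) \<and> (\<forall>i\<le>d + 1. \<gamma> i \<in> Arr C (c i) (c (i + 1)))"

definition seq_morphism ::
    "nat \<Rightarrow> ('k, 'o, 'm, 'z) angcat_scheme \<Rightarrow> (nat \<Rightarrow> 'o) \<Rightarrow> (nat \<Rightarrow> 'm) \<Rightarrow>
     (nat \<Rightarrow> 'o) \<Rightarrow> (nat \<Rightarrow> 'm) \<Rightarrow> (nat \<Rightarrow> 'm) \<Rightarrow> bool" where
  "seq_morphism d C b \<beta> c \<gamma> \<phi> \<longleftrightarrow>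
     (\<forall>i\<le>d + 2. \<phi> i \<in> Arr C (b i) (c i)) \<and> \<phi> (d + 2) = Sarr C (b 0) (c 0) (\<phi> 0) \<and>
     (\<forall>i\<le>d + 1. Comp C (b i) (b (i + 1)) (c (i + 1)) (\<phi> (i + 1)) (\<beta> i) =
        Comp C (b i) (c i) (c (i + 1)) (\<gamma> i) (\<phi> i))"

definition is_seq_sum ::
    "nat \<Rightarrow> ('k, 'o, 'm, 'z) angcat_scheme \<Rightarrow> (nat \<Rightarrow> 'o) \<Rightarrow> (nat \<Rightarrow> 'm) \<Rightarrow>
     (nat \<Rightarrow> 'o) \<Rightarrow> (nat \<Rightarrow> 'm) \<Rightarrow> (nat \<Rightarrow> 'o) \<Rightarrow> (nat \<Rightarrow> 'm) \<Rightarrow> bool" where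
  "is_seq_sum d C p \<rho> b \<beta> c \<gamma> \<longleftrightarrow> (\<exists>i1 i2 p1 p2.
     seq_morphism d C b \<beta> p \<rho> i1 \<and> seq_morphism d C c \<gamma> p \<rho> i2 \<and>
     seq_morphism d C p \<rho> b \<beta> p1 \<and> seq_morphism d C p \<rho> c \<gamma> p2 \<and>
     (\<forall>i\<le>d + 1. biproduct C (p i) (b i) (c i) (i1 i) (i2 i) (p1 i) (p2 i)))"

definition rot_obj :: "nat \<Rightarrow> ('k, 'o, 'm, 'z) angcat_scheme \<Rightarrow> (nat \<Rightarrow> 'o) \<Rightarrow> nat \<Rightarrow> 'o" where
  "rot_obj d C c i = (if i \<le> d + 1 then c (i + 1) else Sob C (c 1))"

definition rot_arr ::
    "nat \<Rightarrow> ('k, 'o, 'm, 'z) angcat_scheme \<Rightarrow> (nat \<Rightarrow> 'o) \<Rightarrow> (nat \<Rightarrow> 'm) \<Rightarrow> nat \<Rightarrow> 'm" where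
  "rot_arr d C c \<gamma> i =
     (if i \<le> d then \<gamma> (i + 1)
      else if even d then Sarr C (c 0) (c 1) (\<gamma> 0)
      else \<ominus>\<^bsub>Hom C (Sob C (c 0)) (Sob C (c 1))\<^esub> Sarr C (c 0) (c 1) (\<gamma> 0))"

text \<open>
  \<open>p\<close>, \<open>\<rho>\<close> is a mapping cone of \<open>\<phi>\<close>.  Its object in degree \<open>i\<close> is a direct sum of
  \<open>rot_obj d C b i\<close> and \<open>c i\<close>; in degree \<open>d + 2\<close> the structure maps of the direct sum are the
  shifts of those in degree \<open>0\<close>.  The last four clauses give the entries of the matrix of
  \<open>\<rho> i\<close>.  The entry containing \<open>\<beta>\<close> differs from \<open>rot_arr\<close>: its last instance is
  $-\Sigma^d(\beta^0)$, whatever the parity of \<open>d\<close>.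
\<close>

definition is_mapping_cone ::
    "nat \<Rightarrow> ('k, 'o, 'm, 'z) angcat_scheme \<Rightarrow> (nat \<Rightarrow> 'o) \<Rightarrow> (nat \<Rightarrow> 'm) \<Rightarrow>
     (nat \<Rightarrow> 'o) \<Rightarrow> (nat \<Rightarrow> 'm) \<Rightarrow> (nat \<Rightarrow> 'm) \<Rightarrow> (nat \<Rightarrow> 'o) \<Rightarrow> (nat \<Rightarrow> 'm) \<Rightarrow> bool" where
  "is_mapping_cone d C b \<beta> c \<gamma> \<phi> p \<rho> \<longleftrightarrow> sigma_seq d C p \<rho> \<and>
     (let b' = rot_obj d C b;
          \<beta>' = (\<lambda>i. if i \<le> d then \<beta> (i + 1) else Sarr C (b 0) (b 1) (\<beta> 0));
          entry = (\<lambda>i X Y \<pi> \<iota>. Comp C X (p (i + 1)) Y \<pi> (Comp C X (p i) (p (i + 1)) (\<rho> i) \<iota>))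
      in \<exists>i1 i2 p1 p2.
       (\<forall>i\<le>d + 1. biproduct C (p i) (b' i) (c i) (i1 i) (i2 i) (p1 i) (p2 i)) \<and>
       i1 (d + 2) = Sarr C (b' 0) (p 0) (i1 0) \<and> i2 (d + 2) = Sarr C (c 0) (p 0) (i2 0) \<and>
       p1 (d + 2) = Sarr C (p 0) (b' 0) (p1 0) \<and> p2 (d + 2) = Sarr C (p 0) (c 0) (p2 0) \<and>
       (\<forall>i\<le>d + 1.
          entry i (b' i) (b' (i + 1)) (p1 (i + 1)) (i1 i) = \<ominus>\<^bsub>Hom C (b' i) (b' (i + 1))\<^esub> \<beta>' i \<and>
          entry i (c i) (b' (i + 1)) (p1 (i + 1)) (i2 i) = Zero C (c i) (b' (i + 1)) \<and>
          entry i (b' i) (c (i + 1)) (p2 (i + 1)) (i1 i) = \<phi> (i + 1) \<and>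
          entry i (c i) (c (i + 1)) (p2 (i + 1)) (i2 i) = \<gamma> i))"

locale angulated_category = additive_category K C
  for K :: "'k ring" and d :: nat and C :: "('k, 'o, 'm, 'z) angcat_scheme" +
  assumes d_pos: "d \<ge> 1"
    and shift_automorphism: "automorphism K C (shift C)"
    and angle_seq: "angle C c \<gamma> \<Longrightarrow> sigma_seq d C c \<gamma>"
    and N1_sums:
      "\<lbrakk>sigma_seq d C b \<beta>; sigma_seq d C c \<gamma>; sigma_seq d C p \<rho>; is_seq_sum d C p \<rho> b \<beta> c \<gamma>\<rbrakk> \<Longrightarrow>
        angle C p \<rho> \<longleftrightarrow> angle C b \<beta> \<and> angle C c \<gamma>"
    and N1_trivial:
      "\<lbrakk>sigma_seq d C c \<gamma>; c 1 = c 0; \<gamma> 0 = Ident C (c 0); \<forall>i\<in>{2..d + 1}. zero_object C (c i)\<rbrakk> \<Longrightarrow>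
        angle C c \<gamma>"
    and N1_extend:
      "f \<in> Arr C X Y \<Longrightarrow> \<exists>c \<gamma>. angle C c \<gamma> \<and> c 0 = X \<and> c 1 = Y \<and> \<gamma> 0 = f"
    and N2:
      "sigma_seq d C c \<gamma> \<Longrightarrow> angle C c \<gamma> \<longleftrightarrow> angle C (rot_obj d C c) (rot_arr d C c \<gamma>)"
    and N3:
      "\<lbrakk>angle C b \<beta>; angle C c \<gamma>; f \<in> Arr C (b 0) (c 0); g \<in> Arr C (b 1) (c 1);
        Comp C (b 0) (b 1) (c 1) g (\<beta> 0) = Comp C (b 0) (c 0) (c 1) (\<gamma> 0) f\<rbrakk> \<Longrightarrow>
        \<exists>\<phi>. seq_morphism d C b \<beta> c \<gamma> \<phi> \<and> \<phi> 0 = f \<and> \<phi> 1 = g"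
    and N4:
      "\<lbrakk>angle C b \<beta>; angle C c \<gamma>; f \<in> Arr C (b 0) (c 0); g \<in> Arr C (b 1) (c 1);
        Comp C (b 0) (b 1) (c 1) g (\<beta> 0) = Comp C (b 0) (c 0) (c 1) (\<gamma> 0) f\<rbrakk> \<Longrightarrow>
        \<exists>\<phi>. seq_morphism d C b \<beta> c \<gamma> \<phi> \<and> \<phi> 0 = f \<and> \<phi> 1 = g \<and>
          (\<exists>p \<rho>. is_mapping_cone d C b \<beta> c \<gamma> \<phi> p \<rho> \<and> angle C p \<rho>)"

definition calabi_yau :: "'k ring \<Rightarrow> ('k, 'o, 'm, 'z) angcat_scheme \<Rightarrow> bool" where
  "calabi_yau K C \<longleftrightarrow> (\<exists>S. serre_functor K C S \<and>
     naturally_isomorphic C S (comp_functor (shift C) (shift C)))"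

section \<open>Oppermann-Thomas cluster tilting\<close>

text \<open>A $(d+2)$-angle $t_d \to \cdots \to t_0 \to x \to \Sigma^d(t_d)$ has \<open>t\<^sub>i = c (d - i)\<close>.\<close>

definition resolution ::
    "nat \<Rightarrow> ('k, 'o, 'm, 'z) angcat_scheme \<Rightarrow> 'o set \<Rightarrow> 'o \<Rightarrow> (nat \<Rightarrow> 'o) \<Rightarrow> (nat \<Rightarrow> 'm) \<Rightarrow> bool" where
  "resolution d C A x c \<gamma> \<longleftrightarrow> angle C c \<gamma> \<and> c (d + 1) = x \<and> (\<forall>i\<le>d. c (d - i) \<in> A)"

definition OT_cluster_tilting :: "nat \<Rightarrow> ('k, 'o, 'm, 'z) angcat_scheme \<Rightarrow> 'o \<Rightarrow> bool" where
  "OT_cluster_tilting d C T \<longleftrightarrow>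
     (\<forall>X \<in> add_of C T. \<forall>Y \<in> add_of C T. Arr C X (Sob C Y) = {Zero C X (Sob C Y)}) \<and>
     (\<forall>x. \<exists>c \<gamma>. resolution d C (add_of C T) x c \<gamma>)"

text \<open>
  \<open>V\<close> below is the object whose indecomposable summands are, up to isomorphism, those of \<open>U\<close>
  with \<open>u\<close> removed and \<open>u'\<close> added.
\<close>

definition mutation :: "nat \<Rightarrow> ('k, 'o, 'm, 'z) angcat_scheme \<Rightarrow> 'o \<Rightarrow> 'o \<Rightarrow> 'o \<Rightarrow> bool" where
  "mutation d C U u u' \<longleftrightarrow> basic C U \<and> OT_cluster_tilting d C U \<and>
     indec_summand C u U \<and> indecomposable C u' \<and>
     (\<exists>V. basic C V \<and> OT_cluster_tilting d C V \<and>
        (\<forall>X. indec_summand C X V \<longleftrightarrow>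
           (indec_summand C X U \<and> \<not> isomorphic C X u) \<or>
           (indecomposable C X \<and> isomorphic C X u')))"

definition exchange_pair ::
    "'k ring \<Rightarrow> nat \<Rightarrow> ('k, 'o, 'm, 'z) angcat_scheme \<Rightarrow> 'o \<Rightarrow> 'o \<Rightarrow> 'o \<Rightarrow> bool" where
  "exchange_pair K d C U u u' \<longleftrightarrow> mutation d C U u u' \<and>
     hom_dim K C u (Sob C u') = 1 \<and> hom_dim K C u' (Sob C u) = 1 \<and>
     (let E = {X. \<exists>Xs. is_list_sum C X Xs \<and>
                set Xs \<subseteq> {v \<in> Indec C (add_of C U). \<not> isomorphic C v u}}
      in (\<exists>c \<gamma>. angle C c \<gamma> \<and> c 0 = u' \<and> c (d + 1) = u \<and> (\<forall>i\<in>{1..d}. c i \<in> E)) \<and>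
         (\<exists>c \<gamma>. angle C c \<gamma> \<and> c 0 = u \<and> c (d + 1) = u' \<and> (\<forall>i\<in>{1..d}. c i \<in> E)))"

section \<open>Index and homological $c$-vectors\<close>

text \<open>The split Grothendieck group, a quotient of the library's free abelian group and hence written
  multiplicatively; \<open>K0_class C A t\<close> is its element $[t]$.\<close>

definition split_relations :: "('k, 'o, 'm, 'z) lincat_scheme \<Rightarrow> 'o set \<Rightarrow> ('o \<Rightarrow>\<^sub>0 int) set" where
  "split_relations C A = generate (free_Abelian_group A)
     {frag_of t - (frag_of t0 + frag_of t1) | t t0 t1.
        t \<in> A \<and> t0 \<in> A \<and> t1 \<in> A \<and> is_sum C t t0 t1}"

definition K0_split ::
    "('k, 'o, 'm, 'z) lincat_scheme \<Rightarrow> 'o set \<Rightarrow> ('o \<Rightarrow>\<^sub>0 int) set monoid" where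
  "K0_split C A = free_Abelian_group A Mod split_relations C A"

definition K0_class ::
    "('k, 'o, 'm, 'z) lincat_scheme \<Rightarrow> 'o set \<Rightarrow> 'o \<Rightarrow> ('o \<Rightarrow>\<^sub>0 int) set" where
  "K0_class C A t = split_relations C A #>\<^bsub>free_Abelian_group A\<^esub> frag_of t"

definition index ::
    "nat \<Rightarrow> ('k, 'o, 'm, 'z) angcat_scheme \<Rightarrow> 'o set \<Rightarrow> 'o \<Rightarrow> ('o \<Rightarrow>\<^sub>0 int) set" where
  "index d C A x = (THE k. \<exists>c \<gamma>. resolution d C A x c \<gamma> \<and>
     k = (\<Otimes>\<^bsub>K0_split C A\<^esub> i \<in> {..d}. K0_class C A (c (d - i)) [^]\<^bsub>K0_split C A\<^esub> ((- 1) ^ i :: int)))"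

text \<open>Extensionality makes the homomorphisms to $\mathbb{Z}$ unique as functions.\<close>

definition int_dual :: "'a monoid \<Rightarrow> ('a \<Rightarrow> int) set" where
  "int_dual G = hom G integer_group \<inter> extensional (carrier G)"

definition c_vector ::
    "nat \<Rightarrow> ('k, 'o, 'm, 'z) angcat_scheme \<Rightarrow> 'o set \<Rightarrow> 'o \<Rightarrow> 'o set \<Rightarrow> ('o \<Rightarrow>\<^sub>0 int) set \<Rightarrow> int" where
  "c_vector d C A u B = (THE \<phi>. \<phi> \<in> int_dual (K0_split C A) \<and>
     (\<forall>v \<in> Indec C B. \<phi> (index d C A v) = (if isomorphic C u v then 1 else 0)))"

end

theory Submission imports Defs
begin

text \<open>
  For a cluster tilting \<open>\<T>\<close>, the alternating sum of the dimensions of $\mathrm{Hom}(t_i, Y)$ over a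
  resolution of \<open>X\<close> depends only on \<open>X\<close>: it is
  $\langle X, Y\rangle_{\mathscr{T}} = \dim \mathrm{Hom}(X, Y) - \dim I(X, Y) + (-1)^d \dim I(X, \Sigma^d Y)$,
  where \<open>I\<close> consists of the morphisms that vanish on all morphisms from \<open>\<T>\<close>, which are those factoring
  through $\Sigma^d\mathscr{T}$.  This form is additive on angles whose last morphism lies in \<open>I\<close>.
  The functions $\dim \mathrm{Hom}(-, Y)$ separate the elements of the split Grothendieck group, so the
  index is determined by the form.  Applied to the shift of a \<open>\<T>\<close>-resolution of \<open>v \<in> \<U>\<close>, additivity shows
  that $t \mapsto (-1)^d \langle \Sigma^d t, \Sigma^d u^*\rangle_{\mathscr{U}}$ sends the index of \<open>v\<close> to
  $\dim \mathrm{Hom}(v, \Sigma^d u^*) = \delta_{uv}$; hence it is the $c$-vector.  Serre duality turns the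
  last term of the form into the dimension of the second quotient space.

  If both quotient spaces were non-zero, there would be $f : t \to u^*$ and $g : u^* \to \Sigma^d t$ with
  $e f \neq 0$ and $l g \neq 0$ for some $e : u^* \to \Sigma^d u$ and $l : \Sigma^d t \to \Sigma^d u$.  As
  $\mathrm{Hom}(u^*, \Sigma^d u)$ is one-dimensional, \<open>e\<close> is a multiple of \<open>l g\<close>, so \<open>e f\<close> is one of
  \<open>l g f\<close>, and $g f \in \mathrm{Hom}(t, \Sigma^d t) = 0$.
\<close>

section \<open>Finite-dimensional linear algebra\<close>

text \<open>The index and the c-vector are definite descriptions that must be justified along the
  way, so additivity of the form is used twice, with the roles of T and U exchanged. For the form of
  U it gives existence of the c-vector, as described. For the form of T it is applied to a
  U-resolution of Sigma^d t, whose last morphism starts in Sigma^d T. This writes [t] as a signed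
  sum of indices of objects of U, so a functional is determined by its values on these indices.

  The obstacle to additivity is that I(-, Y) is only a subfunctor of Hom(-, Y): an element of I may
  extend along the angle to a morphism outside I. A shifted resolution of Y removes it. Elements of
  I lift to its term in Sigma^d T next to Y, the extension is made there, and whatever passes
  through that term lies in I.

  Separation rests on Serre duality: each indecomposable x has a non-zero morphism x -> Sigma^2d x
  killing all morphisms from other indecomposables, and the angle on it yields the objects Y of a
  combination of functions dim Hom(-, Y) that is non-zero at x only.\<close>

definition sdim :: "'k ring \<Rightarrow> ('k, 'm) module \<Rightarrow> 'm set \<Rightarrow> nat" where
  "sdim K V W = vectorspace.dim K (V\<lparr>carrier := W\<rparr>)"

lemma sdim_carrier: "sdim K V (carrier V) = vectorspace.dim K V"
  by (simp add: sdim_def)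

lemma linear_mapI:
  assumes "vectorspace K V" "vectorspace K V'" "T \<in> module_hom K V V'"
  shows "linear_map K V V' T"
  using assms by (simp add: linear_map_def mod_hom_def mod_hom_axioms_def vectorspace_def)

lemma subspaceI:
  assumes "vectorspace K V" "W \<subseteq> carrier V" "\<zero>\<^bsub>V\<^esub> \<in> W"
    and "\<And>v w. v \<in> W \<Longrightarrow> w \<in> W \<Longrightarrow> v \<oplus>\<^bsub>V\<^esub> w \<in> W"
    and "\<And>c v. c \<in> carrier K \<Longrightarrow> v \<in> W \<Longrightarrow> c \<odot>\<^bsub>V\<^esub> v \<in> W"
  shows "subspace K W V"
  using assms by (auto simp: subspace_def submodule_def vectorspace_def)

lemma subspace_carrier:
  assumes "vectorspace K V"
  shows "subspace K (carrier V) V"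
proof -
  interpret vectorspace K V by fact
  show ?thesis by (rule subspaceI) (use assms in auto)
qed

lemma subspace_subset: "subspace K W V \<Longrightarrow> W \<subseteq> carrier V"
  by (simp add: subspace_def submodule_def)

lemma subspace_vectorspace: "subspace K W V \<Longrightarrow> vectorspace K (V\<lparr>carrier := W\<rparr>)"
  by (rule vectorspace.subspace_is_vs) (auto simp: subspace_def)

text \<open>Independence in \<open>W\<close> is independence in \<open>V\<close>, so independent
  subsets of \<open>W\<close> have at most dim V elements. A maximal one therefore exists, and it
  generates \<open>W\<close>.\<close>

lemma fin_dim_subspace:
  assumes "vectorspace.fin_dim K V" "subspace K W V"
  shows "vectorspace.fin_dim K (V\<lparr>carrier := W\<rparr>)"
proof -
  interpret V: vectorspace K V using assms(2) by (simp add: subspace_def)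
  interpret W: vectorspace K "V\<lparr>carrier := W\<rparr>" by (rule subspace_vectorspace) fact
  have sub: "submodule K W V" and WV: "W \<subseteq> carrier V"
    using assms(2) by (simp_all add: subspace_def submodule_def)
  let ?P = "\<lambda>S. S \<subseteq> W \<and> W.lin_indpt S"
  have "finite A \<and> card A \<le> V.dim" if "?P A" for A
  proof -
    have "V.lin_indpt A" using V.span_li_not_depend(2)[OF _ sub, of A] that by simp
    thus ?thesis using V.li_le_dim[OF assms(1)] that WV by blast
  qed
  moreover have "?P {}" by (simp add: W.lin_dep_def)
  ultimately obtain A where A: "finite A" "maximal A ?P"
    using maximal_exists[of ?P V.dim "{}"] by blast
  hence "W.gen_set A" using W.max_li_is_gen[of A] by simp
  moreover have "A \<subseteq> W" using A(2) by (simp add: maximal_def)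
  ultimately show ?thesis using A(1) by (auto simp: W.fin_dim_def)
qed

lemma module_hom_subspace:
  assumes "T \<in> module_hom K V V'" "W \<subseteq> carrier V"
  shows "T \<in> module_hom K (V\<lparr>carrier := W\<rparr>) V'"
  using assms by (fastforce simp: module_hom_def)

text \<open>The form used for all dimension counts: images and kernels are subsets of fixed ambient
  spaces, so the kernel of one map and the image of the next can be compared as sets.\<close>

lemma rank_nullity_subspace:
  assumes "vectorspace.fin_dim K V" "subspace K W V" "vectorspace K V'" "T \<in> module_hom K V V'"
  shows "sdim K V' (T ` W) + sdim K V {v \<in> W. T v = \<zero>\<^bsub>V'\<^esub>} = sdim K V W"
proof -
  interpret linear_map K "V\<lparr>carrier := W\<rparr>" V' T
    using assms(2-4) module_hom_subspace[OF assms(4) subspace_subset[OF assms(2)]]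
    by (intro linear_mapI subspace_vectorspace)
  show ?thesis
    using rank_nullity[OF fin_dim_subspace[OF assms(1,2)]] by (simp add: sdim_def im_def ker_def)
qed

lemma sdim_zero:
  assumes "vectorspace K V"
  shows "sdim K V {\<zero>\<^bsub>V\<^esub>} = 0"
proof -
  interpret V: vectorspace K V by fact
  have "subspace K {\<zero>\<^bsub>V\<^esub>} V" by (rule subspaceI) (use assms in auto)
  then interpret W: vectorspace K "V\<lparr>carrier := {\<zero>\<^bsub>V\<^esub>}\<rparr>" by (rule subspace_vectorspace)
  have "W.gen_set {\<zero>\<^bsub>V\<^esub>}"
    using W.in_own_span[of "{\<zero>\<^bsub>V\<^esub>}"] W.span_is_subset2[of "{\<zero>\<^bsub>V\<^esub>}"] by force
  thus ?thesis using W.dim0I by (simp add: sdim_def)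
qed

lemma sdim_eq_0:
  assumes "vectorspace.fin_dim K V" "subspace K W V"
  shows "sdim K V W = 0 \<longleftrightarrow> W = {\<zero>\<^bsub>V\<^esub>}"
proof
  interpret V: vectorspace K V using assms(2) by (simp add: subspace_def)
  interpret W: vectorspace K "V\<lparr>carrier := W\<rparr>" by (rule subspace_vectorspace) fact
  assume d: "sdim K V W = 0"
  obtain B where B: "finite B" "W.basis B"
    using W.finite_basis_exists[OF fin_dim_subspace[OF assms]] by blast
  hence "B = {}" using W.dim_basis d by (auto simp: sdim_def)
  hence "W.span {} = W" using B(2) by (simp add: W.basis_def)
  thus "W = {\<zero>\<^bsub>V\<^esub>}" using W.span_empty by simp
next
  assume "W = {\<zero>\<^bsub>V\<^esub>}"
  thus "sdim K V W = 0" using sdim_zero assms(2) by (auto simp: subspace_def)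
qed

lemma sdim_image_inj:
  assumes "vectorspace.fin_dim K V" "subspace K W V" "vectorspace K V'" "T \<in> module_hom K V V'"
    and "inj_on T W"
  shows "sdim K V' (T ` W) = sdim K V W"
proof -
  interpret linear_map K V V' T using assms by (intro linear_mapI) (auto simp: subspace_def)
  have "\<zero>\<^bsub>V\<^esub> \<in> W" using assms(2) by (simp add: subspace_def submodule_def)
  hence "{v \<in> W. T v = \<zero>\<^bsub>V'\<^esub>} = {\<zero>\<^bsub>V\<^esub>}"
    using assms(5) by (auto dest: inj_onD[of T W _ "\<zero>\<^bsub>V\<^esub>"])
  thus ?thesis using rank_nullity_subspace[OF assms(1-4)] sdim_zero[of K V] assms(2)
    by (simp add: subspace_def)
qed

lemma dim_1_span:
  assumes "vectorspace K V" "vectorspace.fin_dim K V" "vectorspace.dim K V = 1"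
    and "e \<in> carrier V" "e \<noteq> \<zero>\<^bsub>V\<^esub>" "v \<in> carrier V"
  shows "\<exists>a\<in>carrier K. v = a \<odot>\<^bsub>V\<^esub> e"
proof -
  interpret V: vectorspace K V by fact
  have "e \<notin> V.span {}" using V.span_empty assms(5) by simp
  hence "V.lin_indpt {e}" using V.lin_dep_iff_in_span[of "{}" e] assms(4)
    by (auto simp: V.lin_dep_def)
  hence "V.basis {e}" using V.dim_li_is_basis[of "{e}"] assms by simp
  hence "v \<in> V.span {e}" using assms(6) by (simp add: V.basis_def)
  then obtain a A where A: "A \<subseteq> {e}" "a \<in> A \<rightarrow> carrier K" "v = V.lincomb a A"
    by (auto simp: V.span_def)
  show ?thesis
  proof (cases "A = {}")
    case True
    thus ?thesis using A(3) assms(4) by (intro bexI[of _ "\<zero>\<^bsub>K\<^esub>"]) (auto simp: V.lincomb_def)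
  next
    case False
    hence "A = {e}" using A(1) by blast
    thus ?thesis using A assms(4) by (auto simp: V.lincomb_def)
  qed
qed

section \<open>Bases, linear functionals and annihilators\<close>

lemma exists_functional:
  assumes "vectorspace K V" "finite B" "vectorspace.basis K V B" "\<phi> \<in> B \<rightarrow> carrier K"
  shows "\<exists>f \<in> module_hom K V (regular_module K). \<forall>b\<in>B. f b = \<phi> b"
proof -
  interpret V: vectorspace K V by fact
  have BV: "B \<subseteq> carrier V" using assms(3) by (simp add: V.basis_def)
  have ex1: "\<exists>!a. a \<in> B \<rightarrow>\<^sub>E carrier K \<and> V.lincomb a B = v" if "v \<in> carrier V" for v
    using V.basis_criterion[OF assms(2) BV] assms(3) that by blast
  \<comment> \<open>The coordinates of \<open>v\<close> in the basis. Extensionality makes them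
    unique as a function, so linearity of \<open>cf\<close> follows from uniqueness.\<close>
  define cf where "cf v = (THE a. a \<in> B \<rightarrow>\<^sub>E carrier K \<and> V.lincomb a B = v)" for v
  have cf: "cf v \<in> B \<rightarrow>\<^sub>E carrier K" "V.lincomb (cf v) B = v" if "v \<in> carrier V" for v
    using theI'[OF ex1[OF that]] by (auto simp: cf_def)
  have cf_unique: "cf v = a" if "a \<in> B \<rightarrow>\<^sub>E carrier K" "V.lincomb a B = v" "v \<in> carrier V" for v a
    using ex1[OF that(3)] cf[OF that(3)] that by blast
  interpret F: linear_map K "V.func_space B" V "\<lambda>a. V.lincomb a B"
    by (rule V.lincomb_is_linear[OF assms(2) BV])
  have cf_add: "cf (v \<oplus>\<^bsub>V\<^esub> w) = (\<lambda>b\<in>B. cf v b \<oplus>\<^bsub>K\<^esub> cf w b)"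
    if "v \<in> carrier V" "w \<in> carrier V" for v w
    using cf[OF that(1)] cf[OF that(2)] that F.T_add[of "cf v" "cf w"]
    by (intro cf_unique) (auto simp: V.func_space_def)
  have cf_smult: "cf (c \<odot>\<^bsub>V\<^esub> v) = (\<lambda>b\<in>B. c \<otimes>\<^bsub>K\<^esub> cf v b)"
    if "c \<in> carrier K" "v \<in> carrier V" for v c
    using cf[OF that(2)] that F.T_smult[of c "cf v"]
    by (intro cf_unique) (auto simp: V.func_space_def)
  have cf_basis: "cf b = (\<lambda>b'\<in>B. if b' = b then \<one>\<^bsub>K\<^esub> else \<zero>\<^bsub>K\<^esub>)" if "b \<in> B" for b
  proof (rule cf_unique)
    have "V.lincomb (\<lambda>b'\<in>B. if b' = b then \<one>\<^bsub>K\<^esub> else \<zero>\<^bsub>K\<^esub>) B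
        = (\<Oplus>\<^bsub>V\<^esub>b'\<in>B. if b = b' then b' else \<zero>\<^bsub>V\<^esub>)"
      unfolding V.lincomb_def using BV by (intro V.M.finsum_cong') auto
    also have "\<dots> = b" using V.M.finsum_singleton[OF that assms(2), of "\<lambda>b. b"] BV by auto
    finally show "V.lincomb (\<lambda>b'\<in>B. if b' = b then \<one>\<^bsub>K\<^esub> else \<zero>\<^bsub>K\<^esub>) B = b" .
  qed (use that BV in auto)
  have cfB: "cf v b \<in> carrier K" if "v \<in> carrier V" "b \<in> B" for v b
    using cf(1)[OF that(1)] that(2) by auto
  have \<phi>B: "\<phi> b \<in> carrier K" if "b \<in> B" for b
    using assms(4) that by auto
  define f where "f v = (\<Oplus>\<^bsub>K\<^esub>b\<in>B. cf v b \<otimes>\<^bsub>K\<^esub> \<phi> b)" for v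
  have "f \<in> module_hom K V (regular_module K)"
    unfolding module_hom_def
  proof (intro CollectI conjI allI impI)
    show "f \<in> carrier V \<rightarrow> carrier (regular_module K)"
      using cfB \<phi>B by (auto simp: f_def regular_module_def intro!: V.R.finsum_closed)
  next
    fix v w assume vw: "v \<in> carrier V \<and> w \<in> carrier V"
    have "f (v \<oplus>\<^bsub>V\<^esub> w) = (\<Oplus>\<^bsub>K\<^esub>b\<in>B. cf v b \<otimes>\<^bsub>K\<^esub> \<phi> b \<oplus>\<^bsub>K\<^esub> cf w b \<otimes>\<^bsub>K\<^esub> \<phi> b)"
      unfolding f_def using vw cfB \<phi>B
      by (intro V.R.finsum_cong') (auto simp: cf_add V.R.l_distr)
    also have "\<dots> = f v \<oplus>\<^bsub>K\<^esub> f w"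
      unfolding f_def using vw cfB \<phi>B by (intro V.R.finsum_addf) auto
    finally show "f (v \<oplus>\<^bsub>V\<^esub> w) = f v \<oplus>\<^bsub>regular_module K\<^esub> f w" by (simp add: regular_module_def)
  next
    fix c v assume cv: "c \<in> carrier K \<and> v \<in> carrier V"
    have "f (c \<odot>\<^bsub>V\<^esub> v) = (\<Oplus>\<^bsub>K\<^esub>b\<in>B. c \<otimes>\<^bsub>K\<^esub> (cf v b \<otimes>\<^bsub>K\<^esub> \<phi> b))"
      unfolding f_def using cv cfB \<phi>B
      by (intro V.R.finsum_cong') (auto simp: cf_smult V.R.m_assoc)
    also have "\<dots> = c \<otimes>\<^bsub>K\<^esub> f v"
      unfolding f_def using cv cfB \<phi>B by (intro V.R.finsum_rdistr[symmetric] assms(2)) auto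
    finally show "f (c \<odot>\<^bsub>V\<^esub> v) = c \<odot>\<^bsub>regular_module K\<^esub> f v" by (simp add: regular_module_def)
  qed
  moreover have "f b = \<phi> b" if "b \<in> B" for b
  proof -
    have "f b = (\<Oplus>\<^bsub>K\<^esub>b'\<in>B. if b = b' then \<phi> b' else \<zero>\<^bsub>K\<^esub>)"
      unfolding f_def using that \<phi>B by (intro V.R.finsum_cong') (auto simp: cf_basis)
    also have "\<dots> = \<phi> b" using V.R.finsum_singleton[OF that assms(2), of \<phi>] \<phi>B by auto
    finally show ?thesis .
  qed
  ultimately show ?thesis by blast
qed


text \<open>Steinitz replacement provides \<open>C\<close> such that \<open>D \<union> C\<close>
  generates and has at most dim V elements; such a generating set is a basis.\<close>

lemma basis_extension:
  assumes "vectorspace K V" "vectorspace.fin_dim K V" "finite D" "D \<subseteq> carrier V"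
    "\<not> module.lin_dep K V D"
  shows "\<exists>C. finite C \<and> C \<inter> D = {} \<and> vectorspace.basis K V (D \<union> C)"
proof -
  interpret V: vectorspace K V by fact
  obtain B0 where B0: "finite B0" "V.basis B0" using V.finite_basis_exists[OF assms(2)] by blast
  obtain C where C: "finite C" "C \<subseteq> carrier V" "C \<inter> D = {}"
      "int (card C) \<le> int (card B0) - int (card D)" "V.span (D \<union> C) = V.span B0"
    using V.replacement[OF assms(3) B0(1) _ assms(5)] B0(2) assms(4) by (auto simp: V.basis_def)
  have gen: "V.gen_set (D \<union> C)" using C(5) B0(2) by (simp add: V.basis_def)
  have "card (D \<union> C) \<le> card D + card C" by (rule card_Un_le)
  also have "\<dots> \<le> V.dim" using C(4) V.dim_basis[OF B0] by simp
  finally have "V.basis (D \<union> C)"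
    using V.dim_gen_is_basis[of "D \<union> C"] gen C(1,2) assms(3,4) by simp
  thus ?thesis using C by blast
qed

lemma regular_module_vectorspace:
  assumes "field K"
  shows "vectorspace K (regular_module K)"
proof -
  interpret field K by fact
  have "\<exists>w\<in>carrier K. v \<oplus>\<^bsub>K\<^esub> w = \<zero>\<^bsub>K\<^esub>" if "v \<in> carrier K" for v
    using that r_neg by blast
  thus ?thesis
    by (intro vs_criteria[OF assms])
      (simp_all add: regular_module_def a_ac m_assoc l_distr r_distr)
qed

lemma functional_vanishes_on_span:
  assumes "vectorspace K V" "f \<in> module_hom K V (regular_module K)" "B \<subseteq> carrier V"
    "\<forall>b\<in>B. f b = \<zero>\<^bsub>K\<^esub>" "v \<in> module.span K V B"
  shows "f v = \<zero>\<^bsub>K\<^esub>"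
proof -
  interpret V: vectorspace K V by fact
  interpret f: linear_map K V "regular_module K" f
    by (intro linear_mapI assms regular_module_vectorspace V.field_axioms)
  have "B \<subseteq> f.kerT" unfolding f.ker_def using assms(3,4) by (auto simp: regular_module_def)
  hence "V.span B \<subseteq> f.kerT"
    using V.span_is_subset[of B f.kerT] f.kerT_is_subspace by (simp add: subspace_def)
  hence "v \<in> f.kerT" using assms(5) by blast
  thus ?thesis unfolding f.ker_def by (simp add: regular_module_def)
qed

text \<open>The dimension is read off from a space \<open>S\<close> that has \<open>C\<close> as a
  basis, since coordinates identify \<open>S\<close> with the functions on \<open>C\<close>.\<close>

lemma dim_func_space:
  assumes "vectorspace K S" "vectorspace.fin_dim K S" "finite C" "vectorspace.basis K S C"
  shows "vectorspace.dim K (ring.func_space K C) = card C"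
proof -
  interpret S: vectorspace K S by fact
  have CS: "C \<subseteq> carrier S" using assms(4) by (simp add: S.basis_def)
  interpret F: vectorspace K "S.func_space C" by (rule S.func_space_is_vs)
  interpret L: linear_map K "S.func_space C" S "\<lambda>a. S.lincomb a C"
    by (rule S.lincomb_is_linear[OF assms(3) CS])
  have ex1: "\<exists>!a. a \<in> C \<rightarrow>\<^sub>E carrier K \<and> S.lincomb a C = v" if "v \<in> carrier S" for v
    using S.basis_criterion[OF assms(3) CS] assms(4) that by blast
  have clos: "S.lincomb a C \<in> carrier S" if "a \<in> C \<rightarrow>\<^sub>E carrier K" for a
    using L.T_im[of a] that by (simp add: S.func_space_def)
  have inj: "inj_on (\<lambda>a. S.lincomb a C) (carrier (S.func_space C))"
    unfolding inj_on_def S.func_space_def using ex1 clos by (metis partial_object.select_convs(1))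
  have surj: "(\<lambda>a. S.lincomb a C) ` carrier (S.func_space C) = carrier S"
  proof (intro equalityI subsetI)
    fix v assume "v \<in> carrier S"
    from ex1[OF this] show "v \<in> (\<lambda>a. S.lincomb a C) ` carrier (S.func_space C)"
      by (auto simp: S.func_space_def)
  qed (use clos in \<open>auto simp: S.func_space_def\<close>)
  \<comment> \<open>The coordinate map. It starts at \<open>S\<close>, the side whose finite
    dimension is known, as the comparison of dimensions requires.\<close>
  define T where "T = inv_into (carrier (S.func_space C)) (\<lambda>a. S.lincomb a C)"
  have Tb: "bij_betw T (carrier S) (carrier (S.func_space C))"
    unfolding T_def by (rule bij_betw_inv_into) (use inj surj in \<open>simp add: bij_betw_def\<close>)
  have TL: "T (S.lincomb a C) = a" if "a \<in> carrier (S.func_space C)" for a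
    unfolding T_def using inj that by (rule inv_into_f_f)
  have ex: "\<exists>a \<in> carrier (S.func_space C). v = S.lincomb a C" if "v \<in> carrier S" for v
    using surj that by blast
  have "T \<in> module_hom K S (S.func_space C)"
    unfolding module_hom_def
  proof (intro CollectI conjI allI impI)
    show "T \<in> carrier S \<rightarrow> carrier (S.func_space C)"
      using Tb by (auto simp: bij_betw_def)
  next
    fix v w assume "v \<in> carrier S \<and> w \<in> carrier S"
    then obtain a b where ab: "a \<in> carrier (S.func_space C)" "v = S.lincomb a C"
        "b \<in> carrier (S.func_space C)" "w = S.lincomb b C" using ex by blast
    have "v \<oplus>\<^bsub>S\<^esub> w = S.lincomb (a \<oplus>\<^bsub>S.func_space C\<^esub> b) C"
      using L.T_add[of a b] ab by simp
    hence "T (v \<oplus>\<^bsub>S\<^esub> w) = a \<oplus>\<^bsub>S.func_space C\<^esub> b"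
      using TL[OF F.M.a_closed[OF ab(1,3)]] by simp
    thus "T (v \<oplus>\<^bsub>S\<^esub> w) = T v \<oplus>\<^bsub>S.func_space C\<^esub> T w"
      using TL[OF ab(1)] TL[OF ab(3)] unfolding ab(2,4) by simp
  next
    fix c v assume cv: "c \<in> carrier K \<and> v \<in> carrier S"
    then obtain a where ab: "a \<in> carrier (S.func_space C)" "v = S.lincomb a C" using ex by blast
    have "c \<odot>\<^bsub>S\<^esub> v = S.lincomb (c \<odot>\<^bsub>S.func_space C\<^esub> a) C"
      using L.T_smult[of c a] ab cv by simp
    hence "T (c \<odot>\<^bsub>S\<^esub> v) = c \<odot>\<^bsub>S.func_space C\<^esub> a"
      using TL[OF F.smult_closed[OF _ ab(1)]] cv by simp
    thus "T (c \<odot>\<^bsub>S\<^esub> v) = c \<odot>\<^bsub>S.func_space C\<^esub> T v"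
      using TL[OF ab(1)] unfolding ab(2) by simp
  qed
  then interpret T: linear_map K S "S.func_space C" T
    by (intro linear_mapI S.vectorspace_axioms S.func_space_is_vs)
  show ?thesis
    using T.dim_eq[OF assms(2)] Tb S.dim_basis[OF assms(3,4)] by (simp add: bij_betw_def)
qed

lemma subspace_basis:
  assumes "vectorspace K V" "vectorspace.fin_dim K V" "subspace K N V"
  shows "\<exists>D. finite D \<and> D \<subseteq> N \<and> \<not> module.lin_dep K V D \<and> module.span K V D = N \<and>
    card D = sdim K V N"
proof -
  interpret V: vectorspace K V by fact
  interpret N: vectorspace K "V\<lparr>carrier := N\<rparr>" by (rule subspace_vectorspace) fact
  have sub: "submodule K N V" using assms(3) by (simp add: subspace_def)
  obtain D where D: "finite D" "N.basis D"
    using N.finite_basis_exists[OF fin_dim_subspace[OF assms(2,3)]] by blast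
  have DN: "D \<subseteq> N" using D(2) by (simp add: N.basis_def)
  show ?thesis
    using D V.span_li_not_depend[OF DN sub] DN N.dim_basis[OF D]
    by (intro exI[of _ D]) (simp add: N.basis_def sdim_def)
qed

text \<open>As \<open>v\<close> lies outside the span \<open>N\<close> of \<open>D\<close>, adding
  \<open>v\<close> to \<open>D\<close> keeps it independent; in a basis extending both, the
  coordinate at \<open>v\<close> is the functional.\<close>

lemma exists_functional_vanishing:
  assumes "vectorspace K V" "vectorspace.fin_dim K V" "subspace K N V" "v \<in> carrier V" "v \<notin> N"
  shows "\<exists>f \<in> carrier (dual_space K V). (\<forall>n\<in>N. f n = \<zero>\<^bsub>K\<^esub>) \<and> f v \<noteq> \<zero>\<^bsub>K\<^esub>"
proof -
  interpret V: vectorspace K V by fact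
  have NV: "N \<subseteq> carrier V" by (rule subspace_subset[OF assms(3)])
  obtain D where D: "finite D" "D \<subseteq> N" "V.lin_indpt D" "V.span D = N"
    using subspace_basis[OF assms(1-3)] by blast
  have vD: "v \<notin> D" using D(2) assms(5) by blast
  have "D \<subseteq> carrier V" using D(2) NV by blast
  hence li: "V.lin_indpt (D \<union> {v})"
    using V.lin_dep_iff_in_span[of D v] D(3,4) assms(4,5) vD by simp
  obtain C where C: "finite C" "C \<inter> (D \<union> {v}) = {}" "V.basis (D \<union> {v} \<union> C)"
    using basis_extension[OF assms(1,2) _ _ li] D(1) \<open>D \<subseteq> carrier V\<close> assms(4) by auto
  obtain f where f: "f \<in> module_hom K V (regular_module K)"
      "\<forall>b\<in>D \<union> {v} \<union> C. f b = (if b = v then \<one>\<^bsub>K\<^esub> else \<zero>\<^bsub>K\<^esub>)"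
    using exists_functional[OF assms(1) _ C(3), of "\<lambda>b. if b = v then \<one>\<^bsub>K\<^esub> else \<zero>\<^bsub>K\<^esub>"] C(1) D(1)
    by auto
  have fD: "\<forall>b\<in>D. f b = \<zero>\<^bsub>K\<^esub>" using f(2) vD by auto
  have fN: "f n = \<zero>\<^bsub>K\<^esub>" if "n \<in> N" for n
    using functional_vanishes_on_span[OF assms(1) f(1) _ fD, of n] \<open>D \<subseteq> carrier V\<close> D(4) that by simp
  have "restrict f (carrier V) \<in> carrier (dual_space K V)"
    using f(1) by (auto simp: module_hom_def dual_space_def)
  moreover have "restrict f (carrier V) v \<noteq> \<zero>\<^bsub>K\<^esub>" using f(2) assms(4) by simp
  moreover have "\<forall>n\<in>N. restrict f (carrier V) n = \<zero>\<^bsub>K\<^esub>" using fN NV by auto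
  ultimately show ?thesis by blast
qed

text \<open>The dual is presented by a space \<open>W\<close> with an isomorphism
  \<open>\<eta>\<close>, the form in which Serre duality supplies it. For a basis \<open>C\<close>
  of a complement of \<open>N\<close>, restriction to \<open>C\<close> identifies the functionals
  vanishing on \<open>N\<close> with all functions on \<open>C\<close>.\<close>

lemma sdim_annihilator:
  assumes V: "vectorspace K V" "vectorspace.fin_dim K V" and W: "vectorspace K W" "vectorspace.fin_dim K W"
    and \<eta>: "\<eta> \<in> module_hom K W (dual_space K V)"
      "bij_betw \<eta> (carrier W) (carrier (dual_space K V))"
    and N: "subspace K N V"
  shows "sdim K W {w \<in> carrier W. \<forall>n\<in>N. \<eta> w n = \<zero>\<^bsub>K\<^esub>} + sdim K V N = vectorspace.dim K V"
proof -
  interpret V: vectorspace K V by fact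
  interpret W: vectorspace K W by fact
  have NV: "N \<subseteq> carrier V" by (rule subspace_subset[OF N])
  obtain D where D: "finite D" "D \<subseteq> N" "V.lin_indpt D" "V.span D = N" "card D = sdim K V N"
    using subspace_basis[OF V N] by blast
  have DV: "D \<subseteq> carrier V" using D(2) NV by blast
  obtain C where C: "finite C" "C \<inter> D = {}" "V.basis (D \<union> C)"
    using basis_extension[OF V D(1) DV D(3)] by blast
  have CV: "C \<subseteq> carrier V" using C(3) by (simp add: V.basis_def)
  have cardC: "card C + sdim K V N = V.dim"
    using V.dim_basis[OF _ C(3)] C(1,2) D(1,5) card_Un_disjoint[of D C] by (simp add: Int_commute)
  have spC: "subspace K (V.span C) V" by (rule V.span_is_subspace[OF CV])
  \<comment> \<open>The span of \<open>C\<close> is brought in as a space with basis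
    \<open>C\<close>, from which the dimension of the functions on \<open>C\<close> is
    obtained.\<close>
  have CsC: "C \<subseteq> V.span C" using V.in_own_span[OF CV] .
  interpret S: vectorspace K "V\<lparr>carrier := V.span C\<rparr>" by (rule subspace_vectorspace[OF spC])
  have "V.lin_indpt C" using V.subset_li_is_li[of "D \<union> C" C] C(3) by (auto simp: V.basis_def)
  hence "S.basis C"
    using V.span_li_not_depend[OF CsC V.is_module[OF spC]] CsC by (simp add: S.basis_def)
  hence F: "vectorspace.dim K (V.func_space C) = card C"
    by (intro dim_func_space[OF S.vectorspace_axioms] fin_dim_subspace[OF V(2) spC] C(1))
  have ext: "\<exists>f \<in> module_hom K V (regular_module K).
       (\<forall>n\<in>N. f n = \<zero>\<^bsub>K\<^esub>) \<and> (\<forall>c\<in>C. f c = \<phi> c)" if \<phi>: "\<phi> \<in> C \<rightarrow> carrier K" for \<phi>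
  proof -
    have "(\<lambda>b. if b \<in> C then \<phi> b else \<zero>\<^bsub>K\<^esub>) \<in> D \<union> C \<rightarrow> carrier K" using \<phi> by auto
    then obtain f where f: "f \<in> module_hom K V (regular_module K)"
        "\<forall>b\<in>D \<union> C. f b = (if b \<in> C then \<phi> b else \<zero>\<^bsub>K\<^esub>)"
      using exists_functional[OF V(1) finite_UnI[OF D(1) C(1)] C(3)] by blast
    have "\<forall>b\<in>D. f b = \<zero>\<^bsub>K\<^esub>" using f(2) C(2) by auto
    hence "\<forall>n\<in>N. f n = \<zero>\<^bsub>K\<^esub>"
      using functional_vanishes_on_span[OF V(1) f(1) DV] D(4) by blast
    thus ?thesis using f by auto
  qed
  have van: "f v = \<zero>\<^bsub>K\<^esub>" if "f \<in> module_hom K V (regular_module K)"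
       "\<forall>n\<in>N. f n = \<zero>\<^bsub>K\<^esub>" "\<forall>c\<in>C. f c = \<zero>\<^bsub>K\<^esub>" "v \<in> carrier V" for f v
    using functional_vanishes_on_span[OF V(1) that(1), of "D \<union> C" v] that D(2) DV CV C(3)
    by (auto simp: V.basis_def)
  have dual: "carrier (dual_space K V) = module_hom K V (regular_module K) \<inter> extensional (carrier V)"
    by (simp add: dual_space_def)
  have \<eta>f: "\<eta> w \<in> module_hom K V (regular_module K)" "\<eta> w \<in> extensional (carrier V)" if "w \<in> carrier W" for w
    using \<eta>(2) that dual by (auto simp: bij_betw_def)
  have \<eta>K: "\<eta> w v \<in> carrier K" if "w \<in> carrier W" "v \<in> carrier V" for w v
    using \<eta>f(1)[OF that(1)] that(2) by (auto simp: module_hom_def regular_module_def)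
  have \<eta>add: "\<eta> (w \<oplus>\<^bsub>W\<^esub> w') v = \<eta> w v \<oplus>\<^bsub>K\<^esub> \<eta> w' v"
    if "w \<in> carrier W" "w' \<in> carrier W" "v \<in> carrier V" for w w' v
    using \<eta>(1) that by (auto simp: module_hom_def dual_space_def V.func_space_def)
  have \<eta>smult: "\<eta> (c \<odot>\<^bsub>W\<^esub> w) v = c \<otimes>\<^bsub>K\<^esub> \<eta> w v"
    if "w \<in> carrier W" "c \<in> carrier K" "v \<in> carrier V" for w c v
    using \<eta>(1) that by (auto simp: module_hom_def dual_space_def V.func_space_def)
  have \<eta>0: "\<eta> \<zero>\<^bsub>W\<^esub> v = \<zero>\<^bsub>K\<^esub>" if "v \<in> carrier V" for v
    using \<eta>smult[of "\<zero>\<^bsub>W\<^esub>" "\<zero>\<^bsub>K\<^esub>" v] that \<eta>K by simp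
  let ?A = "{w \<in> carrier W. \<forall>n\<in>N. \<eta> w n = \<zero>\<^bsub>K\<^esub>}"
  have A: "subspace K ?A W"
    by (rule subspaceI) (use W NV \<eta>0 \<eta>add \<eta>smult in \<open>auto simp: subset_iff\<close>)
  let ?T = "\<lambda>w. restrict (\<eta> w) C"
  have T: "?T \<in> module_hom K W (V.func_space C)"
    using CV \<eta>K \<eta>add \<eta>smult
    by (auto simp: module_hom_def V.func_space_def fun_eq_iff restrict_def subset_iff)
  have img: "?T ` ?A = carrier (V.func_space C)"
  proof
    show "?T ` ?A \<subseteq> carrier (V.func_space C)" using T by (auto simp: module_hom_def)
    show "carrier (V.func_space C) \<subseteq> ?T ` ?A"
    proof
      fix \<phi> assume \<phi>: "\<phi> \<in> carrier (V.func_space C)"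
      then obtain f where f: "f \<in> module_hom K V (regular_module K)"
          "\<forall>n\<in>N. f n = \<zero>\<^bsub>K\<^esub>" "\<forall>c\<in>C. f c = \<phi> c"
        using ext[of \<phi>] by (auto simp: V.func_space_def)
      have "restrict f (carrier V) \<in> carrier (dual_space K V)"
        unfolding dual using f(1) by (auto simp: module_hom_def)
      then obtain w where w: "w \<in> carrier W" "\<eta> w = restrict f (carrier V)"
        using \<eta>(2) unfolding bij_betw_def by (metis (no_types, lifting) imageE)
      have "w \<in> ?A" using w f(2) NV by auto
      moreover have "?T w = \<phi>"
        using w f(3) CV \<phi> by (auto simp: V.func_space_def restrict_def fun_eq_iff PiE_def extensional_def)
      ultimately show "\<phi> \<in> ?T ` ?A" by blast
    qed
  qed
  have ker: "{w \<in> ?A. ?T w = \<zero>\<^bsub>V.func_space C\<^esub>} = {\<zero>\<^bsub>W\<^esub>}"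
  proof
    show "{\<zero>\<^bsub>W\<^esub>} \<subseteq> {w \<in> ?A. ?T w = \<zero>\<^bsub>V.func_space C\<^esub>}"
      using \<eta>0 NV CV by (auto simp: V.func_space_def restrict_def fun_eq_iff)
    show "{w \<in> ?A. ?T w = \<zero>\<^bsub>V.func_space C\<^esub>} \<subseteq> {\<zero>\<^bsub>W\<^esub>}"
    proof
      fix w assume w: "w \<in> {w \<in> ?A. ?T w = \<zero>\<^bsub>V.func_space C\<^esub>}"
      hence "\<forall>c\<in>C. \<eta> w c = \<zero>\<^bsub>K\<^esub>" by (auto simp: V.func_space_def restrict_def fun_eq_iff) metis
      hence "\<forall>v\<in>carrier V. \<eta> w v = \<zero>\<^bsub>K\<^esub>" using van[of "\<eta> w"] \<eta>f(1) w by auto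
      hence "\<eta> w = \<eta> \<zero>\<^bsub>W\<^esub>"
        using \<eta>f(2)[of w] \<eta>f(2)[of "\<zero>\<^bsub>W\<^esub>"] w \<eta>0
        by (intro extensionalityI[of _ "carrier V"]) auto
      thus "w \<in> {\<zero>\<^bsub>W\<^esub>}" using \<eta>(2) w by (auto simp: bij_betw_def inj_on_def)
    qed
  qed
  have "sdim K W ?A = sdim K (V.func_space C) (carrier (V.func_space C))"
    using rank_nullity_subspace[OF W(2) A V.func_space_is_vs T] unfolding img ker sdim_zero[OF W(1)] by simp
  thus ?thesis using F cardC by (simp add: sdim_carrier)
qed

section \<open>Quotient spaces\<close>

lemma vectorspace_surj_image:
  assumes "vectorspace K V" and surj: "h ` carrier V = carrier Q"
    and add: "\<And>v w. v \<in> carrier V \<Longrightarrow> w \<in> carrier V \<Longrightarrow> h (v \<oplus>\<^bsub>V\<^esub> w) = h v \<oplus>\<^bsub>Q\<^esub> h w"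
    and smult: "\<And>c v. c \<in> carrier K \<Longrightarrow> v \<in> carrier V \<Longrightarrow> h (c \<odot>\<^bsub>V\<^esub> v) = c \<odot>\<^bsub>Q\<^esub> h v"
    and zero: "h \<zero>\<^bsub>V\<^esub> = \<zero>\<^bsub>Q\<^esub>"
  shows "vectorspace K Q"
proof -
  interpret V: vectorspace K V by fact
  have ex: "\<exists>v\<in>carrier V. x = h v" if "x \<in> carrier Q" for x
    using that unfolding surj[symmetric] image_iff .
  have im: "h v \<in> carrier Q" if "v \<in> carrier V" for v
    using imageI[OF that, of h] unfolding surj .
  show ?thesis
  proof (rule vs_criteria[OF V.field_axioms]; (intro allI impI ballI)?)
    show "\<zero>\<^bsub>Q\<^esub> \<in> carrier Q" using im[of "\<zero>\<^bsub>V\<^esub>"] zero by simp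
  next
    fix v w assume "v \<in> carrier Q \<and> w \<in> carrier Q"
    then obtain v' w' where "v' \<in> carrier V" "w' \<in> carrier V" "v = h v'" "w = h w'" using ex by blast
    thus "v \<oplus>\<^bsub>Q\<^esub> w \<in> carrier Q" and "v \<oplus>\<^bsub>Q\<^esub> w = w \<oplus>\<^bsub>Q\<^esub> v"
      by (simp_all add: add[symmetric] im V.M.a_comm)
  next
    fix v assume "v \<in> carrier Q"
    then obtain v' where v': "v' \<in> carrier V" "v = h v'" using ex by blast
    have "v \<oplus>\<^bsub>Q\<^esub> h (\<ominus>\<^bsub>V\<^esub> v') = \<zero>\<^bsub>Q\<^esub>"
      using v' by (simp add: add[symmetric] V.M.r_neg zero)
    thus "\<exists>w\<in>carrier Q. v \<oplus>\<^bsub>Q\<^esub> w = \<zero>\<^bsub>Q\<^esub>" 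
      by (rule bexI) (intro im V.M.a_inv_closed v'(1))
    show "v \<oplus>\<^bsub>Q\<^esub> \<zero>\<^bsub>Q\<^esub> = v" using v' by (simp add: add[symmetric] zero[symmetric])
    show "\<one>\<^bsub>K\<^esub> \<odot>\<^bsub>Q\<^esub> v = v" using v' by (simp add: smult[symmetric])
  next
    fix c v assume "c \<in> carrier K \<and> v \<in> carrier Q"
    then obtain v' where "c \<in> carrier K" "v' \<in> carrier V" "v = h v'" using ex by blast
    thus "c \<odot>\<^bsub>Q\<^esub> v \<in> carrier Q" by (simp add: smult[symmetric] im)
  next
    fix u v w assume "u \<in> carrier Q \<and> v \<in> carrier Q \<and> w \<in> carrier Q"
    hence uvw: "u \<in> carrier Q" "v \<in> carrier Q" "w \<in> carrier Q" by simp_all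
    obtain u' v' w' where "u' \<in> carrier V" "v' \<in> carrier V" "w' \<in> carrier V"
      "u = h u'" "v = h v'" "w = h w'"
      using ex[OF uvw(1)] ex[OF uvw(2)] ex[OF uvw(3)] by (elim bexE)
    thus "u \<oplus>\<^bsub>Q\<^esub> v \<oplus>\<^bsub>Q\<^esub> w = u \<oplus>\<^bsub>Q\<^esub> (v \<oplus>\<^bsub>Q\<^esub> w)"
      by (simp add: add[symmetric] V.M.a_assoc)
  next
    fix a b v assume "a \<in> carrier K \<and> b \<in> carrier K \<and> v \<in> carrier Q"
    then obtain v' where "a \<in> carrier K" "b \<in> carrier K" "v' \<in> carrier V" "v = h v'" using ex by blast
    thus "a \<otimes>\<^bsub>K\<^esub> b \<odot>\<^bsub>Q\<^esub> v = a \<odot>\<^bsub>Q\<^esub> (b \<odot>\<^bsub>Q\<^esub> v)"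
      "(a \<oplus>\<^bsub>K\<^esub> b) \<odot>\<^bsub>Q\<^esub> v = a \<odot>\<^bsub>Q\<^esub> v \<oplus>\<^bsub>Q\<^esub> b \<odot>\<^bsub>Q\<^esub> v"
      by (simp_all add: add[symmetric] smult[symmetric] V.smult_assoc1 V.smult_l_distr)
  next
    fix a v w assume "a \<in> carrier K \<and> v \<in> carrier Q \<and> w \<in> carrier Q"
    hence avw: "a \<in> carrier K" "v \<in> carrier Q" "w \<in> carrier Q" by simp_all
    obtain v' w' where "v' \<in> carrier V" "w' \<in> carrier V" "v = h v'" "w = h w'"
      using ex[OF avw(2)] ex[OF avw(3)] by (elim bexE)
    thus "a \<odot>\<^bsub>Q\<^esub> (v \<oplus>\<^bsub>Q\<^esub> w) = a \<odot>\<^bsub>Q\<^esub> v \<oplus>\<^bsub>Q\<^esub> a \<odot>\<^bsub>Q\<^esub> w"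
      using avw(1) by (simp add: add[symmetric] smult[symmetric] V.smult_r_distr)
  qed
qed

text \<open>The projection onto cosets is surjective and compatible with the operations, which
  transfers the vector space axioms; its kernel is \<open>N\<close>, which gives the dimension and
  the criterion for vanishing.\<close>

lemma dim_quotient:
  fixes V :: "('k, 'm) module"
  assumes "vectorspace K V" "vectorspace.fin_dim K V" "subspace K N V"
  shows "vectorspace.dim K (quotient_module V N) + sdim K V N = vectorspace.dim K V"
    and "carrier (quotient_module V N) = {\<zero>\<^bsub>quotient_module V N\<^esub>} \<longleftrightarrow> carrier V = N"
proof -
  interpret V: vectorspace K V by fact
  have sub: "submodule K N V" and NV: "N \<subseteq> carrier V"
    using assms(3) by (simp_all add: subspace_def submodule_def)
  let ?Q = "quotient_module V N"
  let ?h = "\<lambda>v. N +>\<^bsub>V\<^esub> v"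
  have N0: "\<zero>\<^bsub>V\<^esub> \<in> N" using assms(3) by (simp add: subspace_def submodule_def)
  have Nsmult: "c \<odot>\<^bsub>V\<^esub> n \<in> N" if "c \<in> carrier K" "n \<in> N" for c n
    using assms(3) that by (simp add: subspace_def submodule_def)
  have Nadd: "m \<oplus>\<^bsub>V\<^esub> n \<in> N" if "m \<in> N" "n \<in> N" for m n
    using assms(3) that by (simp add: subspace_def submodule_def)
  have Nneg: "\<ominus>\<^bsub>V\<^esub> n \<in> N" if "n \<in> N" for n
    using Nsmult[of "\<ominus>\<^bsub>K\<^esub> \<one>\<^bsub>K\<^esub>" n] that NV V.smult_minus_1[of n] by auto
  have asub: "subgroup N (add_monoid V)"
    by (rule subgroup.intro) (use NV N0 Nadd Nneg in \<open>auto simp: a_inv_def[symmetric]\<close>)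
  interpret N: abelian_subgroup N V
    by (rule abelian_subgroupI3[OF additive_subgroup.intro[OF asub] V.M.abelian_group_axioms])
  have hN: "?h n = N" if "n \<in> N" for n using N.a_rcos_const that by simp
  have diff: "?h v = ?h w" if "v \<in> carrier V" "w \<in> carrier V" "v \<ominus>\<^bsub>V\<^esub> w \<in> N" for v w
  proof -
    have "(v \<ominus>\<^bsub>V\<^esub> w) \<oplus>\<^bsub>V\<^esub> w = v" using that by (simp add: a_minus_def V.M.a_assoc V.M.l_neg)
    hence "v \<in> ?h w" using that V.M.a_rcosI[of "v \<ominus>\<^bsub>V\<^esub> w" N w] NV by simp
    thus ?thesis using V.M.a_repr_independence[OF _ that(2) asub] by simp
  qed
  \<comment> \<open>The scalar multiple of a coset is a union over all its representatives; the
    union collapses because any two of them yield the same coset.\<close>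
  have smult: "?h (c \<odot>\<^bsub>V\<^esub> v) = c \<odot>\<^bsub>?Q\<^esub> ?h v" if "c \<in> carrier K" "v \<in> carrier V" for c v
  proof -
    have "?h (c \<odot>\<^bsub>V\<^esub> x) = ?h (c \<odot>\<^bsub>V\<^esub> v)" if x: "x \<in> ?h v" for x
    proof -
      obtain n where n: "n \<in> N" "x = n \<oplus>\<^bsub>V\<^esub> v" 
        using x unfolding a_r_coset_def' UN_iff singleton_iff by (elim bexE)
      have "c \<odot>\<^bsub>V\<^esub> x \<ominus>\<^bsub>V\<^esub> c \<odot>\<^bsub>V\<^esub> v = c \<odot>\<^bsub>V\<^esub> n"
        using n NV \<open>c \<in> carrier K\<close> \<open>v \<in> carrier V\<close>
        by (auto simp: V.smult_r_distr a_minus_def V.M.a_assoc V.M.r_neg subset_iff)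
      thus ?thesis using n NV \<open>c \<in> carrier K\<close> \<open>v \<in> carrier V\<close> Nsmult by (intro diff) auto
    qed
    moreover have "v \<in> ?h v" using N.a_rcos_self that by simp
    ultimately have "(\<Union>x\<in>?h v. ?h (c \<odot>\<^bsub>V\<^esub> x)) = (\<Union>x\<in>?h v. ?h (c \<odot>\<^bsub>V\<^esub> v))" and "?h v \<noteq> {}"
      by (blast intro: SUP_cong)+
    thus ?thesis by (simp add: quotient_module_def)
  qed
  have surj: "?h ` carrier V = carrier ?Q" by (auto simp: quotient_module_def A_RCOSETS_def')
  have add: "?h (v \<oplus>\<^bsub>V\<^esub> w) = ?h v \<oplus>\<^bsub>?Q\<^esub> ?h w" if "v \<in> carrier V" "w \<in> carrier V" for v w
    using N.a_rcos_sum that by (simp add: quotient_module_def)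
  have zero: "?h \<zero>\<^bsub>V\<^esub> = \<zero>\<^bsub>?Q\<^esub>" using hN[OF N0] by (simp add: quotient_module_def)
  have Q: "vectorspace K ?Q" by (rule vectorspace_surj_image[OF assms(1) surj add smult zero])
  have hom: "?h \<in> module_hom K V ?Q" using surj add smult by (auto simp: module_hom_def)
  have ker_iff: "?h v = \<zero>\<^bsub>?Q\<^esub> \<longleftrightarrow> v \<in> N" if "v \<in> carrier V" for v
  proof
    assume "?h v = \<zero>\<^bsub>?Q\<^esub>"
    hence "?h v = N" by (simp add: quotient_module_def)
    thus "v \<in> N" using N.a_rcos_self[OF that] by (rule subst)
  next
    assume "v \<in> N"
    thus "?h v = \<zero>\<^bsub>?Q\<^esub>" by (simp add: quotient_module_def hN)
  qed
  have ker: "{v \<in> carrier V. ?h v = \<zero>\<^bsub>?Q\<^esub>} = N"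
    using NV by (intro subset_antisym subsetI) (auto simp: ker_iff)
  show "vectorspace.dim K ?Q + sdim K V N = vectorspace.dim K V"
    using rank_nullity_subspace[OF assms(2) subspace_carrier[OF assms(1)] Q hom]
    unfolding surj ker sdim_carrier .
  show "carrier ?Q = {\<zero>\<^bsub>?Q\<^esub>} \<longleftrightarrow> carrier V = N"
  proof
    assume "carrier ?Q = {\<zero>\<^bsub>?Q\<^esub>}"
    hence "v \<in> N" if "v \<in> carrier V" for v
      using ker_iff[OF that] imageI[OF that, of ?h] unfolding surj by simp
    thus "carrier V = N" using NV by (intro subset_antisym subsetI) auto
  next
    assume "carrier V = N"
    hence "?h v = \<zero>\<^bsub>?Q\<^esub>" if "v \<in> carrier V" for v using ker_iff that by simp
    moreover have "\<zero>\<^bsub>?Q\<^esub> \<in> carrier ?Q" 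
      using imageI[OF V.M.zero_closed, of ?h] unfolding surj zero .
    ultimately show "carrier ?Q = {\<zero>\<^bsub>?Q\<^esub>}" unfolding surj[symmetric]
      by (intro subset_antisym subsetI) auto
  qed
qed

section \<open>Exactness of Hom on angles\<close>

context linear_category
begin

sublocale Hom: vectorspace K "Hom C X Y" for X Y
  by (rule Hom_vectorspace)

lemma Comp_closed [simp, intro]:
  assumes "f \<in> Arr C X Y" "g \<in> Arr C Y Z"
  shows "Comp C X Y Z g f \<in> Arr C X Z"
  using Comp_linear_right[OF assms(2), of X] assms(1) by (auto simp: module_hom_def)

lemma Comp_add_right:
  "g \<in> Arr C Y Z \<Longrightarrow> f \<in> Arr C X Y \<Longrightarrow> f' \<in> Arr C X Y \<Longrightarrow>
    Comp C X Y Z g (f \<oplus>\<^bsub>Hom C X Y\<^esub> f') = Comp C X Y Z g f \<oplus>\<^bsub>Hom C X Z\<^esub> Comp C X Y Z g f'"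
  using Comp_linear_right[of g Y Z X] by (simp add: module_hom_def)

lemma Comp_add_left:
  "f \<in> Arr C X Y \<Longrightarrow> g \<in> Arr C Y Z \<Longrightarrow> g' \<in> Arr C Y Z \<Longrightarrow>
    Comp C X Y Z (g \<oplus>\<^bsub>Hom C Y Z\<^esub> g') f = Comp C X Y Z g f \<oplus>\<^bsub>Hom C X Z\<^esub> Comp C X Y Z g' f"
  using Comp_linear_left[of f X Y Z] by (simp add: module_hom_def)

lemma Comp_smult_right:
  "g \<in> Arr C Y Z \<Longrightarrow> f \<in> Arr C X Y \<Longrightarrow> a \<in> carrier K \<Longrightarrow>
    Comp C X Y Z g (a \<odot>\<^bsub>Hom C X Y\<^esub> f) = a \<odot>\<^bsub>Hom C X Z\<^esub> Comp C X Y Z g f"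
  using Comp_linear_right[of g Y Z X] by (simp add: module_hom_def)

lemma Comp_smult_left:
  "f \<in> Arr C X Y \<Longrightarrow> g \<in> Arr C Y Z \<Longrightarrow> a \<in> carrier K \<Longrightarrow>
    Comp C X Y Z (a \<odot>\<^bsub>Hom C Y Z\<^esub> g) f = a \<odot>\<^bsub>Hom C X Z\<^esub> Comp C X Y Z g f"
  using Comp_linear_left[of f X Y Z] by (simp add: module_hom_def)

lemma linear_map_right: "g \<in> Arr C Y Z \<Longrightarrow> linear_map K (Hom C X Y) (Hom C X Z) (Comp C X Y Z g)"
  using Comp_linear_right[of g Y Z X] by (intro linear_mapI Hom_vectorspace) simp

lemma linear_map_left: "f \<in> Arr C X Y \<Longrightarrow> linear_map K (Hom C Y Z) (Hom C X Z) (\<lambda>g. Comp C X Y Z g f)"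
  using Comp_linear_left[of f X Y Z] by (intro linear_mapI Hom_vectorspace)

lemma Comp_zero_right [simp]: "g \<in> Arr C Y Z \<Longrightarrow> Comp C X Y Z g (Zero C X Y) = Zero C X Z"
  by (rule linear_map.T0_is_0[OF linear_map_right])

lemma Comp_zero_left [simp]: "f \<in> Arr C X Y \<Longrightarrow> Comp C X Y Z (Zero C Y Z) f = Zero C X Z"
  by (rule linear_map.T0_is_0[OF linear_map_left])

lemma Comp_neg_right:
  "g \<in> Arr C Y Z \<Longrightarrow> f \<in> Arr C X Y \<Longrightarrow>
    Comp C X Y Z g (\<ominus>\<^bsub>Hom C X Y\<^esub> f) = \<ominus>\<^bsub>Hom C X Z\<^esub> Comp C X Y Z g f"
  by (rule linear_map.T_neg[OF linear_map_right])

lemma Comp_neg_left: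
  "f \<in> Arr C X Y \<Longrightarrow> g \<in> Arr C Y Z \<Longrightarrow>
    Comp C X Y Z (\<ominus>\<^bsub>Hom C Y Z\<^esub> g) f = \<ominus>\<^bsub>Hom C X Z\<^esub> Comp C X Y Z g f"
  by (rule linear_map.T_neg[OF linear_map_left])

lemma Comp_minus_right:
  "g \<in> Arr C Y Z \<Longrightarrow> f \<in> Arr C X Y \<Longrightarrow> f' \<in> Arr C X Y \<Longrightarrow>
    Comp C X Y Z g (f \<ominus>\<^bsub>Hom C X Y\<^esub> f') = Comp C X Y Z g f \<ominus>\<^bsub>Hom C X Z\<^esub> Comp C X Y Z g f'"
  by (rule linear_map.T_minus[OF linear_map_right])

lemma Comp_minus_left:
  "f \<in> Arr C X Y \<Longrightarrow> g \<in> Arr C Y Z \<Longrightarrow> g' \<in> Arr C Y Z \<Longrightarrow>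
    Comp C X Y Z (g \<ominus>\<^bsub>Hom C Y Z\<^esub> g') f = Comp C X Y Z g f \<ominus>\<^bsub>Hom C X Z\<^esub> Comp C X Y Z g' f"
  by (rule linear_map.T_minus[OF linear_map_left])

lemmas Comp_linear = Comp_add_right Comp_add_left Comp_smult_right Comp_smult_left
  Comp_neg_right Comp_neg_left Comp_minus_right Comp_minus_left

lemma zero_object_arr_from:
  assumes "zero_object C X" "f \<in> Arr C X Y"
  shows "f = Zero C X Y"
proof -
  have "f = Comp C X X Y f (Ident C X)" using assms(2) by (simp add: Ident_right)
  thus ?thesis using assms by (simp add: zero_object_def)
qed

lemma zero_object_arr_to:
  assumes "zero_object C Y" "f \<in> Arr C X Y"
  shows "f = Zero C X Y"
proof -
  have "f = Comp C X Y Y (Ident C Y) f" using assms(2) by (simp add: Ident_left)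
  thus ?thesis using assms by (simp add: zero_object_def)
qed

end

context angulated_category
begin

lemma shift_functor: "linear_functor K C (shift C)"
  using shift_automorphism by (simp add: automorphism_def)

lemma Sarr_hom: "Sarr C X Y \<in> module_hom K (Hom C X Y) (Hom C (Sob C X) (Sob C Y))"
  using shift_functor by (simp add: linear_functor_def)

lemma Sarr_linear: "linear_map K (Hom C X Y) (Hom C (Sob C X) (Sob C Y)) (Sarr C X Y)"
  by (intro linear_mapI Hom_vectorspace Sarr_hom)

lemma Sarr_closed [simp, intro]: "f \<in> Arr C X Y \<Longrightarrow> Sarr C X Y f \<in> Arr C (Sob C X) (Sob C Y)"
  using Sarr_hom[of X Y] by (auto simp: module_hom_def)

lemma Sarr_zero [simp]: "Sarr C X Y (Zero C X Y) = Zero C (Sob C X) (Sob C Y)"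
  by (rule linear_map.T0_is_0[OF Sarr_linear])

lemma Sarr_ident [simp]: "Sarr C X X (Ident C X) = Ident C (Sob C X)"
  using shift_functor by (simp add: linear_functor_def)

lemma Sarr_comp:
  "f \<in> Arr C X Y \<Longrightarrow> g \<in> Arr C Y Z \<Longrightarrow> Sarr C X Z (Comp C X Y Z g f) =
    Comp C (Sob C X) (Sob C Y) (Sob C Z) (Sarr C Y Z g) (Sarr C X Y f)"
  using shift_functor by (simp add: linear_functor_def)

lemma Sarr_bij: "bij_betw (Sarr C X Y) (Arr C X Y) (Arr C (Sob C X) (Sob C Y))"
  using shift_automorphism by (simp add: automorphism_def)

lemma Sarr_inj: "f \<in> Arr C X Y \<Longrightarrow> g \<in> Arr C X Y \<Longrightarrow> Sarr C X Y f = Sarr C X Y g \<longleftrightarrow> f = g"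
  using Sarr_bij[of X Y] by (auto simp: bij_betw_def inj_on_def)

lemma Sarr_eq_zero [simp]:
  "f \<in> Arr C X Y \<Longrightarrow> Sarr C X Y f = Zero C (Sob C X) (Sob C Y) \<longleftrightarrow> f = Zero C X Y"
  using Sarr_inj[of f X Y "Zero C X Y"] by simp

lemma Sarr_surj:
  assumes "g \<in> Arr C (Sob C X) (Sob C Y)"
  obtains f where "f \<in> Arr C X Y" "g = Sarr C X Y f"
  using assms Sarr_bij[of X Y] unfolding bij_betw_def by blast

lemma Sob_surj: obtains X where "Y = Sob C X"
  using shift_automorphism unfolding automorphism_def bij_def surj_def by blast

lemma zero_object_Sob: "zero_object C X \<Longrightarrow> zero_object C (Sob C X)"
  by (metis zero_object_def Sarr_ident Sarr_zero)

text \<open>What is retained of an angle: vanishing composites and exactness for morphisms out of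
  and into its terms. In degree 0 the kernel condition is stated after a shift, against the last
  morphism, so that no inverse shift occurs. The gain is stability under termwise shift; for angles
  themselves, d + 2 rotations give the termwise shift only up to the sign (-1)^d on every
  morphism.\<close>

definition hexact :: "(nat \<Rightarrow> 'o) \<Rightarrow> (nat \<Rightarrow> 'm) \<Rightarrow> bool" where
  "hexact c \<gamma> \<longleftrightarrow> sigma_seq d C c \<gamma> \<and>
     (\<forall>k\<le>d. Comp C (c k) (c (Suc k)) (c (Suc (Suc k))) (\<gamma> (Suc k)) (\<gamma> k) = Zero C (c k) (c (Suc (Suc k)))) \<and>
     Comp C (c (Suc d)) (Sob C (c 0)) (Sob C (c 1)) (Sarr C (c 0) (c 1) (\<gamma> 0)) (\<gamma> (Suc d)) =
       Zero C (c (Suc d)) (Sob C (c 1)) \<and>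
     (\<forall>k\<le>d. \<forall>Y. \<forall>f \<in> Arr C (c (Suc k)) Y. Comp C (c k) (c (Suc k)) Y f (\<gamma> k) = Zero C (c k) Y \<longrightarrow>
        (\<exists>g \<in> Arr C (c (Suc (Suc k))) Y. f = Comp C (c (Suc k)) (c (Suc (Suc k))) Y g (\<gamma> (Suc k)))) \<and>
     (\<forall>Y. \<forall>f \<in> Arr C (c 0) Y.
        Comp C (c (Suc d)) (Sob C (c 0)) (Sob C Y) (Sarr C (c 0) Y f) (\<gamma> (Suc d)) = Zero C (c (Suc d)) (Sob C Y) \<longrightarrow>
        (\<exists>g \<in> Arr C (c 1) Y. f = Comp C (c 0) (c 1) Y g (\<gamma> 0))) \<and>
     (\<forall>k\<le>d. \<forall>Y. \<forall>f \<in> Arr C Y (c (Suc k)).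
        Comp C Y (c (Suc k)) (c (Suc (Suc k))) (\<gamma> (Suc k)) f = Zero C Y (c (Suc (Suc k))) \<longrightarrow>
        (\<exists>g \<in> Arr C Y (c k). f = Comp C Y (c k) (c (Suc k)) (\<gamma> k) g))"

lemma sigma_seqD:
  assumes "sigma_seq d C c \<gamma>"
  shows "c (Suc (Suc d)) = Sob C (c 0)" "k \<le> Suc d \<Longrightarrow> \<gamma> k \<in> Arr C (c k) (c (Suc k))"
  using assms by (simp_all add: sigma_seq_def)

lemma hexactD:
  assumes "hexact c \<gamma>"
  shows hexact_last: "c (Suc (Suc d)) = Sob C (c 0)"
    and hexact_arr: "k \<le> Suc d \<Longrightarrow> \<gamma> k \<in> Arr C (c k) (c (Suc k))"
    and hexact_comp: "k \<le> d \<Longrightarrow>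
      Comp C (c k) (c (Suc k)) (c (Suc (Suc k))) (\<gamma> (Suc k)) (\<gamma> k) = Zero C (c k) (c (Suc (Suc k)))"
    and hexact_comp_last:
      "Comp C (c (Suc d)) (Sob C (c 0)) (Sob C (c 1)) (Sarr C (c 0) (c 1) (\<gamma> 0)) (\<gamma> (Suc d)) =
       Zero C (c (Suc d)) (Sob C (c 1))"
    and hexact_contra: "k \<le> d \<Longrightarrow> f \<in> Arr C (c (Suc k)) Y \<Longrightarrow>
      Comp C (c k) (c (Suc k)) Y f (\<gamma> k) = Zero C (c k) Y \<Longrightarrow>
      \<exists>g \<in> Arr C (c (Suc (Suc k))) Y. f = Comp C (c (Suc k)) (c (Suc (Suc k))) Y g (\<gamma> (Suc k))"
    and hexact_contra_0: "f \<in> Arr C (c 0) Y \<Longrightarrow>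
      Comp C (c (Suc d)) (Sob C (c 0)) (Sob C Y) (Sarr C (c 0) Y f) (\<gamma> (Suc d)) = Zero C (c (Suc d)) (Sob C Y) \<Longrightarrow>
      \<exists>g \<in> Arr C (c 1) Y. f = Comp C (c 0) (c 1) Y g (\<gamma> 0)"
    and hexact_co: "k \<le> d \<Longrightarrow> f \<in> Arr C Y (c (Suc k)) \<Longrightarrow>
      Comp C Y (c (Suc k)) (c (Suc (Suc k))) (\<gamma> (Suc k)) f = Zero C Y (c (Suc (Suc k))) \<Longrightarrow>
      \<exists>g \<in> Arr C Y (c k). f = Comp C Y (c k) (c (Suc k)) (\<gamma> k) g"
  using assms unfolding hexact_def sigma_seq_def by simp_all

lemma rot_obj_simps [simp]:
  "k \<le> Suc d \<Longrightarrow> rot_obj d C c k = c (Suc k)" "rot_obj d C c (Suc (Suc d)) = Sob C (c 1)"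
  by (simp_all add: rot_obj_def)

lemma rot_arr_simps [simp]: "k \<le> d \<Longrightarrow> rot_arr d C c \<gamma> k = \<gamma> (Suc k)"
  by (simp add: rot_arr_def)

lemma angle_rot: "angle C c \<gamma> \<Longrightarrow> angle C (rot_obj d C c) (rot_arr d C c \<gamma>)"
  using N2 angle_seq by blast

text \<open>The sign that rotation puts on the last morphism is absorbed into the other factor, so
  it never affects whether a morphism factors.\<close>

lemma rot_last_right:
  assumes "\<gamma> 0 \<in> Arr C (c 0) (c 1)" "g \<in> Arr C Y (Sob C (c 0))"
  shows "\<exists>g' \<in> Arr C Y (Sob C (c 0)).
    Comp C Y (Sob C (c 0)) (Sob C (c 1)) (rot_arr d C c \<gamma> (Suc d)) g =
    Comp C Y (Sob C (c 0)) (Sob C (c 1)) (Sarr C (c 0) (c 1) (\<gamma> 0)) g'"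
proof (cases "even d")
  case True
  thus ?thesis using assms by (intro bexI[of _ g]) (auto simp: rot_arr_def)
next
  case False
  thus ?thesis using assms
    by (intro bexI[of _ "\<ominus>\<^bsub>Hom C Y (Sob C (c 0))\<^esub> g"]) (auto simp: rot_arr_def Comp_linear)
qed

lemma rot_last_left:
  assumes "\<gamma> 0 \<in> Arr C (c 0) (c 1)" "g \<in> Arr C (Sob C (c 1)) Y"
  shows "\<exists>g' \<in> Arr C (Sob C (c 1)) Y.
    Comp C (Sob C (c 0)) (Sob C (c 1)) Y g (rot_arr d C c \<gamma> (Suc d)) =
    Comp C (Sob C (c 0)) (Sob C (c 1)) Y g' (Sarr C (c 0) (c 1) (\<gamma> 0))"
proof (cases "even d")
  case True
  thus ?thesis using assms by (intro bexI[of _ g]) (auto simp: rot_arr_def)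
next
  case False
  thus ?thesis using assms
    by (intro bexI[of _ "\<ominus>\<^bsub>Hom C (Sob C (c 1)) Y\<^esub> g"]) (auto simp: rot_arr_def Comp_linear)
qed

end

section \<open>Exactness derived from rotation and completion of morphisms\<close>

context angulated_category
begin

lemma sigma_seq_rot:
  assumes "sigma_seq d C c \<gamma>"
  shows "sigma_seq d C (rot_obj d C c) (rot_arr d C c \<gamma>)"
proof -
  note seq = sigma_seqD[OF assms]
  have "rot_arr d C c \<gamma> i \<in> Arr C (rot_obj d C c i) (rot_obj d C c (i + 1))" if "i \<le> d + 1" for i
  proof (cases "i = Suc d")
    case True
    thus ?thesis using seq(1) Sarr_closed[OF seq(2)[of 0]] by (simp add: rot_arr_def)
  next
    case False
    thus ?thesis using that seq(2)[of "Suc i"] by simp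
  qed
  thus ?thesis by (simp add: sigma_seq_def)
qed

text \<open>The identity of \<open>c 0\<close> and \<open>\<gamma> 0\<close> complete to a morphism
  from the trivial angle on \<open>c 0\<close>. The second morphism of the trivial angle is zero, so
  commutativity of the square after it gives the claim.\<close>

lemma angle_comp_0:
  assumes "angle C c \<gamma>"
  shows "Comp C (c 0) (c 1) (c (Suc 1)) (\<gamma> 1) (\<gamma> 0) = Zero C (c 0) (c (Suc 1))"
proof -
  obtain Z where Z: "zero_object C Z" using zero_exists by blast
  note seq = sigma_seqD[OF angle_seq[OF assms]]
  define b where "b i = (if i \<le> 1 then c 0 else if i \<le> Suc d then Z else Sob C (c 0))" for i
  define \<beta> where "\<beta> i = (if i = 0 then Ident C (c 0) else Zero C (b i) (b (Suc i)))" for i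
  have b: "angle C b \<beta>"
    by (rule N1_trivial) (use Z in \<open>auto simp: sigma_seq_def b_def \<beta>_def Ident_closed\<close>)
  have "Comp C (b 0) (b 1) (c 1) (\<gamma> 0) (\<beta> 0) = Comp C (b 0) (c 0) (c 1) (\<gamma> 0) (Ident C (c 0))"
    by (simp add: b_def \<beta>_def)
  then obtain \<phi> where \<phi>: "seq_morphism d C b \<beta> c \<gamma> \<phi>" "\<phi> 1 = \<gamma> 0"
    using N3[OF b assms, of "Ident C (c 0)" "\<gamma> 0"] seq(2)[of 0] Ident_closed
    by (auto simp: b_def)
  have "Comp C (b 1) (b (1 + 1)) (c (1 + 1)) (\<phi> (1 + 1)) (\<beta> 1) =
      Comp C (b 1) (c 1) (c (1 + 1)) (\<gamma> 1) (\<phi> 1)"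
    and "\<phi> 2 \<in> Arr C (b 2) (c 2)"
    using \<phi>(1) unfolding seq_morphism_def by auto
  thus ?thesis using \<phi>(2) by (simp add: \<beta>_def b_def numeral_2_eq_2)
qed

text \<open>Rotation lowers the degree by one, so only degree 0 needs an argument; the same
  induction serves the other exactness statements.\<close>

lemma angle_comp:
  assumes "angle C c \<gamma>" "k \<le> d"
  shows "Comp C (c k) (c (Suc k)) (c (Suc (Suc k))) (\<gamma> (Suc k)) (\<gamma> k) = Zero C (c k) (c (Suc (Suc k)))"
  using assms
proof (induction k arbitrary: c \<gamma>)
  case 0
  thus ?case using angle_comp_0 by simp
next
  case (Suc k)
  thus ?case using Suc.IH[OF angle_rot[OF Suc.prems(1)]] by simp
qed

lemma angle_comp_last:
  assumes "angle C c \<gamma>"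
  shows "Comp C (c (Suc d)) (Sob C (c 0)) (Sob C (c 1)) (Sarr C (c 0) (c 1) (\<gamma> 0)) (\<gamma> (Suc d)) =
    Zero C (c (Suc d)) (Sob C (c 1))"
proof -
  note seq = sigma_seqD[OF angle_seq[OF assms]]
  have "Comp C (c (Suc d)) (c (Suc (Suc d))) (Sob C (c 1)) (rot_arr d C c \<gamma> (Suc d)) (\<gamma> (Suc d)) =
      Zero C (c (Suc d)) (Sob C (c 1))"
    using angle_comp[OF angle_rot[OF assms], of d] by simp
  thus ?thesis
    using seq(1) seq(2)[of 0] seq(2)[of "Suc d"]
    by (cases "even d") (auto simp: rot_arr_def Comp_linear)
qed

text \<open>Zero in degree 0 and \<open>f\<close> in degree 1 complete to a morphism into an angle
  whose morphism from degree 1 to degree 2 is the identity of \<open>Y\<close>. The component in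
  degree 2 is the required factor.\<close>

lemma angle_contra_0:
  assumes "angle C c \<gamma>" "f \<in> Arr C (c 1) Y" "Comp C (c 0) (c 1) Y f (\<gamma> 0) = Zero C (c 0) Y"
  shows "\<exists>g \<in> Arr C (c (Suc 1)) Y. f = Comp C (c 1) (c (Suc 1)) Y g (\<gamma> 1)"
proof -
  obtain Z where Z: "zero_object C Z" using zero_exists by blast
  note seq = sigma_seqD[OF angle_seq[OF assms(1)]]
  \<comment> \<open>The trivial angle on \<open>Y\<close> rotated backwards by one place, so
    \<open>N2\<close> is used from the rotated sequence to the original one. Degree d + 2 has to
    hold the shift of the zero object in degree 0.\<close>
  define s where "s i = (if i = 0 then Z else if i \<le> 2 then Y else if i \<le> Suc d then Z else Sob C Z)" for i
  define \<sigma> where "\<sigma> i = (if i = 1 then Ident C Y else Zero C (s i) (s (Suc i)))" for i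
  have s: "sigma_seq d C s \<sigma>"
    using d_pos by (auto simp: sigma_seq_def s_def \<sigma>_def Ident_closed numeral_2_eq_2)
  have "angle C (rot_obj d C s) (rot_arr d C s \<sigma>)"
  proof (rule N1_trivial)
    show "sigma_seq d C (rot_obj d C s) (rot_arr d C s \<sigma>)"
      by (rule sigma_seq_rot[OF s])
    show "rot_obj d C s 1 = rot_obj d C s 0" using d_pos by (simp add: s_def)
    show "rot_arr d C s \<sigma> 0 = Ident C (rot_obj d C s 0)" by (simp add: \<sigma>_def s_def)
    show "\<forall>i\<in>{2..d + 1}. zero_object C (rot_obj d C s i)"
      using Z zero_object_Sob[OF Z] by (auto simp: s_def)
  qed
  hence ang: "angle C s \<sigma>" using N2[OF s] by simp
  have sob: "s 0 = Z" "s 1 = Y" "s 2 = Y" by (simp_all add: s_def)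
  have "Comp C (c 0) (c 1) (s 1) f (\<gamma> 0) = Comp C (c 0) (s 0) (s 1) (\<sigma> 0) (Zero C (c 0) (s 0))"
    using assms(3) sob by (simp add: \<sigma>_def)
  then obtain \<phi> where \<phi>: "seq_morphism d C c \<gamma> s \<sigma> \<phi>" "\<phi> 1 = f"
    using N3[OF assms(1) ang, of "Zero C (c 0) (s 0)" f] assms(2) sob by auto
  have "Comp C (c 1) (c (1 + 1)) (s (1 + 1)) (\<phi> (1 + 1)) (\<gamma> 1) =
      Comp C (c 1) (s 1) (s (1 + 1)) (\<sigma> 1) (\<phi> 1)"
    and p2: "\<phi> 2 \<in> Arr C (c 2) (s 2)"
    using \<phi>(1) unfolding seq_morphism_def by auto
  hence "Comp C (c 1) (c 2) Y (\<phi> 2) (\<gamma> 1) = f"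
    using assms(2) sob \<phi>(2) by (simp add: \<sigma>_def Ident_left numeral_2_eq_2)
  thus ?thesis using p2 sob by (intro bexI[of _ "\<phi> 2"]) (auto simp: numeral_2_eq_2)
qed

lemma angle_contra:
  assumes "angle C c \<gamma>" "k \<le> d" "f \<in> Arr C (c (Suc k)) Y"
    "Comp C (c k) (c (Suc k)) Y f (\<gamma> k) = Zero C (c k) Y"
  shows "\<exists>g \<in> Arr C (c (Suc (Suc k))) Y. f = Comp C (c (Suc k)) (c (Suc (Suc k))) Y g (\<gamma> (Suc k))"
  using assms
proof (induction k arbitrary: c \<gamma>)
  case 0
  thus ?case using angle_contra_0[of c \<gamma> f Y] by simp
next
  case (Suc k)
  thus ?case using Suc.IH[OF angle_rot[OF Suc.prems(1)]] by simp
qed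

text \<open>This is exactness in the last place of the rotated angle, whose last morphism is the
  shift of \<open>\<gamma> 0\<close> up to sign. The shift is full and faithful, so the factor found
  there can be unshifted.\<close>

lemma angle_contra_last:
  assumes "angle C c \<gamma>" "f \<in> Arr C (c 0) Y"
    "Comp C (c (Suc d)) (Sob C (c 0)) (Sob C Y) (Sarr C (c 0) Y f) (\<gamma> (Suc d)) = Zero C (c (Suc d)) (Sob C Y)"
  shows "\<exists>g \<in> Arr C (c 1) Y. f = Comp C (c 0) (c 1) Y g (\<gamma> 0)"
proof -
  note seq = sigma_seqD[OF angle_seq[OF assms(1)]]
  have "\<exists>g \<in> Arr C (Sob C (c 1)) (Sob C Y).
      Sarr C (c 0) Y f = Comp C (Sob C (c 0)) (Sob C (c 1)) (Sob C Y) g (rot_arr d C c \<gamma> (Suc d))"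
    using angle_contra[OF angle_rot[OF assms(1)], of d "Sarr C (c 0) Y f" "Sob C Y"] assms seq(1)
    by simp
  then obtain g where g: "g \<in> Arr C (Sob C (c 1)) (Sob C Y)"
      "Sarr C (c 0) Y f = Comp C (Sob C (c 0)) (Sob C (c 1)) (Sob C Y) g (Sarr C (c 0) (c 1) (\<gamma> 0))"
    using rot_last_left[of \<gamma> c _ "Sob C Y"] seq(2)[of 0] by force
  obtain g' where g': "g' \<in> Arr C (c 1) Y" "g = Sarr C (c 1) Y g'" using Sarr_surj[OF g(1)] .
  have "Sarr C (c 0) Y f = Sarr C (c 0) Y (Comp C (c 0) (c 1) Y g' (\<gamma> 0))"
    using g(2) g' seq(2)[of 0] by (simp add: Sarr_comp)
  hence "f = Comp C (c 0) (c 1) Y g' (\<gamma> 0)"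
    using Sarr_inj assms(2) g'(1) seq(2)[of 0] by (simp add: Comp_closed)
  thus ?thesis using g'(1) by blast
qed

text \<open>The trivial angle on \<open>Y\<close>, rotated forwards, starts with Y -> 0 and ends
  with the identity of Sigma^d Y up to the sign (-1)^d. The components \<open>f\<close> and zero
  complete to a morphism from it to \<open>c\<close>, and the last square factors the shift of
  \<open>f\<close>.\<close>

lemma angle_co_0:
  assumes "angle C c \<gamma>" "f \<in> Arr C Y (c 0)" "Comp C Y (c 0) (c 1) (\<gamma> 0) f = Zero C Y (c 1)"
  shows "\<exists>g \<in> Arr C (Sob C Y) (c (Suc d)).
    Sarr C Y (c 0) f = Comp C (Sob C Y) (c (Suc d)) (Sob C (c 0)) (\<gamma> (Suc d)) g"
proof -
  obtain Z where Z: "zero_object C Z" using zero_exists by blast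
  note seq = sigma_seqD[OF angle_seq[OF assms(1)]]
  define b where "b i = (if i \<le> 1 then Y else if i \<le> Suc d then Z else Sob C Y)" for i
  define \<beta> where "\<beta> i = (if i = 0 then Ident C Y else Zero C (b i) (b (Suc i)))" for i
  have b: "angle C b \<beta>"
    by (rule N1_trivial) (use Z in \<open>auto simp: sigma_seq_def b_def \<beta>_def Ident_closed\<close>)
  let ?b = "rot_obj d C b" and ?\<beta> = "rot_arr d C b \<beta>"
  have ang: "angle C ?b ?\<beta>" by (rule angle_rot[OF b])
  have bs: "?b 0 = Y" "?b 1 = Z" "?b (Suc d) = Sob C Y" "?b (Suc (Suc d)) = Sob C Y"
    using d_pos by (simp_all add: b_def)
  have \<beta>0: "?\<beta> 0 = Zero C Y Z"
    using d_pos by (simp add: \<beta>_def b_def)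
  have "Comp C (?b 0) (?b 1) (c 1) (Zero C Z (c 1)) (?\<beta> 0) = Comp C (?b 0) (c 0) (c 1) (\<gamma> 0) f"
    using assms(3) bs \<beta>0 by simp
  then obtain \<phi> where \<phi>: "seq_morphism d C ?b ?\<beta> c \<gamma> \<phi>" "\<phi> 0 = f"
    using N3[OF ang assms(1), of f "Zero C Z (c 1)"] assms(2) bs by auto
  have p: "\<phi> (Suc d) \<in> Arr C (Sob C Y) (c (Suc d))" "\<phi> (Suc (Suc d)) = Sarr C Y (c 0) f"
    using \<phi> bs unfolding seq_morphism_def by (metis le_add2 add_2_eq_Suc' le_SucI le_refl)+
  have sq: "Comp C (Sob C Y) (Sob C Y) (Sob C (c 0)) (Sarr C Y (c 0) f) (?\<beta> (Suc d)) =
      Comp C (Sob C Y) (c (Suc d)) (Sob C (c 0)) (\<gamma> (Suc d)) (\<phi> (Suc d))"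
    using \<phi>(1) bs p(2) seq(1) unfolding seq_morphism_def by (metis Suc_eq_plus1 add_2_eq_Suc' le_refl)
  have \<beta>0': "\<beta> 0 = Ident C Y" "b 0 = Y" "b 1 = Y" by (simp_all add: \<beta>_def b_def)
  show ?thesis
  proof (cases "even d")
    case True
    hence "?\<beta> (Suc d) = Ident C (Sob C Y)" using \<beta>0' by (simp add: rot_arr_def)
    thus ?thesis using sq p(1) Sarr_closed[OF assms(2)] by (intro bexI[of _ "\<phi> (Suc d)"]) (simp_all add: Ident_right)
  next
    case False
    hence "?\<beta> (Suc d) = \<ominus>\<^bsub>Hom C (Sob C Y) (Sob C Y)\<^esub> Ident C (Sob C Y)"
      using \<beta>0' by (simp add: rot_arr_def)
    hence "\<ominus>\<^bsub>Hom C (Sob C Y) (Sob C (c 0))\<^esub> Sarr C Y (c 0) f =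
        Comp C (Sob C Y) (c (Suc d)) (Sob C (c 0)) (\<gamma> (Suc d)) (\<phi> (Suc d))"
      using sq Sarr_closed[OF assms(2)] Ident_closed[of "Sob C Y"]
      by (simp add: Comp_linear Ident_right)
    hence "Sarr C Y (c 0) f = Comp C (Sob C Y) (c (Suc d)) (Sob C (c 0)) (\<gamma> (Suc d))
        (\<ominus>\<^bsub>Hom C (Sob C Y) (c (Suc d))\<^esub> \<phi> (Suc d))"
      using p(1) seq(2)[of "Suc d"] seq(1) Sarr_closed[OF assms(2)] Hom.M.minus_minus
      by (simp add: Comp_linear) (metis Hom.M.minus_minus)
    thus ?thesis using p(1) by (intro bexI[of _ "\<ominus>\<^bsub>Hom C (Sob C Y) (c (Suc d))\<^esub> \<phi> (Suc d)"]) auto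
  qed
qed

lemma angle_co:
  assumes "angle C c \<gamma>" "k \<le> d" "f \<in> Arr C Y (c (Suc k))"
    "Comp C Y (c (Suc k)) (c (Suc (Suc k))) (\<gamma> (Suc k)) f = Zero C Y (c (Suc (Suc k)))"
  shows "\<exists>g \<in> Arr C Y (c k). f = Comp C Y (c k) (c (Suc k)) (\<gamma> k) g"
  using assms
proof (induction k arbitrary: c \<gamma>)
  case (0 c \<gamma>)
  note seq = sigma_seqD[OF angle_seq[OF 0(1)]]
  \<comment> \<open>The rotated angle has the shift of \<open>\<gamma> 0\<close>, up to sign, as its
    last morphism; unshifting the factor obtained there proves degree 0.\<close>
  obtain g where g: "g \<in> Arr C (Sob C Y) (Sob C (c 0))"
      "Sarr C Y (c 1) f = Comp C (Sob C Y) (Sob C (c 0)) (Sob C (c 1)) (Sarr C (c 0) (c 1) (\<gamma> 0)) g"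
    using angle_co_0[OF angle_rot[OF 0(1)], of f Y] 0 seq(1) seq(2)[of 0] rot_last_right[of \<gamma> c _ "Sob C Y"]
    by force
  obtain g' where g': "g' \<in> Arr C Y (c 0)" "g = Sarr C Y (c 0) g'" using Sarr_surj[OF g(1)] .
  have "Sarr C Y (c 1) f = Sarr C Y (c 1) (Comp C Y (c 0) (c 1) (\<gamma> 0) g')"
    using g(2) g' seq(2)[of 0] by (simp add: Sarr_comp)
  moreover have "Comp C Y (c 0) (c 1) (\<gamma> 0) g' \<in> Arr C Y (c 1)"
    using Comp_closed[OF g'(1)] seq(2)[of 0] by simp
  ultimately have "f = Comp C Y (c 0) (c 1) (\<gamma> 0) g'"
    using Sarr_inj[of f Y "c 1" "Comp C Y (c 0) (c 1) (\<gamma> 0) g'"] 0(3) by simp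
  thus ?case using g'(1) by auto
next
  case (Suc k)
  thus ?case using Suc.IH[OF angle_rot[OF Suc.prems(1)]] by simp
qed

lemma hexact_angle:
  assumes "angle C c \<gamma>"
  shows "hexact c \<gamma>"
  unfolding hexact_def
  using angle_seq[OF assms] angle_comp[OF assms] angle_comp_last[OF assms] angle_contra[OF assms]
    angle_contra_last[OF assms] angle_co[OF assms] by blast

text \<open>The shift is bijective on objects and on morphism spaces, so every test object and every
  test morphism is the shift of one for the original sequence.\<close>

lemma hexact_shift:
  assumes "hexact c \<gamma>"
  shows "hexact (\<lambda>i. Sob C (c i)) (\<lambda>i. Sarr C (c i) (c (Suc i)) (\<gamma> i))"
  unfolding hexact_def
proof (intro conjI allI impI ballI)
  note arr = hexact_arr[OF assms]
  note last = hexact_last[OF assms]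
  show "sigma_seq d C (\<lambda>i. Sob C (c i)) (\<lambda>i. Sarr C (c i) (c (Suc i)) (\<gamma> i))"
    using last arr by (simp add: sigma_seq_def)
  show "Comp C (Sob C (c k)) (Sob C (c (Suc k))) (Sob C (c (Suc (Suc k))))
      (Sarr C (c (Suc k)) (c (Suc (Suc k))) (\<gamma> (Suc k))) (Sarr C (c k) (c (Suc k)) (\<gamma> k)) =
      Zero C (Sob C (c k)) (Sob C (c (Suc (Suc k))))" if "k \<le> d" for k
    using hexact_comp[OF assms that] arr[of k] arr[of "Suc k"] that by (simp add: Sarr_comp[symmetric])
  show "Comp C (Sob C (c (Suc d))) (Sob C (Sob C (c 0))) (Sob C (Sob C (c 1)))
      (Sarr C (Sob C (c 0)) (Sob C (c 1)) (Sarr C (c 0) (c (Suc 0)) (\<gamma> 0)))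
      (Sarr C (c (Suc d)) (c (Suc (Suc d))) (\<gamma> (Suc d))) =
      Zero C (Sob C (c (Suc d))) (Sob C (Sob C (c 1)))"
    using hexact_comp_last[OF assms] arr[of 0] arr[of "Suc d"] last by (simp add: Sarr_comp[symmetric])
next
  note arr = hexact_arr[OF assms]
  fix k Y f
  assume k: "k \<le> d" and f: "f \<in> Arr C (Sob C (c (Suc k))) Y"
    and z: "Comp C (Sob C (c k)) (Sob C (c (Suc k))) Y f (Sarr C (c k) (c (Suc k)) (\<gamma> k)) = Zero C (Sob C (c k)) Y"
  obtain Y' where Y: "Y = Sob C Y'" using Sob_surj .
  obtain f' where f': "f' \<in> Arr C (c (Suc k)) Y'" "f = Sarr C (c (Suc k)) Y' f'"
    using Sarr_surj f unfolding Y by blast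
  have "Comp C (c k) (c (Suc k)) Y' f' (\<gamma> k) = Zero C (c k) Y'"
    using z f' arr[of k] k unfolding Y by (simp add: Sarr_comp[symmetric])
  then obtain g where g: "g \<in> Arr C (c (Suc (Suc k))) Y'"
      "f' = Comp C (c (Suc k)) (c (Suc (Suc k))) Y' g (\<gamma> (Suc k))"
    using hexact_contra[OF assms k f'(1)] by blast
  show "\<exists>g\<in>Arr C (Sob C (c (Suc (Suc k)))) Y. f =
      Comp C (Sob C (c (Suc k))) (Sob C (c (Suc (Suc k)))) Y g (Sarr C (c (Suc k)) (c (Suc (Suc k))) (\<gamma> (Suc k)))"
    using g f' arr[of "Suc k"] k unfolding Y
    by (intro bexI[of _ "Sarr C (c (Suc (Suc k))) Y' g"]) (auto simp: Sarr_comp)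
next
  note arr = hexact_arr[OF assms]
  fix Y f
  assume f: "f \<in> Arr C (Sob C (c 0)) Y"
    and z: "Comp C (Sob C (c (Suc d))) (Sob C (Sob C (c 0))) (Sob C Y) (Sarr C (Sob C (c 0)) Y f)
      (Sarr C (c (Suc d)) (c (Suc (Suc d))) (\<gamma> (Suc d))) = Zero C (Sob C (c (Suc d))) (Sob C Y)"
  obtain Y' where Y: "Y = Sob C Y'" using Sob_surj .
  obtain f' where f': "f' \<in> Arr C (c 0) Y'" "f = Sarr C (c 0) Y' f'"
    using Sarr_surj f unfolding Y by blast
  have "Comp C (c (Suc d)) (Sob C (c 0)) (Sob C Y') (Sarr C (c 0) Y' f') (\<gamma> (Suc d)) = Zero C (c (Suc d)) (Sob C Y')"
    using z f' arr[of "Suc d"] hexact_last[OF assms] unfolding Y by (simp add: Sarr_comp[symmetric])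
  then obtain g where g: "g \<in> Arr C (c 1) Y'" "f' = Comp C (c 0) (c 1) Y' g (\<gamma> 0)"
    using hexact_contra_0[OF assms f'(1)] by blast
  show "\<exists>g\<in>Arr C (Sob C (c 1)) Y. f =
      Comp C (Sob C (c 0)) (Sob C (c 1)) Y g (Sarr C (c 0) (c (Suc 0)) (\<gamma> 0))"
    using g f' arr[of 0] unfolding Y by (intro bexI[of _ "Sarr C (c 1) Y' g"]) (auto simp: Sarr_comp)
next
  note arr = hexact_arr[OF assms]
  fix k Y f
  assume k: "k \<le> d" and f: "f \<in> Arr C Y (Sob C (c (Suc k)))"
    and z: "Comp C Y (Sob C (c (Suc k))) (Sob C (c (Suc (Suc k))))
      (Sarr C (c (Suc k)) (c (Suc (Suc k))) (\<gamma> (Suc k))) f = Zero C Y (Sob C (c (Suc (Suc k))))"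
  obtain Y' where Y: "Y = Sob C Y'" using Sob_surj .
  obtain f' where f': "f' \<in> Arr C Y' (c (Suc k))" "f = Sarr C Y' (c (Suc k)) f'"
    using Sarr_surj f unfolding Y by blast
  have "Comp C Y' (c (Suc k)) (c (Suc (Suc k))) (\<gamma> (Suc k)) f' = Zero C Y' (c (Suc (Suc k)))"
    using z f' arr[of "Suc k"] k unfolding Y by (simp add: Sarr_comp[symmetric])
  then obtain g where g: "g \<in> Arr C Y' (c k)" "f' = Comp C Y' (c k) (c (Suc k)) (\<gamma> k) g"
    using hexact_co[OF assms k f'(1)] by blast
  show "\<exists>g\<in>Arr C Y (Sob C (c k)). f =
      Comp C Y (Sob C (c k)) (Sob C (c (Suc k))) (Sarr C (c k) (c (Suc k)) (\<gamma> k)) g"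
    using g f' arr[of k] k unfolding Y
    by (intro bexI[of _ "Sarr C Y' (c k) g"]) (auto simp: Sarr_comp)
qed

end

section \<open>Dimension counts\<close>

text \<open>In the applications \<open>a k\<close> is a dimension in an exact sequence,
  \<open>r k\<close> the rank of an adjacent map and \<open>r'\<close> the rank of the map at the
  beginning. Each inner rank is counted twice with opposite signs.\<close>

lemma alternating_sum_telescope:
  fixes a r :: "nat \<Rightarrow> int"
  assumes "a 0 = r' + r 0" "\<And>k. k \<le> n \<Longrightarrow> a (Suc k) = r k + r (Suc k)"
  shows "(\<Sum>k\<le>Suc n. (- 1) ^ k * a k) = r' + (- 1) ^ Suc n * r (Suc n)"
  using assms(2)
proof (induction n)
  case 0
  thus ?case using assms(1) by simp
next
  case (Suc n)
  have "(\<Sum>k\<le>Suc n. (- 1) ^ k * a k) = r' + (- 1) ^ Suc n * r (Suc n)"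
    using Suc by simp
  thus ?case using Suc.prems[of "Suc n"] by (simp add: algebra_simps)
qed

lemma alternating_sum_rev:
  fixes a :: "nat \<Rightarrow> int"
  shows "(\<Sum>i\<le>d. (- 1) ^ i * a (d - i)) = (- 1) ^ d * (\<Sum>k\<le>d. (- 1) ^ k * a k)"
proof -
  have "(\<Sum>i\<le>d. (- 1) ^ i * a (d - i)) = (\<Sum>k\<le>d. (- 1) ^ (d - k) * a k)"
    by (rule sum.reindex_bij_witness[of _ "\<lambda>i. d - i" "\<lambda>i. d - i"]) auto
  also have "\<dots> = (\<Sum>k\<le>d. (- 1) ^ d * ((- 1) ^ k * a k))"
    by (intro sum.cong refl) (auto simp: power_diff minus_one_power_iff)
  finally show ?thesis by (simp add: sum_distrib_left)
qed

locale hom_finite_angulated_category = angulated_category K d C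
  for K :: "'k ring" and d :: nat and C :: "('k, 'o, 'm, 'z) angcat_scheme" +
  assumes hom_finite: "hom_finite K C"
begin

lemma Hom_fin_dim: "vectorspace.fin_dim K (Hom C X Y)"
  using hom_finite by (simp add: hom_finite_def)

lemma hom_dim_sdim: "hom_dim K C X Y = sdim K (Hom C X Y) (Arr C X Y)"
  by (simp add: hom_dim_def sdim_carrier)

lemma hom_dim_eq_0: "hom_dim K C X Y = 0 \<longleftrightarrow> Arr C X Y = {Zero C X Y}"
  unfolding hom_dim_sdim by (intro sdim_eq_0 Hom_fin_dim subspace_carrier Hom_vectorspace)

lemma hom_dim_Sob: "hom_dim K C (Sob C X) (Sob C Y) = hom_dim K C X Y"
  using sdim_image_inj[OF Hom_fin_dim subspace_carrier[OF Hom_vectorspace] Hom_vectorspace Sarr_hom]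
    Sarr_bij[of X Y] unfolding bij_betw_def hom_dim_sdim by metis

text \<open>The rank of the map from Hom(X', Y) to Hom(X, Y) induced by \<open>f\<close>.\<close>

definition pre_rank :: "'o \<Rightarrow> 'o \<Rightarrow> 'm \<Rightarrow> 'o \<Rightarrow> nat" where
  "pre_rank X X' f Y = sdim K (Hom C X Y) ((\<lambda>g. Comp C X X' Y g f) ` Arr C X' Y)"

lemma rank_nullity_pre:
  assumes "f \<in> Arr C X X'" "subspace K W (Hom C X' Y)"
  shows "sdim K (Hom C X Y) ((\<lambda>g. Comp C X X' Y g f) ` W) +
    sdim K (Hom C X' Y) {g \<in> W. Comp C X X' Y g f = Zero C X Y} = sdim K (Hom C X' Y) W"
  by (intro rank_nullity_subspace Hom_fin_dim Hom_vectorspace Comp_linear_left assms)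

lemma hexact_pre_dim:
  assumes "hexact c \<gamma>" "k \<le> d"
  shows "hom_dim K C (c (Suc k)) Y = pre_rank (c k) (c (Suc k)) (\<gamma> k) Y +
    pre_rank (c (Suc k)) (c (Suc (Suc k))) (\<gamma> (Suc k)) Y"
proof -
  note arr = hexact_arr[OF assms(1)]
  have \<gamma>: "\<gamma> k \<in> Arr C (c k) (c (Suc k))" "\<gamma> (Suc k) \<in> Arr C (c (Suc k)) (c (Suc (Suc k)))"
    using arr assms(2) by simp_all
  have "{g \<in> Arr C (c (Suc k)) Y. Comp C (c k) (c (Suc k)) Y g (\<gamma> k) = Zero C (c k) Y} =
      (\<lambda>g. Comp C (c (Suc k)) (c (Suc (Suc k))) Y g (\<gamma> (Suc k))) ` Arr C (c (Suc (Suc k))) Y"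
  proof (intro subset_antisym subsetI)
    fix g assume "g \<in> {g \<in> Arr C (c (Suc k)) Y. Comp C (c k) (c (Suc k)) Y g (\<gamma> k) = Zero C (c k) Y}"
    thus "g \<in> (\<lambda>g. Comp C (c (Suc k)) (c (Suc (Suc k))) Y g (\<gamma> (Suc k))) ` Arr C (c (Suc (Suc k))) Y"
      using hexact_contra[OF assms, of g Y] by auto
  next
    fix g assume "g \<in> (\<lambda>g. Comp C (c (Suc k)) (c (Suc (Suc k))) Y g (\<gamma> (Suc k))) ` Arr C (c (Suc (Suc k))) Y"
    thus "g \<in> {g \<in> Arr C (c (Suc k)) Y. Comp C (c k) (c (Suc k)) Y g (\<gamma> k) = Zero C (c k) Y}"
      using \<gamma> hexact_comp[OF assms] by (auto simp: Comp_assoc)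
  qed
  thus ?thesis
    using rank_nullity_pre[OF \<gamma>(1) subspace_carrier[OF Hom_vectorspace], of Y]
    by (simp add: pre_rank_def hom_dim_sdim)
qed

text \<open>In degree 0 the map out of Hom(c 0, Y) shifts and then precomposes with the last
  morphism. Since the shift is bijective on morphisms, its image is that of precomposition on
  Hom(Sigma^d c 0, Sigma^d Y); hence \<open>Sob C Y\<close> in the first rank.\<close>

lemma hexact_pre_dim_0:
  assumes "hexact c \<gamma>"
  shows "hom_dim K C (c 0) Y = pre_rank (c (Suc d)) (Sob C (c 0)) (\<gamma> (Suc d)) (Sob C Y) +
    pre_rank (c 0) (c 1) (\<gamma> 0) Y"
proof -
  note arr = hexact_arr[OF assms]
  have \<gamma>: "\<gamma> 0 \<in> Arr C (c 0) (c 1)" "\<gamma> (Suc d) \<in> Arr C (c (Suc d)) (Sob C (c 0))"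
    using arr[of 0] arr[of "Suc d"] hexact_last[OF assms] by simp_all
  let ?T = "\<lambda>f. Comp C (c (Suc d)) (Sob C (c 0)) (Sob C Y) (Sarr C (c 0) Y f) (\<gamma> (Suc d))"
  have T: "?T \<in> module_hom K (Hom C (c 0) Y) (Hom C (c (Suc d)) (Sob C Y))"
    using Sarr_hom[of "c 0" Y] Comp_linear_left[OF \<gamma>(2), of "Sob C Y"] by (auto simp: module_hom_def)
  have img: "?T ` Arr C (c 0) Y =
      (\<lambda>g. Comp C (c (Suc d)) (Sob C (c 0)) (Sob C Y) g (\<gamma> (Suc d))) ` Arr C (Sob C (c 0)) (Sob C Y)"
    using Sarr_bij[of "c 0" Y] unfolding bij_betw_def by (metis (no_types, lifting) image_cong image_image)
  have ker: "{f \<in> Arr C (c 0) Y. ?T f = Zero C (c (Suc d)) (Sob C Y)} =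
      (\<lambda>g. Comp C (c 0) (c 1) Y g (\<gamma> 0)) ` Arr C (c 1) Y"
  proof (intro subset_antisym subsetI)
    fix f assume "f \<in> {f \<in> Arr C (c 0) Y. ?T f = Zero C (c (Suc d)) (Sob C Y)}"
    thus "f \<in> (\<lambda>g. Comp C (c 0) (c 1) Y g (\<gamma> 0)) ` Arr C (c 1) Y"
      using hexact_contra_0[OF assms, of f Y] by auto
  next
    fix f assume "f \<in> (\<lambda>g. Comp C (c 0) (c 1) Y g (\<gamma> 0)) ` Arr C (c 1) Y"
    then obtain g where g: "g \<in> Arr C (c 1) Y" "f = Comp C (c 0) (c 1) Y g (\<gamma> 0)" by auto
    thus "f \<in> {f \<in> Arr C (c 0) Y. ?T f = Zero C (c (Suc d)) (Sob C Y)}"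
      using \<gamma> hexact_comp_last[OF assms] Comp_assoc[OF \<gamma>(2) Sarr_closed[OF \<gamma>(1)] Sarr_closed[OF g(1)]]
      by (simp add: Sarr_comp)
  qed
  show ?thesis
    using rank_nullity_subspace[OF Hom_fin_dim subspace_carrier[OF Hom_vectorspace] Hom_vectorspace T]
    unfolding img ker by (simp add: pre_rank_def hom_dim_sdim)
qed

text \<open>Only the ranks of the last morphism survive, taken at \<open>Sob C Y\<close> and at
  \<open>Y\<close>. They are the origin of the two correction terms of the Euler form.\<close>

lemma hexact_alternating_sum:
  assumes "hexact c \<gamma>"
  shows "(\<Sum>k\<le>Suc d. (- 1) ^ k * int (hom_dim K C (c k) Y)) =
    int (pre_rank (c (Suc d)) (Sob C (c 0)) (\<gamma> (Suc d)) (Sob C Y)) +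
    (- 1) ^ Suc d * int (pre_rank (c (Suc d)) (Sob C (c 0)) (\<gamma> (Suc d)) Y)"
proof -
  have "(\<Sum>k\<le>Suc d. (- 1) ^ k * int (hom_dim K C (c k) Y)) =
    int (pre_rank (c (Suc d)) (Sob C (c 0)) (\<gamma> (Suc d)) (Sob C Y)) +
    (- 1) ^ Suc d * int (pre_rank (c (Suc d)) (c (Suc (Suc d))) (\<gamma> (Suc d)) Y)"
    using hexact_pre_dim_0[OF assms, of Y] hexact_pre_dim[OF assms, of _ Y]
    by (intro alternating_sum_telescope[where r = "\<lambda>k. int (pre_rank (c k) (c (Suc k)) (\<gamma> k) Y)"]) simp_all
  thus ?thesis using hexact_last[OF assms] by simp
qed

definition post_rank :: "'o \<Rightarrow> 'o \<Rightarrow> 'm \<Rightarrow> 'o \<Rightarrow> nat" where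
  "post_rank X X' f Y = sdim K (Hom C Y X') (Comp C Y X X' f ` Arr C Y X)"

lemma hexact_post_dim:
  assumes "hexact c \<gamma>" "k \<le> d"
  shows "hom_dim K C Y (c (Suc k)) = post_rank (c k) (c (Suc k)) (\<gamma> k) Y +
    post_rank (c (Suc k)) (c (Suc (Suc k))) (\<gamma> (Suc k)) Y"
proof -
  note arr = hexact_arr[OF assms(1)]
  have \<gamma>: "\<gamma> k \<in> Arr C (c k) (c (Suc k))" "\<gamma> (Suc k) \<in> Arr C (c (Suc k)) (c (Suc (Suc k)))"
    using arr assms(2) by simp_all
  have "{f \<in> Arr C Y (c (Suc k)). Comp C Y (c (Suc k)) (c (Suc (Suc k))) (\<gamma> (Suc k)) f = Zero C Y (c (Suc (Suc k)))} =
      Comp C Y (c k) (c (Suc k)) (\<gamma> k) ` Arr C Y (c k)"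
  proof (intro subset_antisym subsetI)
    fix g assume "g \<in> {f \<in> Arr C Y (c (Suc k)). Comp C Y (c (Suc k)) (c (Suc (Suc k))) (\<gamma> (Suc k)) f = Zero C Y (c (Suc (Suc k)))}"
    thus "g \<in> Comp C Y (c k) (c (Suc k)) (\<gamma> k) ` Arr C Y (c k)"
      using hexact_co[OF assms, of g Y] by auto
  next
    fix g assume "g \<in> Comp C Y (c k) (c (Suc k)) (\<gamma> k) ` Arr C Y (c k)"
    thus "g \<in> {f \<in> Arr C Y (c (Suc k)). Comp C Y (c (Suc k)) (c (Suc (Suc k))) (\<gamma> (Suc k)) f = Zero C Y (c (Suc (Suc k)))}"
      using \<gamma> hexact_comp[OF assms] by (auto simp: Comp_assoc[symmetric])
  qed
  moreover have "sdim K (Hom C Y (c (Suc (Suc k)))) (Comp C Y (c (Suc k)) (c (Suc (Suc k))) (\<gamma> (Suc k)) ` Arr C Y (c (Suc k))) +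
      sdim K (Hom C Y (c (Suc k))) {f \<in> Arr C Y (c (Suc k)). Comp C Y (c (Suc k)) (c (Suc (Suc k))) (\<gamma> (Suc k)) f = Zero C Y (c (Suc (Suc k)))} =
      sdim K (Hom C Y (c (Suc k))) (Arr C Y (c (Suc k)))"
    by (intro rank_nullity_subspace Hom_fin_dim subspace_carrier Hom_vectorspace Comp_linear_right[OF \<gamma>(2)])
  ultimately show ?thesis by (simp add: post_rank_def hom_dim_sdim)
qed

section \<open>Cluster tilting and additivity\<close>

definition rigid :: "'o set \<Rightarrow> bool" where
  "rigid A \<longleftrightarrow> (\<forall>X\<in>A. \<forall>Y\<in>A. Arr C X (Sob C Y) = {Zero C X (Sob C Y)})"

definition tilting :: "'o set \<Rightarrow> bool" where
  "tilting A \<longleftrightarrow> rigid A \<and> (\<forall>x. \<exists>c \<gamma>. resolution d C A x c \<gamma>)"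

text \<open>Described by vanishing instead of factorization, it is visibly a subspace and stable
  under composition on both sides, for any set \<open>A\<close> of objects.\<close>

definition annihilated :: "'o set \<Rightarrow> 'o \<Rightarrow> 'o \<Rightarrow> 'm set" where
  "annihilated A X Y = {f \<in> Arr C X Y. \<forall>W\<in>A. \<forall>p\<in>Arr C W X. Comp C W X Y f p = Zero C W Y}"

lemma tilting_rigid: "tilting A \<Longrightarrow> rigid A"
  by (simp add: tilting_def)

lemma rigid_zero: "rigid A \<Longrightarrow> X \<in> A \<Longrightarrow> Y \<in> A \<Longrightarrow> f \<in> Arr C X (Sob C Y) \<Longrightarrow> f = Zero C X (Sob C Y)"
  by (auto simp: rigid_def)

lemma tilting_resolution:
  assumes "tilting A"
  obtains c \<gamma> where "resolution d C A x c \<gamma>"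
  using assms unfolding tilting_def by blast

lemma resolutionD:
  assumes "resolution d C A x c \<gamma>"
  shows "hexact c \<gamma>" "c (Suc d) = x" "k \<le> d \<Longrightarrow> c k \<in> A"
proof -
  show "hexact c \<gamma>" "c (Suc d) = x"
    using assms by (simp_all add: resolution_def hexact_angle)
  assume "k \<le> d"
  moreover have "c (d - (d - k)) \<in> A" using assms diff_le_self unfolding resolution_def by blast
  ultimately show "c k \<in> A" by simp
qed

lemma annihilated_subspace: "subspace K (annihilated A X Y) (Hom C X Y)"
  by (rule subspaceI[OF Hom_vectorspace]) (auto simp: annihilated_def Comp_linear)

lemma annihilated_comp_left:
  assumes "f \<in> annihilated A X Y" "g \<in> Arr C Y Z"
  shows "Comp C X Y Z g f \<in> annihilated A X Z"
  using assms by (auto simp: annihilated_def Comp_assoc)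

lemma annihilated_comp_right:
  assumes "f \<in> annihilated A X Y" "g \<in> Arr C Z X"
  shows "Comp C Z X Y f g \<in> annihilated A Z Y"
  using assms by (auto simp: annihilated_def Comp_assoc)

text \<open>A morphism killing everything from \<open>A\<close> kills \<open>c d\<close> ->
  \<open>X\<close>, so by exactness it factors through the last morphism of the resolution.
  Conversely, morphisms from \<open>A\<close> to the shift of \<open>c 0\<close> vanish by
  rigidity.\<close>

lemma annihilated_resolution:
  assumes "rigid A" "resolution d C A X c \<gamma>"
  shows "annihilated A X Y = (\<lambda>g. Comp C X (Sob C (c 0)) Y g (\<gamma> (Suc d))) ` Arr C (Sob C (c 0)) Y"
proof (intro subset_antisym subsetI)
  note res = resolutionD[OF assms(2)]
  have \<gamma>: "\<gamma> d \<in> Arr C (c d) X" "\<gamma> (Suc d) \<in> Arr C X (Sob C (c 0))"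
    using hexact_arr[OF res(1)] hexact_last[OF res(1)] res(2) by (metis le_SucI le_refl)+
  {
    fix f assume f: "f \<in> annihilated A X Y"
    hence "Comp C (c d) X Y f (\<gamma> d) = Zero C (c d) Y"
      using \<gamma>(1) res(3)[of d] by (simp add: annihilated_def)
    thus "f \<in> (\<lambda>g. Comp C X (Sob C (c 0)) Y g (\<gamma> (Suc d))) ` Arr C (Sob C (c 0)) Y"
      using hexact_contra[OF res(1), of d f Y] f hexact_last[OF res(1)] res(2)
      by (auto simp: annihilated_def)
  next
    fix f assume "f \<in> (\<lambda>g. Comp C X (Sob C (c 0)) Y g (\<gamma> (Suc d))) ` Arr C (Sob C (c 0)) Y"
    then obtain g where g: "g \<in> Arr C (Sob C (c 0)) Y" "f = Comp C X (Sob C (c 0)) Y g (\<gamma> (Suc d))"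
      by blast
    have "Comp C W X (Sob C (c 0)) (\<gamma> (Suc d)) p = Zero C W (Sob C (c 0))"
      if "W \<in> A" "p \<in> Arr C W X" for W p
      using rigid_zero[OF assms(1) that(1) res(3)[of 0]] that \<gamma>(2) by simp
    thus "f \<in> annihilated A X Y"
      using g \<gamma>(2) by (auto simp: annihilated_def Comp_assoc)
  }
qed

text \<open>The factorization comes from the last morphism of a resolution of \<open>X\<close>,
  whose target is in the shift of \<open>A\<close>; the converse is rigidity.\<close>

lemma annihilated_eq_factoring:
  assumes "tilting A"
  shows "annihilated A X Y = factoring_through C (Sob C ` A) X Y"
proof (intro subset_antisym subsetI)
  fix f assume f: "f \<in> annihilated A X Y"
  obtain c \<gamma> where c: "resolution d C A X c \<gamma>" using tilting_resolution[OF assms] .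
  note res = resolutionD[OF c]
  have "\<gamma> (Suc d) \<in> Arr C X (Sob C (c 0))"
    using hexact_arr[OF res(1), of "Suc d"] hexact_last[OF res(1)] res(2) by simp
  thus "f \<in> factoring_through C (Sob C ` A) X Y"
    using f res(3)[of 0] unfolding annihilated_resolution[OF tilting_rigid[OF assms] c] factoring_through_def
    by blast
next
  fix f assume "f \<in> factoring_through C (Sob C ` A) X Y"
  then obtain V p q where f: "V \<in> A" "p \<in> Arr C X (Sob C V)" "q \<in> Arr C (Sob C V) Y"
      "f = Comp C X (Sob C V) Y q p"
    unfolding factoring_through_def by blast
  have "Comp C W X (Sob C V) p r = Zero C W (Sob C V)" if "W \<in> A" "r \<in> Arr C W X" for W r
    using rigid_zero[OF tilting_rigid[OF assms] that(1) f(1)] that f(2) by simp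
  thus "f \<in> annihilated A X Y" using f by (auto simp: annihilated_def Comp_assoc)
qed

end

section \<open>The Euler form of a cluster tilting subcategory and its additivity\<close>

context hom_finite_angulated_category
begin

abbreviation ann_dim :: "'o set \<Rightarrow> 'o \<Rightarrow> 'o \<Rightarrow> nat" where
  "ann_dim A X Y \<equiv> sdim K (Hom C X Y) (annihilated A X Y)"

definition euler_form :: "'o set \<Rightarrow> 'o \<Rightarrow> 'o \<Rightarrow> int" where
  "euler_form A X Y = int (hom_dim K C X Y) - int (ann_dim A X Y) + (- 1) ^ d * int (ann_dim A X (Sob C Y))"

text \<open>The image of precomposition with the last morphism is \<open>annihilated\<close>, so
  both boundary ranks depend on \<open>X\<close> only and not on the resolution. The factor (-1)^d
  arises because a resolution numbers its terms from the right.\<close>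

lemma euler_form_resolution:
  assumes "rigid A" "resolution d C A X c \<gamma>"
  shows "(\<Sum>i\<le>d. (- 1) ^ i * int (hom_dim K C (c (d - i)) Y)) = euler_form A X Y"
proof -
  note res = resolutionD[OF assms(2)]
  have "pre_rank X (Sob C (c 0)) (\<gamma> (Suc d)) Z = ann_dim A X Z" for Z
    by (simp add: pre_rank_def annihilated_resolution[OF assms])
  hence "(\<Sum>k\<le>d. (- 1) ^ k * int (hom_dim K C (c k) Y)) =
      (- 1) ^ d * (int (hom_dim K C X Y) - int (ann_dim A X Y)) + int (ann_dim A X (Sob C Y))"
    using hexact_alternating_sum[OF res(1), of Y] res(2) by (simp add: algebra_simps)
  thus ?thesis
    by (cases "even d")
      (simp_all add: alternating_sum_rev[where a = "\<lambda>k. int (hom_dim K C (c k) Y)"] euler_form_def)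
qed

text \<open>
  The alternating sum of \<open>annihilated\<close> along an angle is a boundary term because maps from the
  angle into a shifted resolution of \<open>Y\<close> extend, the obstruction being pushed along the
  resolution until it vanishes.
\<close>

lemma extend_into_resolution:
  assumes c: "hexact c \<gamma>" and r: "hexact r \<rho>" "\<And>k. k \<le> d \<Longrightarrow> r k \<in> Sob C ` A" and A: "rigid A"
    and last: "\<gamma> (Suc d) \<in> factoring_through C (Sob C ` A) (c (Suc d)) (Sob C (c 0))"
    and "k \<le> i" "i \<le> d" "a \<in> Arr C (c k) (r i)"
    and "\<And>j. k = Suc j \<Longrightarrow> Comp C (c j) (c k) (r (Suc i)) (Comp C (c k) (r i) (r (Suc i)) (\<rho> i) a) (\<gamma> j) =
      Zero C (c j) (r (Suc i))"
  shows "\<exists>b \<in> Arr C (c (Suc k)) (r i).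
    Comp C (c k) (r i) (r (Suc i)) (\<rho> i) (Comp C (c k) (c (Suc k)) (r i) b (\<gamma> k)) =
    Comp C (c k) (r i) (r (Suc i)) (\<rho> i) a"
  using assms(6-)
proof (induction k arbitrary: i a)
  \<comment> \<open>The last morphism of \<open>c\<close> passes through Sigma^d W with W in
    \<open>A\<close>. Followed by the shift of \<open>a\<close> it contains the shift of a morphism
    from W to \<open>r i\<close>, which is zero by rigidity because \<open>r i\<close> lies in
    Sigma^d A. Hence \<open>a\<close> extends along \<open>\<gamma> 0\<close>.\<close>
  case 0
  note arr = hexact_arr[OF c]
  obtain W p q where W: "W \<in> A" "p \<in> Arr C (c (Suc d)) (Sob C W)" "q \<in> Arr C (Sob C W) (Sob C (c 0))"
      "\<gamma> (Suc d) = Comp C (c (Suc d)) (Sob C W) (Sob C (c 0)) q p"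
    using last unfolding factoring_through_def by blast
  obtain V where V: "V \<in> A" "r i = Sob C V" using r(2)[OF 0(2)] by blast
  obtain q' where q': "q' \<in> Arr C W (c 0)" "q = Sarr C W (c 0) q'" using Sarr_surj[OF W(3)] .
  have "Comp C W (c 0) (r i) a q' = Zero C W (r i)"
    using rigid_zero[OF A W(1) V(1)] Comp_closed[OF q'(1) 0(3)] V(2) by simp
  hence "Comp C (Sob C W) (Sob C (c 0)) (Sob C (r i)) (Sarr C (c 0) (r i) a) q = Zero C (Sob C W) (Sob C (r i))"
    using q' 0(3) by (simp add: Sarr_comp[symmetric])
  hence "Comp C (c (Suc d)) (Sob C (c 0)) (Sob C (r i)) (Sarr C (c 0) (r i) a) (\<gamma> (Suc d)) =
      Zero C (c (Suc d)) (Sob C (r i))"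
    using W 0(3) by (simp add: Comp_assoc[symmetric])
  then obtain b where "b \<in> Arr C (c 1) (r i)" "a = Comp C (c 0) (c 1) (r i) b (\<gamma> 0)"
    using hexact_contra_0[OF c 0(3)] by blast
  thus ?case by auto
next
  case (Suc k)
  note carr = hexact_arr[OF c] and rarr = hexact_arr[OF r(1)]
  obtain i' where i: "i = Suc i'" "i' \<le> d" using Suc.prems(1,2) by (cases i) auto
  have \<gamma>: "\<gamma> k \<in> Arr C (c k) (c (Suc k))" "\<gamma> (Suc k) \<in> Arr C (c (Suc k)) (c (Suc (Suc k)))"
    using carr Suc.prems(1,2) by simp_all
  have \<rho>: "\<rho> i \<in> Arr C (r i) (r (Suc i))" "\<rho> i' \<in> Arr C (r i') (r i)"
    using rarr i Suc.prems(2) by simp_all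
  have a: "a \<in> Arr C (c (Suc k)) (r i)" by fact
  have "Comp C (c k) (r i) (r (Suc i)) (\<rho> i) (Comp C (c k) (c (Suc k)) (r i) a (\<gamma> k)) = Zero C (c k) (r (Suc i))"
    using Suc.prems(4)[of k] \<gamma>(1) \<rho>(1) a by (simp add: Comp_assoc)
  \<comment> \<open>The restriction of \<open>a\<close> along \<open>\<gamma> k\<close> obstructs
    the extension. It is killed by \<open>\<rho> i\<close> and so lifts one step back in the
    resolution, where the induction hypothesis applies with both \<open>k\<close> and
    \<open>i\<close> lowered by one.\<close>
  then obtain a1 where a1: "a1 \<in> Arr C (c k) (r i')"
      "Comp C (c k) (c (Suc k)) (r i) a (\<gamma> k) = Comp C (c k) (r i') (r i) (\<rho> i') a1"
    using hexact_co[OF r(1) i(2), of "Comp C (c k) (c (Suc k)) (r i) a (\<gamma> k)" "c k"] i(1)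
      Comp_closed[OF \<gamma>(1) a] by auto
  have "Comp C (c j) (c k) (r i) (Comp C (c k) (r i') (r i) (\<rho> i') a1) (\<gamma> j) = Zero C (c j) (r i)"
    if "k = Suc j" for j
  proof -
    have "\<gamma> j \<in> Arr C (c j) (c k)" using carr[of j] that Suc.prems(1,2) by simp
    moreover have "Comp C (c j) (c k) (c (Suc k)) (\<gamma> k) (\<gamma> j) = Zero C (c j) (c (Suc k))"
      using hexact_comp[OF c, of j] that Suc.prems(1,2) by simp
    ultimately show ?thesis
      using a1(2)[symmetric] \<gamma>(1) a by (simp add: Comp_assoc)
  qed
  then obtain b1 where b1: "b1 \<in> Arr C (c (Suc k)) (r i')"
      "Comp C (c k) (r i') (r i) (\<rho> i') (Comp C (c k) (c (Suc k)) (r i') b1 (\<gamma> k)) =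
       Comp C (c k) (r i') (r i) (\<rho> i') a1"
    using Suc.IH[of i' a1] a1(1) i Suc.prems(1) by auto
  \<comment> \<open>Subtracting \<open>?e\<close> removes the obstruction. Composition with
    \<open>\<rho> i\<close> does not see the correction, which is why the extension is asserted only
    up to this composition.\<close>
  let ?e = "Comp C (c (Suc k)) (r i') (r i) (\<rho> i') b1"
  have e: "?e \<in> Arr C (c (Suc k)) (r i)" using Comp_closed[OF b1(1) \<rho>(2)] .
  have "Comp C (c k) (c (Suc k)) (r i) ?e (\<gamma> k) = Comp C (c k) (c (Suc k)) (r i) a (\<gamma> k)"
    using b1 a1(2) \<rho>(2) \<gamma>(1) by (simp add: Comp_assoc)
  hence "Comp C (c k) (c (Suc k)) (r i) (a \<ominus>\<^bsub>Hom C (c (Suc k)) (r i)\<^esub> ?e) (\<gamma> k) = Zero C (c k) (r i)"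
    using a e \<gamma>(1) by (simp add: Comp_linear Hom.M.r_neg a_minus_def)
  moreover have "k \<le> d" using Suc.prems(1,2) by simp
  ultimately obtain b where b: "b \<in> Arr C (c (Suc (Suc k))) (r i)"
      "a \<ominus>\<^bsub>Hom C (c (Suc k)) (r i)\<^esub> ?e = Comp C (c (Suc k)) (c (Suc (Suc k))) (r i) b (\<gamma> (Suc k))"
    using hexact_contra[OF c, of k "a \<ominus>\<^bsub>Hom C (c (Suc k)) (r i)\<^esub> ?e" "r i"] a e by auto
  have "Comp C (r i') (r i) (r (Suc i)) (\<rho> i) (\<rho> i') = Zero C (r i') (r (Suc i))"
    using hexact_comp[OF r(1) i(2)] i(1) by simp
  hence "Comp C (c (Suc k)) (r i) (r (Suc i)) (\<rho> i) ?e = Zero C (c (Suc k)) (r (Suc i))"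
    using \<rho> b1(1) by (simp add: Comp_assoc[symmetric])
  hence "Comp C (c (Suc k)) (r i) (r (Suc i)) (\<rho> i) (a \<ominus>\<^bsub>Hom C (c (Suc k)) (r i)\<^esub> ?e) =
      Comp C (c (Suc k)) (r i) (r (Suc i)) (\<rho> i) a"
    using \<rho>(1) a e Comp_closed[OF a \<rho>(1)] by (simp add: Comp_linear a_minus_def)
  thus ?case using b by auto
qed

text \<open>Every object is a shift, so the termwise shift of a resolution of its preimage ends in
  \<open>Y\<close> and has its other terms in Sigma^d A.\<close>

lemma resolution_shifted:
  assumes "tilting A"
  obtains r \<rho> where "hexact r \<rho>" "r (Suc d) = Y" "\<And>k. k \<le> d \<Longrightarrow> r k \<in> Sob C ` A"
proof -
  obtain Y' where Y: "Y = Sob C Y'" using Sob_surj .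
  obtain c \<gamma> where c: "resolution d C A Y' c \<gamma>" using tilting_resolution[OF assms] .
  note res = resolutionD[OF c]
  show ?thesis using that[OF hexact_shift[OF res(1)]] res(2,3) Y by blast
qed

text \<open>A morphism in I factors through some Sigma^d W, and from there it lifts to the term
  \<open>r d\<close> of a shifted resolution of \<open>Y\<close>. It is extended along the angle as
  a morphism to \<open>r d\<close>; the result stays in I because \<open>r d\<close> belongs to
  Sigma^d A.\<close>

lemma annihilated_exact:
  assumes c: "hexact c \<gamma>" and A: "tilting A"
    and last: "\<gamma> (Suc d) \<in> factoring_through C (Sob C ` A) (c (Suc d)) (Sob C (c 0))"
    and "k \<le> d" "f \<in> annihilated A (c k) Y"
    and z: "\<And>j. k = Suc j \<Longrightarrow> Comp C (c j) (c k) Y f (\<gamma> j) = Zero C (c j) Y"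
  shows "\<exists>g \<in> annihilated A (c (Suc k)) Y. f = Comp C (c k) (c (Suc k)) Y g (\<gamma> k)"
proof -
  obtain r \<rho> where r: "hexact r \<rho>" "r (Suc d) = Y" "\<And>k. k \<le> d \<Longrightarrow> r k \<in> Sob C ` A"
    using resolution_shifted[OF A, of Y] by blast
  have \<rho>: "\<rho> d \<in> Arr C (r d) Y" "\<rho> (Suc d) \<in> Arr C Y (Sob C (r 0))"
    using hexact_arr[OF r(1), of d] hexact_arr[OF r(1), of "Suc d"] hexact_last[OF r(1)] r(2) by simp_all
  obtain W p q where W: "W \<in> A" "p \<in> Arr C (c k) (Sob C W)" "q \<in> Arr C (Sob C W) Y"
      "f = Comp C (c k) (Sob C W) Y q p"
    using assms(5) unfolding annihilated_eq_factoring[OF A] factoring_through_def by blast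
  obtain W0 where W0: "W0 \<in> A" "r 0 = Sob C W0" using r(3)[of 0] by blast
  \<comment> \<open>Both ends are shifts and the target is a double shift of an object of
    \<open>A\<close>, so unshifting gives a morphism that vanishes by rigidity. Exactness then lifts
    \<open>q\<close> to \<open>r d\<close>.\<close>
  have "Comp C (Sob C W) Y (Sob C (r 0)) (\<rho> (Suc d)) q = Zero C (Sob C W) (Sob C (r 0))"
  proof -
    have "Comp C (Sob C W) Y (Sob C (r 0)) (\<rho> (Suc d)) q \<in> Arr C (Sob C W) (Sob C (Sob C W0))"
      using Comp_closed[OF W(3) \<rho>(2)] W0(2) by simp
    then obtain s where s: "s \<in> Arr C W (Sob C W0)"
        "Comp C (Sob C W) Y (Sob C (r 0)) (\<rho> (Suc d)) q = Sarr C W (Sob C W0) s"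
      using Sarr_surj by blast
    show ?thesis using rigid_zero[OF tilting_rigid[OF A] W(1) W0(1) s(1)] s(2) W0(2) by simp
  qed
  then obtain b where b: "b \<in> Arr C (Sob C W) (r d)" "q = Comp C (Sob C W) (r d) Y (\<rho> d) b"
    using hexact_co[OF r(1), of d q "Sob C W"] W(3) hexact_last[OF r(1)] r(2) by auto
  let ?a = "Comp C (c k) (Sob C W) (r d) b p"
  have a: "?a \<in> Arr C (c k) (r d)" using Comp_closed[OF W(2) b(1)] .
  have f: "f = Comp C (c k) (r d) (r (Suc d)) (\<rho> d) ?a"
    using W(2,4) b \<rho>(1) r(2) by (simp add: Comp_assoc)
  obtain e where e: "e \<in> Arr C (c (Suc k)) (r d)"
      "Comp C (c k) (r d) (r (Suc d)) (\<rho> d) (Comp C (c k) (c (Suc k)) (r d) e (\<gamma> k)) = f"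
    using extend_into_resolution[OF c r(1,3) tilting_rigid[OF A] last assms(4) order_refl a]
      z f r(2) by auto
  have \<gamma>: "\<gamma> k \<in> Arr C (c k) (c (Suc k))" using hexact_arr[OF c] assms(4) by simp
  have "Comp C (c (Suc k)) (r d) Y (\<rho> d) e \<in> annihilated A (c (Suc k)) Y"
    using r(3)[of d] e(1) \<rho>(1) unfolding annihilated_eq_factoring[OF A] factoring_through_def by blast
  moreover have "f = Comp C (c k) (c (Suc k)) Y (Comp C (c (Suc k)) (r d) Y (\<rho> d) e) (\<gamma> k)"
    using e \<gamma> \<rho>(1) r(2) by (simp add: Comp_assoc)
  ultimately show ?thesis by blast
qed

text \<open>In degree 0 every element of I extends, so no rank enters from the left. At the right
  end the kernel within I is the whole image of Hom(Sigma^d c 0, Y), because the last morphism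
  itself lies in I; so its full rank appears.\<close>

lemma annihilated_alternating_sum:
  assumes c: "hexact c \<gamma>" and A: "tilting A"
    and last: "\<gamma> (Suc d) \<in> factoring_through C (Sob C ` A) (c (Suc d)) (Sob C (c 0))"
  shows "(\<Sum>k\<le>Suc d. (- 1) ^ k * int (ann_dim A (c k) Y)) =
    (- 1) ^ Suc d * int (pre_rank (c (Suc d)) (Sob C (c 0)) (\<gamma> (Suc d)) Y)"
proof -
  define R where "R k = (\<lambda>g. Comp C (c k) (c (Suc k)) Y g (\<gamma> k)) ` annihilated A (c (Suc k)) Y" for k
  define r where "r k = (if k \<le> d then sdim K (Hom C (c k) Y) (R k)
    else pre_rank (c (Suc d)) (Sob C (c 0)) (\<gamma> (Suc d)) Y)" for k
  note arr = hexact_arr[OF c]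
  have rn: "sdim K (Hom C (c k) Y) (R k) +
      sdim K (Hom C (c (Suc k)) Y) {g \<in> annihilated A (c (Suc k)) Y. Comp C (c k) (c (Suc k)) Y g (\<gamma> k) = Zero C (c k) Y} =
      ann_dim A (c (Suc k)) Y" if "k \<le> d" for k
    unfolding R_def using arr[of k] that by (intro rank_nullity_pre annihilated_subspace) simp
  have Rsub: "R k \<subseteq> {g \<in> annihilated A (c k) Y. \<forall>j. k = Suc j \<longrightarrow> Comp C (c j) (c k) Y g (\<gamma> j) = Zero C (c j) Y}"
    if "k \<le> d" for k
  proof
    fix f assume "f \<in> R k"
    then obtain g where g: "g \<in> annihilated A (c (Suc k)) Y" "f = Comp C (c k) (c (Suc k)) Y g (\<gamma> k)"
      unfolding R_def by blast
    have \<gamma>: "\<gamma> k \<in> Arr C (c k) (c (Suc k))" using arr that by simp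
    have g': "g \<in> Arr C (c (Suc k)) Y" using g(1) by (simp add: annihilated_def)
    have "Comp C (c j) (c k) Y f (\<gamma> j) = Zero C (c j) Y" if j: "k = Suc j" for j
      using hexact_comp[OF c, of j] arr[of j] j \<open>k \<le> d\<close> \<gamma> g' g(2) by (simp add: Comp_assoc)
    thus "f \<in> {g \<in> annihilated A (c k) Y. \<forall>j. k = Suc j \<longrightarrow> Comp C (c j) (c k) Y g (\<gamma> j) = Zero C (c j) Y}"
      using annihilated_comp_right[OF g(1) \<gamma>] g(2) by simp
  qed
  have R: "R k = {g \<in> annihilated A (c k) Y. \<forall>j. k = Suc j \<longrightarrow> Comp C (c j) (c k) Y g (\<gamma> j) = Zero C (c j) Y}"
    if "k \<le> d" for k
  proof (intro subset_antisym Rsub that subsetI)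
    fix f assume f: "f \<in> {g \<in> annihilated A (c k) Y. \<forall>j. k = Suc j \<longrightarrow> Comp C (c j) (c k) Y g (\<gamma> j) = Zero C (c j) Y}"
    hence "\<exists>g \<in> annihilated A (c (Suc k)) Y. f = Comp C (c k) (c (Suc k)) Y g (\<gamma> k)"
      by (intro annihilated_exact[OF c A last that]) auto
    thus "f \<in> R k" unfolding R_def by blast
  qed
  have K: "sdim K (Hom C (c (Suc k)) Y) {g \<in> annihilated A (c (Suc k)) Y. Comp C (c k) (c (Suc k)) Y g (\<gamma> k) = Zero C (c k) Y} =
      r (Suc k)" if k: "k \<le> d" for k
  proof (cases "k = d")
    case False
    thus ?thesis using R[of "Suc k"] k by (simp add: r_def)
  next
    case True
    have \<gamma>: "\<gamma> d \<in> Arr C (c d) (c (Suc d))" "\<gamma> (Suc d) \<in> Arr C (c (Suc d)) (Sob C (c 0))"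
      using arr[of d] arr[of "Suc d"] hexact_last[OF c] by simp_all
    have "{g \<in> annihilated A (c (Suc d)) Y. Comp C (c d) (c (Suc d)) Y g (\<gamma> d) = Zero C (c d) Y} =
        (\<lambda>g. Comp C (c (Suc d)) (Sob C (c 0)) Y g (\<gamma> (Suc d))) ` Arr C (Sob C (c 0)) Y"
    proof (intro subset_antisym subsetI)
      fix g assume "g \<in> {g \<in> annihilated A (c (Suc d)) Y. Comp C (c d) (c (Suc d)) Y g (\<gamma> d) = Zero C (c d) Y}"
      thus "g \<in> (\<lambda>g. Comp C (c (Suc d)) (Sob C (c 0)) Y g (\<gamma> (Suc d))) ` Arr C (Sob C (c 0)) Y"
        using hexact_contra[OF c, of d g Y] hexact_last[OF c] by (auto simp: annihilated_def)
    next
      fix g assume "g \<in> (\<lambda>g. Comp C (c (Suc d)) (Sob C (c 0)) Y g (\<gamma> (Suc d))) ` Arr C (Sob C (c 0)) Y"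
      then obtain h where h: "h \<in> Arr C (Sob C (c 0)) Y" "g = Comp C (c (Suc d)) (Sob C (c 0)) Y h (\<gamma> (Suc d))"
        by blast
      have "\<gamma> (Suc d) \<in> annihilated A (c (Suc d)) (Sob C (c 0))"
        using last unfolding annihilated_eq_factoring[OF A] .
      hence "g \<in> annihilated A (c (Suc d)) Y" using annihilated_comp_left h by simp
      moreover have "Comp C (c d) (c (Suc d)) Y g (\<gamma> d) = Zero C (c d) Y"
        using hexact_comp[OF c, of d] hexact_last[OF c] h \<gamma> by (simp add: Comp_assoc)
      ultimately show "g \<in> {g \<in> annihilated A (c (Suc d)) Y. Comp C (c d) (c (Suc d)) Y g (\<gamma> d) = Zero C (c d) Y}"
        by simp
    qed
    thus ?thesis using True by (simp add: r_def pre_rank_def)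
  qed
  have "int (ann_dim A (c 0) Y) = 0 + int (r 0)" using R[of 0] by (simp add: r_def)
  moreover have "int (ann_dim A (c (Suc k)) Y) = int (r k) + int (r (Suc k))" if "k \<le> d" for k
    using rn[OF that] K[OF that] that by (simp add: r_def)
  ultimately have "(\<Sum>k\<le>Suc d. (- 1) ^ k * int (ann_dim A (c k) Y)) = 0 + (- 1) ^ Suc d * int (r (Suc d))"
    by (rule alternating_sum_telescope)
  thus ?thesis by (simp add: r_def)
qed

text \<open>Over the full angle the boundary rank at \<open>Y\<close> occurs in the sums for Hom and
  for I and cancels in their difference. The rank at \<open>Sob C Y\<close> from Hom cancels against
  the third term, since (-1)^d (-1)^(d+1) = -1; this fixes the sign in the form.\<close>

lemma euler_form_additive:
  assumes c: "hexact c \<gamma>" and A: "tilting A"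
    and last: "\<gamma> (Suc d) \<in> factoring_through C (Sob C ` A) (c (Suc d)) (Sob C (c 0))"
  shows "(\<Sum>i\<le>d. (- 1) ^ i * euler_form A (c (d - i)) Y) = euler_form A (c (Suc d)) Y"
proof -
  let ?P = "\<lambda>Y. int (pre_rank (c (Suc d)) (Sob C (c 0)) (\<gamma> (Suc d)) Y)"
  have "(\<Sum>k\<le>Suc d. (- 1) ^ k * euler_form A (c k) Y) =
     (\<Sum>k\<le>Suc d. (- 1) ^ k * int (hom_dim K C (c k) Y)) - (\<Sum>k\<le>Suc d. (- 1) ^ k * int (ann_dim A (c k) Y)) +
     (- 1) ^ d * (\<Sum>k\<le>Suc d. (- 1) ^ k * int (ann_dim A (c k) (Sob C Y)))"
    unfolding euler_form_def
    by (simp add: algebra_simps sum.distrib sum_subtractf sum_distrib_left sum_distrib_right del: sum.atMost_Suc)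
  also have "\<dots> = 0"
    unfolding hexact_alternating_sum[OF c] annihilated_alternating_sum[OF assms]
    by (simp add: algebra_simps power_add[symmetric] mult_2[symmetric])
  finally have "(- 1) ^ d * (\<Sum>k\<le>d. (- 1) ^ k * euler_form A (c k) Y) = euler_form A (c (Suc d)) Y"
    by (cases "even d") simp_all
  thus ?thesis by (simp add: alternating_sum_rev[where a = "\<lambda>k. euler_form A (c k) Y"])
qed

end

section \<open>Direct sums and indecomposable objects\<close>

context linear_category
begin

lemma isomorphic_refl: "isomorphic C X X"
  unfolding isomorphic_def inverse_arrows_def using Ident_closed Ident_left[OF Ident_closed] by blast

lemma isomorphic_sym: "isomorphic C X Y \<Longrightarrow> isomorphic C Y X"
  unfolding isomorphic_def inverse_arrows_def by blast

lemma Comp_Ident_mid: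
  assumes "f \<in> Arr C X Y" "g \<in> Arr C Y X" "Comp C X Y X g f = Ident C X" "h \<in> Arr C X Z" "k \<in> Arr C W X"
  shows "Comp C W Y Z (Comp C Y X Z h g) (Comp C W X Y f k) = Comp C W X Z h k"
proof -
  have "Comp C W Y Z (Comp C Y X Z h g) (Comp C W X Y f k) = Comp C W X Z h (Comp C W Y X g (Comp C W X Y f k))"
    using assms by (simp add: Comp_assoc)
  also have "Comp C W Y X g (Comp C W X Y f k) = k"
    using assms by (simp add: Comp_assoc[symmetric] Ident_left)
  finally show ?thesis .
qed

lemma isomorphic_trans:
  assumes "isomorphic C X Y" "isomorphic C Y Z"
  shows "isomorphic C X Z"
proof -
  obtain f g where fg: "inverse_arrows C X Y f g" using assms(1) by (auto simp: isomorphic_def)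
  obtain h k where hk: "inverse_arrows C Y Z h k" using assms(2) by (auto simp: isomorphic_def)
  have "inverse_arrows C X Z (Comp C X Y Z h f) (Comp C Z Y X g k)"
    unfolding inverse_arrows_def
    using fg hk Comp_Ident_mid[of h Y Z k g X f X] Comp_Ident_mid[of g Y X f h Z k Z]
    by (auto simp: inverse_arrows_def)
  thus ?thesis by (auto simp: isomorphic_def)
qed

lemma is_sum_comm:
  assumes "is_sum C P X Y"
  shows "is_sum C P Y X"
proof -
  obtain i1 i2 p1 p2 where "biproduct C P X Y i1 i2 p1 p2" using assms by (auto simp: is_sum_def)
  hence "biproduct C P Y X i2 i1 p2 p1" unfolding biproduct_def by (simp add: Hom.M.a_comm Comp_closed)
  thus ?thesis unfolding is_sum_def by blast
qed

text \<open>Isomorphic objects differ by a zero summand. Invariance under isomorphism thereby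
  becomes an instance of additivity, for dimensions and for classes in the Grothendieck group
  alike.\<close>

lemma is_sum_zero:
  assumes "isomorphic C X X'" "zero_object C Z"
  shows "is_sum C X X' Z"
proof -
  obtain f g where fg: "inverse_arrows C X X' f g" using assms(1) by (auto simp: isomorphic_def)
  have "biproduct C X X' Z g (Zero C Z X) f (Zero C X Z)"
    using fg assms(2) unfolding biproduct_def inverse_arrows_def
    by (auto simp: zero_object_def Ident_closed)
  thus ?thesis unfolding is_sum_def by blast
qed

lemma isomorphic_of_is_sum_zero:
  assumes "is_sum C X X' Z" "zero_object C Z"
  shows "isomorphic C X X'"
proof -
  obtain i1 i2 p1 p2 where b: "biproduct C X X' Z i1 i2 p1 p2" using assms(1) by (auto simp: is_sum_def)
  have "i2 = Zero C Z X" "p2 = Zero C X Z"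
    using b zero_object_arr_from[OF assms(2)] zero_object_arr_to[OF assms(2)] by (auto simp: biproduct_def)
  hence "inverse_arrows C X X' p1 i1"
    using b unfolding biproduct_def inverse_arrows_def by auto
  thus ?thesis unfolding isomorphic_def by blast
qed

lemma isomorphic_zero_object:
  assumes "isomorphic C X Y" "zero_object C X"
  shows "zero_object C Y"
proof -
  obtain f g where fg: "f \<in> Arr C X Y" "g \<in> Arr C Y X" "Comp C Y X Y f g = Ident C Y"
    using assms(1) by (auto simp: isomorphic_def inverse_arrows_def)
  have "f = Zero C X Y" using zero_object_arr_from[OF assms(2) fg(1)] .
  thus ?thesis using fg by (simp add: zero_object_def)
qed

lemma is_sum_assoc:
  assumes "is_sum C Q P Z" "is_sum C P X Y" "is_sum C R Y Z"
  shows "is_sum C Q X R"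
proof -
  obtain i1 i2 p1 p2 where Q: "biproduct C Q P Z i1 i2 p1 p2" using assms(1) by (auto simp: is_sum_def)
  obtain j1 j2 q1 q2 where P: "biproduct C P X Y j1 j2 q1 q2" using assms(2) by (auto simp: is_sum_def)
  obtain k1 k2 r1 r2 where R: "biproduct C R Y Z k1 k2 r1 r2" using assms(3) by (auto simp: is_sum_def)
  note q = Q[unfolded biproduct_def] and p = P[unfolded biproduct_def] and r = R[unfolded biproduct_def]
  have [simp, intro]: "i1 \<in> Arr C P Q" "i2 \<in> Arr C Z Q" "p1 \<in> Arr C Q P" "p2 \<in> Arr C Q Z"
      "j1 \<in> Arr C X P" "j2 \<in> Arr C Y P" "q1 \<in> Arr C P X" "q2 \<in> Arr C P Y"
      "k1 \<in> Arr C Y R" "k2 \<in> Arr C Z R" "r1 \<in> Arr C R Y" "r2 \<in> Arr C R Z"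
    using q p r by simp_all
  have Qe: "Comp C P Q P p1 i1 = Ident C P" "Comp C Z Q Z p2 i2 = Ident C Z"
      "Comp C Z Q P p1 i2 = Zero C Z P" "Comp C P Q Z p2 i1 = Zero C P Z"
    and Pe: "Comp C X P X q1 j1 = Ident C X" "Comp C Y P Y q2 j2 = Ident C Y"
      "Comp C Y P X q1 j2 = Zero C Y X" "Comp C X P Y q2 j1 = Zero C X Y"
    and Re: "Comp C Y R Y r1 k1 = Ident C Y" "Comp C Z R Z r2 k2 = Ident C Z"
      "Comp C Z R Y r1 k2 = Zero C Z Y" "Comp C Y R Z r2 k1 = Zero C Y Z"
    using q p r by simp_all
  have pi: "Comp C W Q P p1 (Comp C W P Q i1 f) = f" "Comp C W Q Z p2 (Comp C W P Q i1 f) = Zero C W Z"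
    if "f \<in> Arr C W P" for W f
    using that Qe Comp_assoc[of f W P i1 Q p1 P] Comp_assoc[of f W P i1 Q p2 Z] by (simp_all add: Ident_left)
  have pi': "Comp C W Q P p1 (Comp C W Z Q i2 f) = Zero C W P" "Comp C W Q Z p2 (Comp C W Z Q i2 f) = f"
    if "f \<in> Arr C W Z" for W f
    using that Qe Comp_assoc[of f W Z i2 Q p1 P] Comp_assoc[of f W Z i2 Q p2 Z] by (simp_all add: Ident_left)
  have qj: "Comp C W P X q1 (Comp C W X P j1 f) = f" "Comp C W P Y q2 (Comp C W X P j1 f) = Zero C W Y"
    if "f \<in> Arr C W X" for W f
    using that Pe Comp_assoc[of f W X j1 P q1 X] Comp_assoc[of f W X j1 P q2 Y] by (simp_all add: Ident_left)
  have qj': "Comp C W P X q1 (Comp C W Y P j2 f) = Zero C W X" "Comp C W P Y q2 (Comp C W Y P j2 f) = f"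
    if "f \<in> Arr C W Y" for W f
    using that Pe Comp_assoc[of f W Y j2 P q1 X] Comp_assoc[of f W Y j2 P q2 Y] by (simp_all add: Ident_left)
  have rk: "Comp C W R Y r1 (Comp C W Y R k1 f) = f" "Comp C W R Z r2 (Comp C W Y R k1 f) = Zero C W Z"
    if "f \<in> Arr C W Y" for W f
    using that Re Comp_assoc[of f W Y k1 R r1 Y] Comp_assoc[of f W Y k1 R r2 Z] by (simp_all add: Ident_left)
  have rk': "Comp C W R Y r1 (Comp C W Z R k2 f) = Zero C W Y" "Comp C W R Z r2 (Comp C W Z R k2 f) = f"
    if "f \<in> Arr C W Z" for W f
    using that Re Comp_assoc[of f W Z k2 R r1 Y] Comp_assoc[of f W Z k2 R r2 Z] by (simp_all add: Ident_left)
  define I1 where "I1 = Comp C X P Q i1 j1"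
  define P1 where "P1 = Comp C Q P X q1 p1"
  \<comment> \<open>\<open>R\<close> is an arbitrary sum of \<open>Y\<close> and \<open>Z\<close>,
    so its morphisms to and from \<open>Q\<close> are assembled componentwise, the component at
    \<open>Y\<close> passing through \<open>P\<close>.\<close>
  define I2 where "I2 = Comp C R P Q i1 (Comp C R Y P j2 r1) \<oplus>\<^bsub>Hom C R Q\<^esub> Comp C R Z Q i2 r2"
  define P2 where "P2 = Comp C Q Y R k1 (Comp C Q P Y q2 p1) \<oplus>\<^bsub>Hom C Q R\<^esub> Comp C Q Z R k2 p2"
  have IP: "I1 \<in> Arr C X Q" "P1 \<in> Arr C Q X" "I2 \<in> Arr C R Q" "P2 \<in> Arr C Q R"
    unfolding I1_def P1_def I2_def P2_def by (intro Hom.M.a_closed Comp_closed; simp)+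
  have id: "f = Comp C W P Q i1 (Comp C W Q P p1 f) \<oplus>\<^bsub>Hom C W Q\<^esub> Comp C W Z Q i2 (Comp C W Q Z p2 f)"
    if "f \<in> Arr C W Q" for W f
  proof -
    have "f = Comp C W Q Q (Ident C Q) f" using that by (simp add: Ident_left)
    also have "Ident C Q = Comp C Q P Q i1 p1 \<oplus>\<^bsub>Hom C Q Q\<^esub> Comp C Q Z Q i2 p2" using q by simp
    finally show ?thesis using that by (simp add: Comp_linear Comp_assoc)
  qed
  have idP: "f = Comp C W X P j1 (Comp C W P X q1 f) \<oplus>\<^bsub>Hom C W P\<^esub> Comp C W Y P j2 (Comp C W P Y q2 f)"
    if "f \<in> Arr C W P" for W f
  proof -
    have "f = Comp C W P P (Ident C P) f" using that by (simp add: Ident_left)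
    also have "Ident C P = Comp C P X P j1 q1 \<oplus>\<^bsub>Hom C P P\<^esub> Comp C P Y P j2 q2" using p by simp
    finally show ?thesis using that by (simp add: Comp_linear Comp_assoc)
  qed
  have "biproduct C Q X R I1 I2 P1 P2"
    unfolding biproduct_def
  proof (intro conjI IP)
    show "Comp C X Q X P1 I1 = Ident C X"
      unfolding P1_def I1_def using Pe by (simp add: Comp_assoc pi)
    show "Comp C R Q X P1 I2 = Zero C R X"
      unfolding P1_def I2_def by (simp add: Comp_assoc Comp_linear pi pi' qj')
    show "Comp C X Q R P2 I1 = Zero C X R"
      unfolding P2_def I1_def using Pe by (simp add: Comp_assoc Comp_linear pi pi')
    show "Comp C R Q R P2 I2 = Ident C R"
      unfolding P2_def I2_def using r by (simp add: Comp_assoc Comp_linear pi pi' qj')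
    have "Comp C Q R Q I2 P2 = Comp C Q P Q i1 (Comp C Q Y P j2 (Comp C Q P Y q2 p1)) \<oplus>\<^bsub>Hom C Q Q\<^esub> Comp C Q Z Q i2 p2"
      unfolding P2_def I2_def by (simp add: Comp_assoc Comp_linear rk rk')
    moreover have "Comp C Q X Q I1 P1 = Comp C Q P Q i1 (Comp C Q X P j1 (Comp C Q P X q1 p1))"
      unfolding P1_def I1_def by (simp add: Comp_assoc)
    ultimately have "Comp C Q X Q I1 P1 \<oplus>\<^bsub>Hom C Q Q\<^esub> Comp C Q R Q I2 P2 =
        Comp C Q P Q i1 (Comp C Q X P j1 (Comp C Q P X q1 p1) \<oplus>\<^bsub>Hom C Q P\<^esub> Comp C Q Y P j2 (Comp C Q P Y q2 p1))
        \<oplus>\<^bsub>Hom C Q Q\<^esub> Comp C Q Z Q i2 p2"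
      by (simp add: Comp_linear Hom.M.a_assoc)
    also have "\<dots> = Comp C Q P Q i1 p1 \<oplus>\<^bsub>Hom C Q Q\<^esub> Comp C Q Z Q i2 p2"
      using idP[of p1 Q] by simp
    also have "\<dots> = Ident C Q" using q by simp
    finally show "Comp C Q X Q I1 P1 \<oplus>\<^bsub>Hom C Q Q\<^esub> Comp C Q R Q I2 P2 = Ident C Q" .
  qed
  thus ?thesis unfolding is_sum_def by blast
qed

lemma Comp_finsum_right:
  assumes "finite J" "g \<in> Arr C Y Z" "\<And>j. j \<in> J \<Longrightarrow> f j \<in> Arr C X Y"
  shows "Comp C X Y Z g (\<Oplus>\<^bsub>Hom C X Y\<^esub>j\<in>J. f j) = (\<Oplus>\<^bsub>Hom C X Z\<^esub>j\<in>J. Comp C X Y Z g (f j))"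
  using assms
proof (induction J rule: finite_induct)
  case (insert x J)
  have f: "f \<in> J \<rightarrow> Arr C X Y" "f x \<in> Arr C X Y" using insert.prems by auto
  hence "(\<lambda>j. Comp C X Y Z g (f j)) \<in> J \<rightarrow> Arr C X Z" using insert.prems by auto
  thus ?case using insert f by (simp add: Hom.M.finsum_insert Comp_linear Hom.M.finsum_closed)
qed simp

lemma Comp_finsum_left:
  assumes "finite J" "f \<in> Arr C X Y" "\<And>j. j \<in> J \<Longrightarrow> g j \<in> Arr C Y Z"
  shows "Comp C X Y Z (\<Oplus>\<^bsub>Hom C Y Z\<^esub>j\<in>J. g j) f = (\<Oplus>\<^bsub>Hom C X Z\<^esub>j\<in>J. Comp C X Y Z (g j) f)"
  using assms
proof (induction J rule: finite_induct)
  case (insert x J)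
  have f: "g \<in> J \<rightarrow> Arr C Y Z" "g x \<in> Arr C Y Z" using insert.prems by auto
  hence "(\<lambda>j. Comp C X Y Z (g j) f) \<in> J \<rightarrow> Arr C X Z" using insert.prems by auto
  thus ?case using insert f by (simp add: Hom.M.finsum_insert Comp_linear Hom.M.finsum_closed)
qed simp


lemma is_list_sum_Nil: "is_list_sum C P [] \<longleftrightarrow> zero_object C P"
  by (auto simp: is_list_sum_def zero_object_def)

text \<open>
  Lists grow at the end here, so that the index set of \<^const>\<open>is_list_sum\<close> grows at its maximum.
\<close>

lemma is_list_sum_snoc:
  assumes "is_sum C P V R" "is_list_sum C R Xs"
  shows "is_list_sum C P (Xs @ [V])"
proof -
  obtain i1 i2 p1 p2 where b: "biproduct C P V R i1 i2 p1 p2" using assms(1) by (auto simp: is_sum_def)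
  let ?n = "length Xs"
  obtain \<iota> \<pi> where
    arr: "\<And>i. i < ?n \<Longrightarrow> \<iota> i \<in> Arr C (Xs ! i) R" "\<And>i. i < ?n \<Longrightarrow> \<pi> i \<in> Arr C R (Xs ! i)" and
    orth: "\<And>i j. i < ?n \<Longrightarrow> j < ?n \<Longrightarrow> Comp C (Xs ! j) R (Xs ! i) (\<pi> i) (\<iota> j) =
        (if i = j then Ident C (Xs ! i) else Zero C (Xs ! j) (Xs ! i))" and
    total: "(\<Oplus>\<^bsub>Hom C R R\<^esub> i \<in> {..<?n}. Comp C R (Xs ! i) R (\<iota> i) (\<pi> i)) = Ident C R"
    using assms(2) unfolding is_list_sum_def by blast
  have [simp]: "i1 \<in> Arr C V P" "i2 \<in> Arr C R P" "p1 \<in> Arr C P V" "p2 \<in> Arr C P R"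
    and be: "Comp C V P V p1 i1 = Ident C V" "Comp C R P R p2 i2 = Ident C R"
      "Comp C R P V p1 i2 = Zero C R V" "Comp C V P R p2 i1 = Zero C V R"
      "Comp C P V P i1 p1 \<oplus>\<^bsub>Hom C P P\<^esub> Comp C P R P i2 p2 = Ident C P"
    using b by (simp_all add: biproduct_def)
  define I where "I j = (if j < ?n then Comp C (Xs ! j) R P i2 (\<iota> j) else i1)" for j
  define Q where "Q j = (if j < ?n then Comp C P R (Xs ! j) (\<pi> j) p2 else p1)" for j
  have pi: "Comp C W P V p1 (Comp C W R P i2 f) = Zero C W V" "Comp C W P R p2 (Comp C W R P i2 f) = f"
    if "f \<in> Arr C W R" for W f
    using that be Comp_assoc[of f W R i2 P p1 V] Comp_assoc[of f W R i2 P p2 R] by (simp_all add: Ident_left)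
  have nth: "(Xs @ [V]) ! j = (if j < ?n then Xs ! j else V)" if "j < Suc ?n" for j
    using that by (simp add: nth_append)
  show ?thesis
    unfolding is_list_sum_def
  proof (rule exI[of _ I], rule exI[of _ Q], intro conjI allI impI)
    fix i assume "i < length (Xs @ [V])"
    thus "I i \<in> Arr C ((Xs @ [V]) ! i) P" "Q i \<in> Arr C P ((Xs @ [V]) ! i)"
      using arr by (auto simp: I_def Q_def nth intro!: Comp_closed)
  next
    fix i j assume "i < length (Xs @ [V])" "j < length (Xs @ [V])"
    thus "Comp C ((Xs @ [V]) ! j) P ((Xs @ [V]) ! i) (Q i) (I j) =
        (if i = j then Ident C ((Xs @ [V]) ! i) else Zero C ((Xs @ [V]) ! j) ((Xs @ [V]) ! i))"
      using arr orth[of i j] be by (auto simp: I_def Q_def nth Comp_assoc pi less_Suc_eq)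
  next
    have fin: "(\<lambda>j. Comp C R (Xs ! j) R (\<iota> j) (\<pi> j)) \<in> {..<?n} \<rightarrow> Arr C R R"
      using arr by auto
    have "(\<Oplus>\<^bsub>Hom C P P\<^esub> j \<in> {..<?n}. Comp C P ((Xs @ [V]) ! j) P (I j) (Q j)) =
        (\<Oplus>\<^bsub>Hom C P P\<^esub> j \<in> {..<?n}. Comp C P R P (Comp C R R P i2 (Comp C R (Xs ! j) R (\<iota> j) (\<pi> j))) p2)"
      using arr by (intro Hom.M.finsum_cong') (auto simp: I_def Q_def nth Comp_assoc)
    also have "\<dots> = Comp C P R P (Comp C R R P i2 (\<Oplus>\<^bsub>Hom C R R\<^esub> j \<in> {..<?n}. Comp C R (Xs ! j) R (\<iota> j) (\<pi> j))) p2"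
      using arr by (subst Comp_finsum_right, auto simp: fin intro!: Comp_finsum_left[symmetric])
    also have "\<dots> = Comp C P R P i2 p2" by (simp add: total Ident_right)
    finally have s: "(\<Oplus>\<^bsub>Hom C P P\<^esub> j \<in> {..<?n}. Comp C P ((Xs @ [V]) ! j) P (I j) (Q j)) = Comp C P R P i2 p2" .
    have "(\<lambda>j. Comp C P ((Xs @ [V]) ! j) P (I j) (Q j)) \<in> {..<?n} \<rightarrow> Arr C P P"
      using arr by (auto simp: I_def Q_def nth intro!: Comp_closed)
    hence "(\<Oplus>\<^bsub>Hom C P P\<^esub> j \<in> {..<Suc ?n}. Comp C P ((Xs @ [V]) ! j) P (I j) (Q j)) =
        Comp C P V P i1 p1 \<oplus>\<^bsub>Hom C P P\<^esub> Comp C P R P i2 p2"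
      using s by (simp add: lessThan_Suc Hom.M.finsum_insert I_def Q_def)
    thus "(\<Oplus>\<^bsub>Hom C P P\<^esub> j \<in> {..<length (Xs @ [V])}. Comp C P ((Xs @ [V]) ! j) P (I j) (Q j)) = Ident C P"
      using be by simp
  qed
qed

text \<open>\<open>R\<close> is any sum of \<open>Xs\<close>, not one constructed from
  \<open>P\<close>; the comparison morphisms \<open>i2\<close> and \<open>p2\<close> match its
  components with those of \<open>P\<close>.\<close>

lemma is_list_sum_snocD:
  assumes "is_list_sum C P (Xs @ [V])" "is_list_sum C R Xs"
  shows "is_sum C P V R"
proof -
  let ?n = "length Xs"
  obtain \<iota> \<pi> where
    arr: "\<And>i. i < ?n \<Longrightarrow> \<iota> i \<in> Arr C (Xs ! i) R" "\<And>i. i < ?n \<Longrightarrow> \<pi> i \<in> Arr C R (Xs ! i)" and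
    orth: "\<And>i j. i < ?n \<Longrightarrow> j < ?n \<Longrightarrow> Comp C (Xs ! j) R (Xs ! i) (\<pi> i) (\<iota> j) =
        (if i = j then Ident C (Xs ! i) else Zero C (Xs ! j) (Xs ! i))" and
    total: "(\<Oplus>\<^bsub>Hom C R R\<^esub> i \<in> {..<?n}. Comp C R (Xs ! i) R (\<iota> i) (\<pi> i)) = Ident C R"
    using assms(2) unfolding is_list_sum_def by blast
  let ?Y = "\<lambda>i. (Xs @ [V]) ! i"
  obtain I Q where
    Arr: "\<And>i. i < Suc ?n \<Longrightarrow> I i \<in> Arr C (?Y i) P" "\<And>i. i < Suc ?n \<Longrightarrow> Q i \<in> Arr C P (?Y i)" and
    Orth: "\<And>i j. i < Suc ?n \<Longrightarrow> j < Suc ?n \<Longrightarrow> Comp C (?Y j) P (?Y i) (Q i) (I j) =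
        (if i = j then Ident C (?Y i) else Zero C (?Y j) (?Y i))" and
    Total: "(\<Oplus>\<^bsub>Hom C P P\<^esub> i \<in> {..<Suc ?n}. Comp C P (?Y i) P (I i) (Q i)) = Ident C P"
    using assms(1) unfolding is_list_sum_def length_append_singleton by blast
  have nth: "?Y j = Xs ! j" if "j < ?n" for j using that by (simp add: nth_append)
  have nthn: "?Y ?n = V" by simp
  have I: "I i \<in> Arr C (Xs ! i) P" and Q: "Q i \<in> Arr C P (Xs ! i)" if "i < ?n" for i
    using Arr[of i] nth[of i] that by simp_all
  have IQ: "Comp C (Xs ! j) P (Xs ! i) (Q i) (I j) = (if i = j then Ident C (Xs ! i) else Zero C (Xs ! j) (Xs ! i))"
    if "i < ?n" "j < ?n" for i j
    using Orth[of i j] nth that by simp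
  have In: "I ?n \<in> Arr C V P" "Q ?n \<in> Arr C P V" "Comp C V P V (Q ?n) (I ?n) = Ident C V"
    using Arr[of ?n] Orth[of ?n ?n] by simp_all
  have IQn: "Comp C (Xs ! j) P V (Q ?n) (I j) = Zero C (Xs ! j) V"
    "Comp C V P (Xs ! j) (Q j) (I ?n) = Zero C V (Xs ! j)" if "j < ?n" for j
    using Orth[of ?n j] Orth[of j ?n] nth[of j] that by simp_all
  define i2 where "i2 = (\<Oplus>\<^bsub>Hom C R P\<^esub> j \<in> {..<?n}. Comp C R (Xs ! j) P (I j) (\<pi> j))"
  define p2 where "p2 = (\<Oplus>\<^bsub>Hom C P R\<^esub> j \<in> {..<?n}. Comp C P (Xs ! j) R (\<iota> j) (Q j))"
  have ti: "Comp C R (Xs ! j) P (I j) (\<pi> j) \<in> Arr C R P" "Comp C P (Xs ! j) R (\<iota> j) (Q j) \<in> Arr C P R"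
    "Comp C R (Xs ! j) R (\<iota> j) (\<pi> j) \<in> Arr C R R" "Comp C P (Xs ! j) P (I j) (Q j) \<in> Arr C P P" if "j < ?n" for j
    using arr I Q that by (auto intro!: Comp_closed)
  have i2: "i2 \<in> Arr C R P" and p2: "p2 \<in> Arr C P R"
    unfolding i2_def p2_def using ti by (auto intro!: Hom.M.finsum_closed)
  have Qi2: "Comp C R P (Xs ! i) (Q i) i2 = \<pi> i" if i: "i < ?n" for i
  proof -
    have "Comp C R P (Xs ! i) (Q i) i2 =
        (\<Oplus>\<^bsub>Hom C R (Xs ! i)\<^esub> j \<in> {..<?n}. Comp C R P (Xs ! i) (Q i) (Comp C R (Xs ! j) P (I j) (\<pi> j)))"
      unfolding i2_def using Q[OF i] ti by (intro Comp_finsum_right) auto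
    also have "\<dots> = (\<Oplus>\<^bsub>Hom C R (Xs ! i)\<^esub> j \<in> {..<?n}. if i = j then \<pi> j else Zero C R (Xs ! i))"
      using Q[OF i] I arr(2) IQ[OF i]
      by (intro Hom.M.finsum_cong') (auto simp: Comp_assoc[symmetric] Ident_left)
    also have "\<dots> = \<pi> i"
    proof -
      have "(\<Oplus>\<^bsub>Hom C R (Xs ! i)\<^esub> j \<in> {..<?n}. if i = j then (\<lambda>_. \<pi> i) j else Zero C R (Xs ! i)) = \<pi> i"
        using i arr(2)[OF i] by (intro Hom.M.finsum_singleton) auto
      moreover have "(\<lambda>j. if i = j then \<pi> j else Zero C R (Xs ! i)) = (\<lambda>j. if i = j then \<pi> i else Zero C R (Xs ! i))"
        by auto
      ultimately show ?thesis by simp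
    qed
    finally show ?thesis .
  qed
  have "biproduct C P V R (I ?n) i2 (Q ?n) p2"
    unfolding biproduct_def
  proof (intro conjI In i2 p2)
    show "Comp C R P V (Q ?n) i2 = Zero C R V"
    proof -
      have "Comp C R P V (Q ?n) i2 =
          (\<Oplus>\<^bsub>Hom C R V\<^esub> j \<in> {..<?n}. Comp C R P V (Q ?n) (Comp C R (Xs ! j) P (I j) (\<pi> j)))"
        unfolding i2_def using In ti by (intro Comp_finsum_right) auto
      also have "\<dots> = (\<Oplus>\<^bsub>Hom C R V\<^esub> j \<in> {..<?n}. Zero C R V)"
        using In I arr(2) IQn by (intro Hom.M.finsum_cong') (auto simp: Comp_assoc[symmetric])
      finally show ?thesis by simp
    qed
    show "Comp C V P R p2 (I ?n) = Zero C V R"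
    proof -
      have "Comp C V P R p2 (I ?n) =
          (\<Oplus>\<^bsub>Hom C V R\<^esub> j \<in> {..<?n}. Comp C V P R (Comp C P (Xs ! j) R (\<iota> j) (Q j)) (I ?n))"
        unfolding p2_def using In ti by (intro Comp_finsum_left) auto
      also have "\<dots> = (\<Oplus>\<^bsub>Hom C V R\<^esub> j \<in> {..<?n}. Zero C V R)"
        using In Q arr(1) IQn by (intro Hom.M.finsum_cong') (auto simp: Comp_assoc)
      finally show ?thesis by simp
    qed
    show "Comp C R P R p2 i2 = Ident C R"
    proof -
      have "Comp C R P R p2 i2 =
          (\<Oplus>\<^bsub>Hom C R R\<^esub> j \<in> {..<?n}. Comp C R P R (Comp C P (Xs ! j) R (\<iota> j) (Q j)) i2)"
        unfolding p2_def using i2 ti by (intro Comp_finsum_left) auto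
      also have "\<dots> = (\<Oplus>\<^bsub>Hom C R R\<^esub> j \<in> {..<?n}. Comp C R (Xs ! j) R (\<iota> j) (\<pi> j))"
        using Q arr i2 Qi2 ti by (intro Hom.M.finsum_cong') (auto simp: Comp_assoc)
      finally show ?thesis by (simp add: total)
    qed
    show "Comp C P V P (I ?n) (Q ?n) \<oplus>\<^bsub>Hom C P P\<^esub> Comp C P R P i2 p2 = Ident C P"
    proof -
      have \<pi>p2: "Comp C P R (Xs ! i) (\<pi> i) p2 = Q i" if i: "i < ?n" for i
      proof -
        have "Comp C P R (Xs ! i) (\<pi> i) p2 =
            (\<Oplus>\<^bsub>Hom C P (Xs ! i)\<^esub> j \<in> {..<?n}. Comp C P R (Xs ! i) (\<pi> i) (Comp C P (Xs ! j) R (\<iota> j) (Q j)))"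
          unfolding p2_def using arr(2)[OF i] ti by (intro Comp_finsum_right) auto
        also have "\<dots> = (\<Oplus>\<^bsub>Hom C P (Xs ! i)\<^esub> j \<in> {..<?n}. if i = j then Q i else Zero C P (Xs ! i))"
          using arr Q orth[OF i]
          by (intro Hom.M.finsum_cong') (auto simp: Comp_assoc[symmetric] Ident_left i)
        also have "\<dots> = Q i"
          using i Q[OF i] Hom.M.finsum_singleton[of i "{..<?n}" "\<lambda>_. Q i"] by auto
        finally show ?thesis .
      qed
      have "Comp C P R P i2 p2 =
          (\<Oplus>\<^bsub>Hom C P P\<^esub> j \<in> {..<?n}. Comp C P R P (Comp C R (Xs ! j) P (I j) (\<pi> j)) p2)"
        unfolding i2_def using p2 ti by (intro Comp_finsum_left) auto
      also have "\<dots> = (\<Oplus>\<^bsub>Hom C P P\<^esub> j \<in> {..<?n}. Comp C P (Xs ! j) P (I j) (Q j))"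
        using I arr p2 \<pi>p2 ti by (intro Hom.M.finsum_cong') (auto simp: Comp_assoc)
      also have "\<dots> = (\<Oplus>\<^bsub>Hom C P P\<^esub> j \<in> {..<?n}. Comp C P (?Y j) P (I j) (Q j))"
        using ti nth by (intro Hom.M.finsum_cong') auto
      finally have s: "Comp C P R P i2 p2 = (\<Oplus>\<^bsub>Hom C P P\<^esub> j \<in> {..<?n}. Comp C P (?Y j) P (I j) (Q j))" .
      have "(\<lambda>j. Comp C P (?Y j) P (I j) (Q j)) \<in> {..<?n} \<rightarrow> Arr C P P" using ti nth by auto
      hence "(\<Oplus>\<^bsub>Hom C P P\<^esub> j \<in> {..<Suc ?n}. Comp C P (?Y j) P (I j) (Q j)) =
          Comp C P V P (I ?n) (Q ?n) \<oplus>\<^bsub>Hom C P P\<^esub> Comp C P R P i2 p2"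
        unfolding s lessThan_Suc using Comp_closed[OF In(2,1)] by (subst Hom.M.finsum_insert) auto
      thus ?thesis using Total by simp
    qed
  qed
  thus ?thesis unfolding is_sum_def by blast
qed

end

section \<open>Local objects, retracts and decompositions\<close>

context linear_category
begin

text \<open>A recursive form of \<^const>\<open>is_list_sum\<close>, better suited to induction.\<close>

inductive list_sum :: "'o \<Rightarrow> 'o list \<Rightarrow> bool" where
  list_sum_Nil: "zero_object C P \<Longrightarrow> list_sum P []"
| list_sum_Cons: "is_sum C P X R \<Longrightarrow> list_sum R Xs \<Longrightarrow> list_sum P (X # Xs)"

text \<open>Retracts suffice for the exchange argument with local objects, which needs no
  complement; \<open>retract_summand\<close> produces a complement afterwards.\<close>

definition retract :: "'o \<Rightarrow> 'o \<Rightarrow> bool" where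
  "retract X P \<longleftrightarrow> (\<exists>i p. i \<in> Arr C X P \<and> p \<in> Arr C P X \<and> Comp C X P X p i = Ident C X)"

definition auto_arrow :: "'o \<Rightarrow> 'm \<Rightarrow> bool" where
  "auto_arrow X a \<longleftrightarrow> (\<exists>b. inverse_arrows C X X a b)"

text \<open>Locality of the endomorphism ring, tested on pairs with sum the identity: this is how it
  acts on a decomposed identity morphism.\<close>

definition local_object :: "'o \<Rightarrow> bool" where
  "local_object X \<longleftrightarrow> \<not> zero_object C X \<and>
     (\<forall>a\<in>Arr C X X. \<forall>b\<in>Arr C X X. a \<oplus>\<^bsub>Hom C X X\<^esub> b = Ident C X \<longrightarrow> auto_arrow X a \<or> auto_arrow X b)"

lemma Units_end_ring: "a \<in> Units (end_ring C X) \<longleftrightarrow> auto_arrow X a"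
  by (auto simp: Units_def end_ring_def auto_arrow_def inverse_arrows_def)

lemma auto_arrow_Ident: "auto_arrow X (Ident C X)"
  unfolding auto_arrow_def inverse_arrows_def using Ident_closed[of X] Ident_left by blast

lemma local_object_of_is_local:
  assumes "is_local (end_ring C X)"
  shows "local_object X"
  unfolding local_object_def
proof (intro conjI ballI impI)
  show "\<not> zero_object C X"
    using assms by (simp add: is_local_def end_ring_def zero_object_def)
  fix a b assume ab: "a \<in> Arr C X X" "b \<in> Arr C X X" "a \<oplus>\<^bsub>Hom C X X\<^esub> b = Ident C X"
  have "a \<oplus>\<^bsub>end_ring C X\<^esub> b \<in> Units (end_ring C X)"
    using ab(3) auto_arrow_Ident[of X] by (simp add: Units_end_ring) (simp add: end_ring_def)
  hence "a \<in> Units (end_ring C X) \<or> b \<in> Units (end_ring C X)"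
    using assms ab(1,2) unfolding is_local_def by (auto simp: end_ring_def)
  thus "auto_arrow X a \<or> auto_arrow X b" by (simp add: Units_end_ring)
qed

text \<open>Conjugation with the isomorphism preserves decompositions of the identity, and an
  endomorphism is invertible as soon as its conjugate is.\<close>

lemma local_object_isomorphic:
  assumes "isomorphic C X Y" "local_object Y"
  shows "local_object X"
  unfolding local_object_def
proof (intro conjI ballI impI)
  show "\<not> zero_object C X"
    using assms isomorphic_zero_object[OF assms(1)] by (auto simp: local_object_def)
  obtain f g where fg: "f \<in> Arr C X Y" "g \<in> Arr C Y X" "Comp C X Y X g f = Ident C X" "Comp C Y X Y f g = Ident C Y"
    using assms(1) by (auto simp: isomorphic_def inverse_arrows_def)
  let ?T = "\<lambda>a. Comp C Y X Y f (Comp C Y X X a g)"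
  have T: "?T a \<in> Arr C Y Y" if "a \<in> Arr C X X" for a using that fg by simp
  have unit_back: "auto_arrow X a" if a: "a \<in> Arr C X X" and u: "auto_arrow Y (?T a)" for a
  proof -
    obtain v where v: "v \<in> Arr C Y Y" "Comp C Y Y Y v (?T a) = Ident C Y" "Comp C Y Y Y (?T a) v = Ident C Y"
      using u by (auto simp: auto_arrow_def inverse_arrows_def)
    let ?b = "Comp C X Y X g (Comp C X Y Y v f)"
    have b: "?b \<in> Arr C X X" using v(1) fg by simp
    have "Comp C X X X ?b a = Comp C X X X (Comp C X X X ?b a) (Comp C X Y X g f)"
      using a b fg by (simp add: Ident_right)
    also have "\<dots> = Comp C X Y X g (Comp C X Y Y (Comp C Y Y Y v (?T a)) f)"
      using a v(1) fg(1,2) by (simp add: Comp_assoc)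
    also have "\<dots> = Ident C X" using v fg by (simp add: Ident_left)
    finally have 1: "Comp C X X X ?b a = Ident C X" .
    have "Comp C X X X a ?b = Comp C X X X (Comp C X Y X g f) (Comp C X X X a ?b)"
      using a b fg by (simp add: Ident_left)
    also have "\<dots> = Comp C X Y X g (Comp C X Y Y (Comp C Y Y Y (?T a) v) f)"
      using a v(1) fg(1,2) by (simp add: Comp_assoc)
    also have "\<dots> = Ident C X" using v fg by (simp add: Ident_left)
    finally have 2: "Comp C X X X a ?b = Ident C X" .
    from 1 2 show ?thesis using a b unfolding auto_arrow_def inverse_arrows_def by blast
  qed
  fix a b assume ab: "a \<in> Arr C X X" "b \<in> Arr C X X" "a \<oplus>\<^bsub>Hom C X X\<^esub> b = Ident C X"
  have "?T a \<oplus>\<^bsub>Hom C Y Y\<^esub> ?T b = ?T (a \<oplus>\<^bsub>Hom C X X\<^esub> b)"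
    using ab(1,2) fg by (simp add: Comp_linear)
  also have "\<dots> = Ident C Y" using ab fg by (simp add: Ident_left)
  finally have "auto_arrow Y (?T a) \<or> auto_arrow Y (?T b)"
    using assms(2) T ab unfolding local_object_def by blast
  thus "auto_arrow X a \<or> auto_arrow X b" using unit_back ab by blast
qed

lemma retract_of_is_sum: "is_sum C P X Y \<Longrightarrow> retract X P"
  unfolding is_sum_def biproduct_def retract_def by blast

text \<open>Inserting the decomposition of the identity of \<open>P\<close> writes the identity of
  \<open>X\<close> as a sum of two endomorphisms, one through \<open>Y\<close> and one through
  \<open>R\<close>. By locality one of them is invertible, and its inverse corrects the
  retraction.\<close>

lemma retract_is_sum:
  assumes "local_object X" "retract X P" "is_sum C P Y R"
  shows "retract X Y \<or> retract X R"
proof -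
  obtain i p where ip: "i \<in> Arr C X P" "p \<in> Arr C P X" "Comp C X P X p i = Ident C X"
    using assms(2) by (auto simp: retract_def)
  obtain i1 i2 p1 p2 where b: "biproduct C P Y R i1 i2 p1 p2" using assms(3) by (auto simp: is_sum_def)
  have b': "i1 \<in> Arr C Y P" "i2 \<in> Arr C R P" "p1 \<in> Arr C P Y" "p2 \<in> Arr C P R"
    "Comp C P Y P i1 p1 \<oplus>\<^bsub>Hom C P P\<^esub> Comp C P R P i2 p2 = Ident C P"
    using b by (simp_all add: biproduct_def)
  let ?a = "Comp C X Y X (Comp C Y P X p i1) (Comp C X P Y p1 i)"
  let ?b = "Comp C X R X (Comp C R P X p i2) (Comp C X P R p2 i)"
  have "?a \<oplus>\<^bsub>Hom C X X\<^esub> ?b = Comp C X P X p (Comp C X P P (Comp C P Y P i1 p1 \<oplus>\<^bsub>Hom C P P\<^esub> Comp C P R P i2 p2) i)"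
    using ip(1,2) b'(1-4) by (simp add: Comp_linear Comp_assoc)
  also have "\<dots> = Ident C X" using ip b'(5) by (simp add: Ident_left)
  finally have "auto_arrow X ?a \<or> auto_arrow X ?b"
    using assms(1) ip b' unfolding local_object_def by (meson Comp_closed)
  moreover have "retract X Z" if "f \<in> Arr C X Z" "g \<in> Arr C Z X" and u: "auto_arrow X (Comp C X Z X g f)" for Z f g
  proof -
    obtain v where "v \<in> Arr C X X" "Comp C X X X v (Comp C X Z X g f) = Ident C X"
      using u by (auto simp: auto_arrow_def inverse_arrows_def)
    hence "Comp C X Z X (Comp C Z X X v g) f = Ident C X" "Comp C Z X X v g \<in> Arr C Z X"
      using that(1,2) by (simp_all add: Comp_assoc)
    thus ?thesis using that(1) unfolding retract_def by blast
  qed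
  ultimately show ?thesis using ip b' by (meson Comp_closed)
qed

text \<open>The idempotent \<open>?e\<close> or its complement is invertible. In the first case
  \<open>?e\<close> is the identity, in the second it is zero and so is \<open>X\<close>.\<close>

lemma retract_local_isomorphic:
  assumes "local_object Y" "\<not> zero_object C X" "retract X Y"
  shows "isomorphic C X Y"
proof -
  obtain i p where ip: "i \<in> Arr C X Y" "p \<in> Arr C Y X" "Comp C X Y X p i = Ident C X"
    using assms(3) by (auto simp: retract_def)
  let ?e = "Comp C Y X Y i p"
  let ?f = "Ident C Y \<ominus>\<^bsub>Hom C Y Y\<^esub> ?e"
  have e: "?e \<in> Arr C Y Y" "?f \<in> Arr C Y Y" using ip by (simp_all add: Ident_closed)
  have ee: "Comp C Y Y Y ?e ?e = ?e"
    using ip Comp_Ident_mid[of i X Y p i Y p Y] by simp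
  have fe: "Comp C Y Y Y ?f ?e = Zero C Y Y" "Comp C Y Y Y ?e ?f = Zero C Y Y"
    using e ee Ident_closed[of Y] by (simp_all add: Comp_linear a_minus_def Ident_left Ident_right Hom.M.r_neg)
  have "?e \<oplus>\<^bsub>Hom C Y Y\<^esub> ?f = Ident C Y"
    using e(1) Ident_closed[of Y] Hom.M.r_neg2[of ?e Y Y "Ident C Y"]
    by (simp add: a_minus_def Hom.M.a_comm[of "Ident C Y"])
  hence "auto_arrow Y ?e \<or> auto_arrow Y ?f" using assms(1) e unfolding local_object_def by blast
  thus ?thesis
  proof
    assume "auto_arrow Y ?e"
    then obtain v where v: "v \<in> Arr C Y Y" "Comp C Y Y Y v ?e = Ident C Y"
      by (auto simp: auto_arrow_def inverse_arrows_def)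
    have "?f = Comp C Y Y Y (Comp C Y Y Y v ?e) ?f" using v e by (simp add: Ident_left)
    also have "\<dots> = Comp C Y Y Y v (Comp C Y Y Y ?e ?f)" by (rule Comp_assoc[OF e(2) e(1) v(1)])
    also have "\<dots> = Zero C Y Y" using fe v by simp
    finally have "?e = Ident C Y" using e(1) Ident_closed[of Y] by simp
    thus ?thesis using ip unfolding isomorphic_def inverse_arrows_def by blast
  next
    assume "auto_arrow Y ?f"
    then obtain v where v: "v \<in> Arr C Y Y" "Comp C Y Y Y v ?f = Ident C Y"
      by (auto simp: auto_arrow_def inverse_arrows_def)
    have "?e = Comp C Y Y Y (Comp C Y Y Y v ?f) ?e" using v e by (simp add: Ident_left)
    also have "\<dots> = Comp C Y Y Y v (Comp C Y Y Y ?f ?e)" by (rule Comp_assoc[OF e(1) e(2) v(1)])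
    also have "\<dots> = Zero C Y Y" using fe v by simp
    finally have e0: "?e = Zero C Y Y" .
    have "Ident C X = Comp C X Y X (Comp C Y X X (Ident C X) p) (Comp C X X Y i (Ident C X))"
      using ip by (simp add: Ident_left Ident_right)
    also have "\<dots> = Comp C X Y X p (Comp C X Y Y ?e i)"
      using ip by (simp add: Ident_left Ident_right Comp_assoc)
    also have "\<dots> = Zero C X X" using e0 ip by simp
    finally show ?thesis using assms(2) by (simp add: zero_object_def)
  qed
qed

text \<open>Were both summands non-zero, the idempotent of one of them or its complement would be
  invertible, and the inclusion of the other or of the same summand would vanish.\<close>

lemma local_object_indecomposable:
  assumes "local_object X"
  shows "indecomposable C X"
  unfolding indecomposable_def
proof (intro conjI allI impI)
  show nz: "\<not> zero_object C X" using assms by (simp add: local_object_def)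
  fix Y Z assume s: "is_sum C X Y Z"
  have "retract X Y \<or> retract X Z"
  proof (rule retract_is_sum[OF assms _ s])
    show "retract X X" unfolding retract_def using Ident_closed[of X] Ident_left by blast
  qed
  moreover obtain i1 i2 p1 p2 where b: "biproduct C X Y Z i1 i2 p1 p2" using s by (auto simp: is_sum_def)
  ultimately show "zero_object C Y \<or> zero_object C Z"
  proof (elim disjE)
    have eq: "zero_object C Z'" if "retract X Y'" "j1 \<in> Arr C Y' X" "q1 \<in> Arr C X Y'"
      "j2 \<in> Arr C Z' X" "q2 \<in> Arr C X Z'" "Comp C Y' X Y' q1 j1 = Ident C Y'" "Comp C Z' X Z' q2 j2 = Ident C Z'"
      "Comp C Z' X Y' q1 j2 = Zero C Z' Y'" for Y' Z' j1 q1 j2 q2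
    proof (rule ccontr)
      assume z: "\<not> zero_object C Z'"
      have "\<not> zero_object C Y'"
      proof
        assume "zero_object C Y'"
        moreover obtain i p where "i \<in> Arr C X Y'" "p \<in> Arr C Y' X" "Comp C X Y' X p i = Ident C X"
          using \<open>retract X Y'\<close> by (auto simp: retract_def)
        ultimately have "zero_object C X"
          using zero_object_arr_to[of Y' i X] by (simp add: zero_object_def)
        thus False using nz by simp
      qed
      have "retract Y' X" using that unfolding retract_def by blast
      hence "isomorphic C Y' X" using retract_local_isomorphic[OF assms] \<open>\<not> zero_object C Y'\<close> by simp
      have e: "Comp C X Y' X j1 q1 \<in> Arr C X X" "Comp C X Z' X j2 q2 \<in> Arr C X X" using that by simp_all
      let ?e = "Comp C X Y' X j1 q1" and ?f = "Ident C X \<ominus>\<^bsub>Hom C X X\<^esub> Comp C X Y' X j1 q1"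
      have f: "?f \<in> Arr C X X" using e Ident_closed[of X] by simp
      have "?e \<oplus>\<^bsub>Hom C X X\<^esub> ?f = Ident C X"
        using e(1) Ident_closed[of X] Hom.M.r_neg2[of ?e X X "Ident C X"]
        by (simp add: a_minus_def Hom.M.a_comm[of "Ident C X"])
      hence "auto_arrow X ?e \<or> auto_arrow X ?f" using assms e f unfolding local_object_def by blast
      thus False
      proof
        assume "auto_arrow X ?e"
        then obtain v where v: "v \<in> Arr C X X" "Comp C X X X v ?e = Ident C X"
          by (auto simp: auto_arrow_def inverse_arrows_def)
        have "j2 = Comp C Z' X X (Comp C X X X v ?e) j2" using v that by (simp add: Ident_left)
        also have "\<dots> = Zero C Z' X" using that v(1) by (simp add: Comp_assoc)
        finally show False using z that by (simp add: zero_object_def)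
      next
        assume "auto_arrow X ?f"
        then obtain v where v: "v \<in> Arr C X X" "Comp C X X X v ?f = Ident C X"
          by (auto simp: auto_arrow_def inverse_arrows_def)
        have "Comp C Y' X X ?e j1 = j1" using that by (simp add: Comp_assoc Ident_right)
        hence "Comp C Y' X X ?f j1 = Zero C Y' X"
          using that e Ident_closed[of X] by (simp add: Comp_linear a_minus_def Ident_left Hom.M.r_neg)
        moreover have "j1 = Comp C Y' X X (Comp C X X X v ?f) j1" using v that by (simp add: Ident_left)
        moreover have "Comp C Y' X X (Comp C X X X v ?f) j1 = Comp C Y' X X v (Comp C Y' X X ?f j1)"
          by (rule Comp_assoc[OF that(2) f v(1)])
        ultimately have "j1 = Zero C Y' X" using v(1) by simp
        thus False using \<open>\<not> zero_object C Y'\<close> that by (simp add: zero_object_def)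
      qed
    qed
    {
      assume "retract X Y"
      from eq[OF this, of i1 p1 i2 Z p2] b show "zero_object C Y \<or> zero_object C Z"
        by (simp add: biproduct_def)
    next
      assume "retract X Z"
      from eq[OF this, of i2 p2 i1 Y p1] b show "zero_object C Y \<or> zero_object C Z"
        by (simp add: biproduct_def)
    }
  qed
qed

end

context additive_category
begin

lemma exists_list_sum: "\<exists>P. is_list_sum C P Xs"
proof (induction Xs rule: rev_induct)
  case Nil
  thus ?case using zero_exists by (simp add: is_list_sum_Nil)
next
  case (snoc Y Xs)
  then obtain R where "is_list_sum C R Xs" by blast
  moreover obtain P where "is_sum C P Y R" using sum_exists by blast
  ultimately show ?case using is_list_sum_snoc by blast
qed

lemma list_sum_of_is_list_sum: "is_list_sum C P Xs \<Longrightarrow> list_sum P (rev Xs)"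
proof (induction Xs arbitrary: P rule: rev_induct)
  case Nil
  thus ?case by (simp add: is_list_sum_Nil list_sum_Nil)
next
  case (snoc Y Xs)
  obtain R where R: "is_list_sum C R Xs" using exists_list_sum by blast
  show ?case using list_sum_Cons[OF is_list_sum_snocD[OF snoc.prems R] snoc.IH[OF R]] by simp
qed

lemma list_sum_retract:
  assumes "list_sum P Xs" "local_object X" "retract X P"
  shows "\<exists>Y\<in>set Xs. retract X Y"
  using assms
proof (induction rule: list_sum.induct)
  case (list_sum_Nil P)
  then obtain i p where ip: "i \<in> Arr C X P" "p \<in> Arr C P X" "Comp C X P X p i = Ident C X"
    by (auto simp: retract_def)
  hence "zero_object C X" using zero_object_arr_to[OF list_sum_Nil(1), of i X] by (simp add: zero_object_def)
  thus ?case using list_sum_Nil by (simp add: local_object_def)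
next
  case (list_sum_Cons P Y R Xs)
  thus ?case using retract_is_sum[OF list_sum_Cons.prems(1,2) list_sum_Cons.hyps(1)] by auto
qed

lemma list_sum_summand:
  assumes "list_sum P Xs" "Y \<in> set Xs"
  shows "\<exists>R. is_sum C P Y R"
  using assms
proof (induction rule: list_sum.induct)
  case (list_sum_Cons P X R Xs)
  show ?case
  proof (cases "Y = X")
    case True
    thus ?thesis using list_sum_Cons by blast
  next
    case False
    then obtain R' where R': "is_sum C R Y R'" using list_sum_Cons by auto
    obtain W where "is_sum C W R' X" using sum_exists by blast
    thus ?thesis using is_sum_assoc[OF is_sum_comm[OF list_sum_Cons.hyps(1)] R'] by blast
  qed
qed simp

lemma is_sum_isomorphic:
  assumes "is_sum C P X R" "isomorphic C X X'"
  shows "\<exists>R'. is_sum C P X' R'"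
proof -
  obtain Z where Z: "zero_object C Z" using zero_exists by blast
  obtain W where "is_sum C W Z R" using sum_exists by blast
  thus ?thesis using is_sum_assoc[OF assms(1) is_sum_zero[OF assms(2) Z]] by blast
qed

end

locale krull_schmidt_category = additive_category K C
  for K :: "'k ring" and C :: "('k, 'o, 'm, 'z) lincat_scheme" +
  assumes krull_schmidt: "krull_schmidt C"
begin

lemma local_decomposition:
  obtains Xs where "list_sum P Xs" "\<And>X. X \<in> set Xs \<Longrightarrow> local_object X"
proof -
  obtain Xs where "is_list_sum C P Xs" "\<forall>Y \<in> set Xs. is_local (end_ring C Y)"
    using krull_schmidt unfolding krull_schmidt_def by blast
  thus ?thesis using that[of "rev Xs"] list_sum_of_is_list_sum local_object_of_is_local by auto
qed

text \<open>The first summand of a local decomposition is non-zero, so indecomposability forces the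
  sum of the remaining ones to be zero.\<close>

lemma indecomposable_local:
  assumes "indecomposable C X"
  shows "local_object X"
proof -
  obtain Xs where Xs: "list_sum X Xs" "\<And>Y. Y \<in> set Xs \<Longrightarrow> local_object Y"
    using local_decomposition by blast
  from Xs(1) show ?thesis
  proof cases
    case list_sum_Nil
    thus ?thesis using assms by (simp add: indecomposable_def)
  next
    case (list_sum_Cons Y R Ys)
    have Y: "local_object Y" using Xs(2) list_sum_Cons by simp
    hence "\<not> zero_object C Y" by (simp add: local_object_def)
    hence "zero_object C R" using assms list_sum_Cons by (auto simp: indecomposable_def)
    hence "isomorphic C X Y" using isomorphic_of_is_sum_zero list_sum_Cons by blast
    thus ?thesis using local_object_isomorphic Y by blast
  qed
qed

text \<open>A local retract of \<open>P\<close> is a retract of some local summand of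
  \<open>P\<close>, hence isomorphic to that summand.\<close>

lemma retract_summand:
  assumes "local_object X" "retract X P"
  shows "\<exists>R. is_sum C P X R"
proof -
  obtain Xs where Xs: "list_sum P Xs" "\<And>Y. Y \<in> set Xs \<Longrightarrow> local_object Y"
    using local_decomposition by blast
  obtain Y where Y: "Y \<in> set Xs" "retract X Y" using list_sum_retract[OF Xs(1) assms] by blast
  have "isomorphic C X Y"
    using retract_local_isomorphic Xs(2) Y assms(1) by (auto simp: local_object_def)
  thus ?thesis using list_sum_summand[OF Xs(1) Y(1)] is_sum_isomorphic isomorphic_sym by blast
qed

lemma add_of_summand:
  assumes "P \<in> add_of C T" "is_sum C P X Y"
  shows "X \<in> add_of C T"
proof -
  obtain n Q Z where Q: "is_list_sum C Q (replicate n T)" "is_sum C Q P Z"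
    using assms(1) unfolding add_of_def by blast
  obtain W where "is_sum C W Y Z" using sum_exists by blast
  thus ?thesis using is_sum_assoc[OF Q(2) assms(2)] Q(1) unfolding add_of_def by blast
qed

lemma add_of_self: "T \<in> add_of C T"
proof -
  obtain Z where Z: "zero_object C Z" using zero_exists by blast
  have s: "is_sum C T T Z" by (rule is_sum_zero[OF isomorphic_refl Z])
  have "is_list_sum C T (replicate 1 T)"
    using is_list_sum_snoc[OF s, of "[]"] Z by (simp add: is_list_sum_Nil)
  thus ?thesis using s unfolding add_of_def by blast
qed

lemma add_of_zero: "zero_object C Z \<Longrightarrow> Z \<in> add_of C T"
  using is_list_sum_Nil[of Z] is_sum_zero[OF isomorphic_refl, of Z Z] unfolding add_of_def
  by (metis (mono_tags, lifting) mem_Collect_eq replicate_0)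

text \<open>An indecomposable object of \<open>add_of C T\<close> is a local retract of a sum of
  copies of \<open>T\<close>, and thus of a single copy.\<close>

lemma indec_summand_iff_Indec: "indec_summand C X T \<longleftrightarrow> X \<in> Indec C (add_of C T)"
proof
  assume "indec_summand C X T"
  thus "X \<in> Indec C (add_of C T)"
    using add_of_summand[OF add_of_self] by (auto simp: indec_summand_def Indec_def)
next
  assume X: "X \<in> Indec C (add_of C T)"
  then obtain n P Y where P: "is_list_sum C P (replicate n T)" "is_sum C P X Y" "local_object X"
    using indecomposable_local by (auto simp: Indec_def add_of_def)
  have "list_sum P (replicate n T)" using list_sum_of_is_list_sum[OF P(1)] by simp
  from list_sum_retract[OF this P(3) retract_of_is_sum[OF P(2)]] have "retract X T" by auto
  thus "indec_summand C X T"
    using retract_summand[OF P(3)] X by (auto simp: indec_summand_def Indec_def)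
qed

end

section \<open>The split Grothendieck group\<close>

lemma diff_diff_regroup:
  fixes x y x' y' :: "'a::ab_group_add"
  shows "(x - y) - (x' - y') = (x - x') + - (y - y')"
  by (simp add: algebra_simps)

text \<open>The linear extension of \<open>f\<close> to formal integral combinations.\<close>

definition frag_eval :: "('a \<Rightarrow> int) \<Rightarrow> ('a \<Rightarrow>\<^sub>0 int) \<Rightarrow> int" where
  "frag_eval f g = (\<Sum>x\<in>Poly_Mapping.keys g. Poly_Mapping.lookup g x * f x)"

lemma frag_eval_superset:
  assumes "finite F" "Poly_Mapping.keys g \<subseteq> F"
  shows "frag_eval f g = (\<Sum>x\<in>F. Poly_Mapping.lookup g x * f x)"
  unfolding frag_eval_def by (rule sum.mono_neutral_left) (use assms in \<open>auto simp: in_keys_iff\<close>)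

lemma frag_eval_0 [simp]: "frag_eval f 0 = 0"
  by (simp add: frag_eval_def)

lemma frag_eval_of [simp]: "frag_eval f (frag_of x) = f x"
  by (simp add: frag_eval_def)

lemma frag_eval_add: "frag_eval f (g + h) = frag_eval f g + frag_eval f h"
proof -
  let ?F = "Poly_Mapping.keys g \<union> Poly_Mapping.keys h"
  have "Poly_Mapping.keys (g + h) \<subseteq> ?F" by (rule Poly_Mapping.keys_add)
  thus ?thesis
    by (simp add: frag_eval_superset[of ?F] lookup_add sum.distrib distrib_right)
qed

lemma frag_eval_minus: "frag_eval f (- g) = - frag_eval f g"
  by (simp add: frag_eval_def sum_negf)

lemma frag_eval_diff: "frag_eval f (g - h) = frag_eval f g - frag_eval f h"
  using frag_eval_add[of f g "- h"] by (simp add: frag_eval_minus)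

context linear_category
begin

definition sum_additive :: "'o set \<Rightarrow> ('o \<Rightarrow> int) \<Rightarrow> bool" where
  "sum_additive A f \<longleftrightarrow> (\<forall>t\<in>A. \<forall>t0\<in>A. \<forall>t1\<in>A. is_sum C t t0 t1 \<longrightarrow> f t = f t0 + f t1)"

lemma split_relations_subgroup: "subgroup (split_relations C A) (free_Abelian_group A)"
proof -
  have "Poly_Mapping.keys (frag_of t - (frag_of t0 + frag_of t1)) \<subseteq> A" if "t \<in> A" "t0 \<in> A" "t1 \<in> A" for t t0 t1
  proof -
    have "Poly_Mapping.keys (frag_of t0 + frag_of t1) \<subseteq> A"
      using Poly_Mapping.keys_add[of "frag_of t0" "frag_of t1"] that by auto
    thus ?thesis using keys_diff[of "frag_of t" "frag_of t0 + frag_of t1"] that by auto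
  qed
  hence "{frag_of t - (frag_of t0 + frag_of t1) | t t0 t1. t \<in> A \<and> t0 \<in> A \<and> t1 \<in> A \<and> is_sum C t t0 t1}
      \<subseteq> carrier (free_Abelian_group A)"
    by auto
  thus ?thesis unfolding split_relations_def by (rule group.generate_is_subgroup[OF group_free_Abelian_group])
qed

lemma split_relations_normal: "split_relations C A \<lhd> free_Abelian_group A"
  by (rule comm_group.subgroup_imp_normal[OF abelian_free_Abelian_group split_relations_subgroup])

lemma split_relations_keys:
  assumes "g \<in> split_relations C A"
  shows "Poly_Mapping.keys g \<subseteq> A"
  using subsetD[OF subgroup.subset[OF split_relations_subgroup] assms]
  unfolding carrier_free_Abelian_group_iff .

lemma split_relations_0: "0 \<in> split_relations C A"
  using subgroup.one_closed[OF split_relations_subgroup] by simp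

lemma split_relations_add: "g \<in> split_relations C A \<Longrightarrow> h \<in> split_relations C A \<Longrightarrow> g + h \<in> split_relations C A"
  using subgroup.m_closed[OF split_relations_subgroup, of g A h] by simp

lemma split_relations_minus: "g \<in> split_relations C A \<Longrightarrow> - g \<in> split_relations C A"
  using subgroup.m_inv_closed[OF split_relations_subgroup, of g A] split_relations_keys[of g A] by simp

lemma split_relations_sum:
  assumes "t \<in> A" "t0 \<in> A" "t1 \<in> A" "is_sum C t t0 t1"
  shows "frag_of t - (frag_of t0 + frag_of t1) \<in> split_relations C A"
  unfolding split_relations_def using assms by (intro generate.incl) blast

lemma split_relations_eval:
  assumes "sum_additive A f" "g \<in> split_relations C A"
  shows "frag_eval f g = 0"
  using assms(2) unfolding split_relations_def
proof (induction rule: generate.induct)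
  case (incl h)
  thus ?case using assms(1) by (auto simp: sum_additive_def frag_eval_diff frag_eval_add)
next
  case (inv h)
  have "h \<in> split_relations C A" using inv unfolding split_relations_def by (rule generate.incl)
  hence "inv\<^bsub>free_Abelian_group A\<^esub> h = - h" using split_relations_keys[of h A] by simp
  moreover have "frag_eval f h = 0"
    using inv assms(1) by (auto simp: sum_additive_def frag_eval_diff frag_eval_add)
  ultimately show ?case by (simp add: frag_eval_minus)
qed (simp_all add: frag_eval_add)

abbreviation K0_coset :: "'o set \<Rightarrow> ('o \<Rightarrow>\<^sub>0 int) \<Rightarrow> ('o \<Rightarrow>\<^sub>0 int) set" where
  "K0_coset A g \<equiv> split_relations C A #>\<^bsub>free_Abelian_group A\<^esub> g"

lemma K0_coset_def': "K0_coset A g = {n + g | n. n \<in> split_relations C A}"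
  by (auto simp: r_coset_def)

lemma K0_coset_eqI:
  assumes "g - h \<in> split_relations C A"
  shows "K0_coset A g = K0_coset A h"
  unfolding K0_coset_def'
proof (intro subset_antisym subsetI)
  fix x assume "x \<in> {n + g |n. n \<in> split_relations C A}"
  then obtain n where "n \<in> split_relations C A" "x = (n + (g - h)) + h" by auto
  thus "x \<in> {n + h |n. n \<in> split_relations C A}" using split_relations_add[OF _ assms] by blast
next
  fix x assume "x \<in> {n + h |n. n \<in> split_relations C A}"
  then obtain n where "n \<in> split_relations C A" "x = (n + - (g - h)) + g" by auto
  thus "x \<in> {n + g |n. n \<in> split_relations C A}"
    using split_relations_add[OF _ split_relations_minus[OF assms]] by blast
qed

lemma K0_comm_group: "comm_group (K0_split C A)"
  unfolding K0_split_def
  by (rule comm_group.abelian_FactGroup[OF abelian_free_Abelian_group split_relations_subgroup])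

lemma K0_carrier: "z \<in> carrier (K0_split C A) \<longleftrightarrow> (\<exists>g. Poly_Mapping.keys g \<subseteq> A \<and> z = K0_coset A g)"
  unfolding K0_split_def carrier_FactGroup image_iff Bex_def carrier_free_Abelian_group_iff ..

lemma K0_one: "\<one>\<^bsub>K0_split C A\<^esub> = K0_coset A 0"
proof -
  have "K0_coset A 0 = split_relations C A"
    using group.coset_mult_one[OF group_free_Abelian_group subgroup.subset[OF split_relations_subgroup]] by simp
  thus ?thesis by (simp add: K0_split_def)
qed

lemma K0_mult:
  assumes "Poly_Mapping.keys g \<subseteq> A" "Poly_Mapping.keys h \<subseteq> A"
  shows "K0_coset A g \<otimes>\<^bsub>K0_split C A\<^esub> K0_coset A h = K0_coset A (g + h)"
  using normal.rcos_sum[OF split_relations_normal, of g A h] assms by (simp add: K0_split_def)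

lemma K0_class_coset: "K0_class C A t = K0_coset A (frag_of t)"
  by (simp add: K0_class_def)

lemma K0_class_closed: "t \<in> A \<Longrightarrow> K0_class C A t \<in> carrier (K0_split C A)"
  unfolding K0_carrier K0_class_coset by (intro exI[of _ "frag_of t"]) simp

lemma K0_hom_eval:
  assumes "\<phi> \<in> hom (K0_split C A) integer_group" "Poly_Mapping.keys g \<subseteq> A"
  shows "\<phi> (K0_coset A g) = frag_eval (\<lambda>t. \<phi> (K0_class C A t)) g"
proof -
  interpret \<phi>: group_hom "K0_split C A" integer_group \<phi>
    using assms(1) K0_comm_group by (simp add: group_hom_def group_hom_axioms_def comm_group_def)
  have clos: "K0_coset A g \<in> carrier (K0_split C A)" if "Poly_Mapping.keys g \<subseteq> A" for g
    using that unfolding K0_carrier by blast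
  show ?thesis
  proof (rule free_Abelian_group_induct[OF assms(2)])
    show "\<phi> (K0_coset A 0) = frag_eval (\<lambda>t. \<phi> (K0_class C A t)) 0"
      using \<phi>.hom_one by (simp add: K0_one)
  next
    fix g h assume gh: "Poly_Mapping.keys g \<subseteq> A" "Poly_Mapping.keys h \<subseteq> A"
      "\<phi> (K0_coset A g) = frag_eval (\<lambda>t. \<phi> (K0_class C A t)) g"
      "\<phi> (K0_coset A h) = frag_eval (\<lambda>t. \<phi> (K0_class C A t)) h"
    have k: "Poly_Mapping.keys (g - h) \<subseteq> A" using gh(1,2) keys_diff[of g h] by blast
    have "\<phi> (K0_coset A (g - h)) + \<phi> (K0_coset A h) = \<phi> (K0_coset A g)"
      using \<phi>.hom_mult[OF clos[OF k] clos[OF gh(2)]] K0_mult[OF k gh(2)] by simp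
    thus "\<phi> (K0_coset A (g - h)) = frag_eval (\<lambda>t. \<phi> (K0_class C A t)) (g - h)"
      using gh(3,4) by (simp add: frag_eval_diff)
  qed (simp add: K0_class_coset)
qed

lemma K0_dual_exists:
  assumes "sum_additive A f"
  shows "\<exists>\<phi> \<in> int_dual (K0_split C A). \<forall>t\<in>A. \<phi> (K0_class C A t) = f t"
proof -
  \<comment> \<open>The chosen representative is immaterial: two representatives differ by a
    relation, on which the extension of an additive \<open>f\<close> vanishes.\<close>
  define \<phi> where "\<phi> = restrict (\<lambda>z. frag_eval f (SOME g. g \<in> z)) (carrier (K0_split C A))"
  have \<phi>: "\<phi> (K0_coset A g) = frag_eval f g" if g: "Poly_Mapping.keys g \<subseteq> A" for g
  proof -
    have "g \<in> K0_coset A g" unfolding K0_coset_def' using split_relations_0 by force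
    hence "(SOME g'. g' \<in> K0_coset A g) \<in> K0_coset A g" by (rule someI)
    then obtain n where "n \<in> split_relations C A" "(SOME g'. g' \<in> K0_coset A g) = n + g"
      unfolding K0_coset_def' by blast
    hence "frag_eval f (SOME g'. g' \<in> K0_coset A g) = frag_eval f g"
      using split_relations_eval[OF assms] by (simp add: frag_eval_add)
    moreover have "K0_coset A g \<in> carrier (K0_split C A)" using g unfolding K0_carrier by blast
    ultimately show ?thesis by (simp add: \<phi>_def)
  qed
  have "\<phi> (x \<otimes>\<^bsub>K0_split C A\<^esub> y) = \<phi> x + \<phi> y"
    if xy: "x \<in> carrier (K0_split C A)" "y \<in> carrier (K0_split C A)" for x y
  proof -
    obtain g where g: "Poly_Mapping.keys g \<subseteq> A" "x = K0_coset A g"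
      using xy(1) unfolding K0_carrier by (elim exE conjE)
    obtain h where h: "Poly_Mapping.keys h \<subseteq> A" "y = K0_coset A h"
      using xy(2) unfolding K0_carrier by (elim exE conjE)
    have k: "Poly_Mapping.keys (g + h) \<subseteq> A"
      by (rule order_trans[OF Poly_Mapping.keys_add Un_least[OF g(1) h(1)]])
    show ?thesis
      unfolding g(2) h(2) K0_mult[OF g(1) h(1)] \<phi>[OF k] \<phi>[OF g(1)] \<phi>[OF h(1)] by (rule frag_eval_add)
  qed
  hence "\<phi> \<in> int_dual (K0_split C A)" by (auto simp: int_dual_def hom_def \<phi>_def)
  moreover have "\<phi> (K0_class C A t) = f t" if "t \<in> A" for t
    using \<phi>[of "frag_of t"] that by (simp add: K0_class_coset)
  ultimately show ?thesis by blast
qed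

end

section \<open>Normal forms and separation in the split Grothendieck group\<close>

context krull_schmidt_category
begin

text \<open>The choice depends only on the predicate \<open>isomorphic C X\<close>, and isomorphic
  objects have the same predicate; so they share their representative.\<close>

definition iso_rep :: "'o \<Rightarrow> 'o" where
  "iso_rep X = (SOME Y. isomorphic C X Y)"

lemma isomorphic_iso_rep: "isomorphic C X (iso_rep X)"
  unfolding iso_rep_def using isomorphic_refl by (rule someI)

lemma iso_rep_eq:
  assumes "isomorphic C X Y"
  shows "iso_rep X = iso_rep Y"
proof -
  have "isomorphic C X Z \<longleftrightarrow> isomorphic C Y Z" for Z
    using isomorphic_trans[OF isomorphic_sym[OF assms], of Z] isomorphic_trans[OF assms, of Z] by (rule iffI)
  hence "isomorphic C X = isomorphic C Y" by (rule ext)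
  thus ?thesis unfolding iso_rep_def by (rule arg_cong)
qed

lemma add_of_isomorphic:
  assumes "X \<in> add_of C T" "isomorphic C X Y"
  shows "Y \<in> add_of C T"
proof -
  obtain Z where "zero_object C Z" using zero_exists by blast
  thus ?thesis using add_of_summand[OF assms(1) is_sum_zero[OF assms(2)]] by blast
qed

text \<open>Modulo the relations an object becomes the sum of its local summands, and each of these
  is exchanged for its chosen representative at the cost of the class of a zero object, which is a
  relation itself.\<close>

lemma K0_normal_form_object:
  assumes "list_sum t Xs" "\<And>X. X \<in> set Xs \<Longrightarrow> local_object X" "t \<in> add_of C T"
  shows "\<exists>g. Poly_Mapping.keys g \<subseteq> iso_rep ` {X \<in> add_of C T. local_object X} \<and>
    frag_of t - g \<in> split_relations C (add_of C T)"
  using assms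
proof (induction rule: list_sum.induct)
  case (list_sum_Nil t)
  have "is_sum C t t t" by (rule is_sum_zero[OF isomorphic_refl]) fact
  \<comment> \<open>A zero object is the sum of two copies of itself; this relation is the negative
    of its class.\<close>
  hence "- (frag_of t - (frag_of t + frag_of t)) \<in> split_relations C (add_of C T)"
    using list_sum_Nil by (intro split_relations_minus split_relations_sum)
  thus ?case by (intro exI[of _ 0]) simp
next
  case (list_sum_Cons t X R Xs)
  let ?A = "add_of C T" and ?N = "split_relations C (add_of C T)"
  have R: "R \<in> ?A" and X: "X \<in> ?A"
    using add_of_summand[OF list_sum_Cons.prems(2)] list_sum_Cons.hyps(1) is_sum_comm by blast+
  obtain g where g: "Poly_Mapping.keys g \<subseteq> iso_rep ` {X \<in> ?A. local_object X}" "frag_of R - g \<in> ?N"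
    using list_sum_Cons.IH list_sum_Cons.prems R by auto
  obtain Z where Z: "zero_object C Z" using zero_exists by blast
  have ZA: "Z \<in> ?A" using add_of_zero[OF Z] .
  have "is_sum C Z Z Z" by (rule is_sum_zero[OF isomorphic_refl Z])
  hence z: "frag_of Z - (frag_of Z + frag_of Z) \<in> ?N" using ZA by (intro split_relations_sum)
  have "is_sum C X (iso_rep X) Z" by (rule is_sum_zero[OF isomorphic_iso_rep Z])
  hence x: "frag_of X - (frag_of (iso_rep X) + frag_of Z) \<in> ?N"
    using X ZA add_of_isomorphic[OF X isomorphic_iso_rep] by (intro split_relations_sum)
  have t: "frag_of t - (frag_of X + frag_of R) \<in> ?N"
    using list_sum_Cons.prems(2) X R list_sum_Cons.hyps(1) by (intro split_relations_sum)
  have "frag_of t - (frag_of (iso_rep X) + g) =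
      (frag_of t - (frag_of X + frag_of R)) + (frag_of X - (frag_of (iso_rep X) + frag_of Z)) +
      - (frag_of Z - (frag_of Z + frag_of Z)) + (frag_of R - g)"
    by (simp add: algebra_simps)
  also have "\<dots> \<in> ?N" by (intro split_relations_add split_relations_minus t x z g)
  finally have "frag_of t - (frag_of (iso_rep X) + g) \<in> ?N" .
  moreover have "Poly_Mapping.keys (frag_of (iso_rep X) + g) \<subseteq> iso_rep ` {X \<in> ?A. local_object X}"
    using Poly_Mapping.keys_add[of "frag_of (iso_rep X)" g] g(1) X list_sum_Cons.prems(1) by auto
  ultimately show ?case by blast
qed

lemma K0_normal_form:
  assumes "Poly_Mapping.keys g \<subseteq> add_of C T"
  shows "\<exists>g'. Poly_Mapping.keys g' \<subseteq> iso_rep ` {X \<in> add_of C T. local_object X} \<and>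
    g - g' \<in> split_relations C (add_of C T)"
proof -
  let ?N = "split_relations C (add_of C T)"
  define S where "S = iso_rep ` {X \<in> add_of C T. local_object X}"
  define P where "P x \<longleftrightarrow> (\<exists>g'. Poly_Mapping.keys g' \<subseteq> S \<and> x - g' \<in> ?N)" for x
  have zero: "P 0" unfolding P_def using split_relations_0 by (intro exI[of _ 0]) simp
  have diff: "P (x - y)" if xy: "P x" "P y" for x y
  proof -
    obtain x' where x': "Poly_Mapping.keys x' \<subseteq> S" "x - x' \<in> ?N"
      using xy(1) unfolding P_def by (elim exE conjE)
    obtain y' where y': "Poly_Mapping.keys y' \<subseteq> S" "y - y' \<in> ?N"
      using xy(2) unfolding P_def by (elim exE conjE)
    have "(x - y) - (x' - y') \<in> ?N"
      unfolding diff_diff_regroup by (intro split_relations_add split_relations_minus x'(2) y'(2))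
    moreover have "Poly_Mapping.keys (x' - y') \<subseteq> S"
      by (rule order_trans[OF keys_diff Un_least[OF x'(1) y'(1)]])
    ultimately show ?thesis unfolding P_def by (intro exI[of _ "x' - y'"] conjI)
  qed
  have single: "P (frag_of t)" if t: "t \<in> add_of C T" for t
  proof -
    obtain Xs where Xs: "list_sum t Xs" "\<And>X. X \<in> set Xs \<Longrightarrow> local_object X"
      using local_decomposition[of t] by metis
    show ?thesis unfolding P_def S_def by (rule K0_normal_form_object[OF Xs t])
  qed
  have "P g"
  proof (rule free_Abelian_group_induct[OF assms])
    show "P 0" by (rule zero)
    show "P (x - y)" if "P x" "P y" for x y using that by (rule diff)
    show "P (frag_of t)" if "t \<in> add_of C T" for t using that by (rule single)
  qed
  thus ?thesis unfolding P_def S_def .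
qed

text \<open>Distinct keys of a normal form are non-isomorphic. The functional for a key
  \<open>X\<close> therefore sends \<open>z\<close> to the coefficient at \<open>X\<close> times a
  non-zero number, so all coefficients vanish. No independence of the classes is
  presupposed.\<close>

lemma K0_separation:
  assumes z: "z \<in> carrier (K0_split C (add_of C T))"
    and sep: "\<And>X. X \<in> add_of C T \<Longrightarrow> local_object X \<Longrightarrow>
      \<exists>\<phi> \<in> hom (K0_split C (add_of C T)) integer_group. \<phi> z = 0 \<and> \<phi> (K0_class C (add_of C T) X) \<noteq> 0 \<and>
        (\<forall>Y\<in>add_of C T. local_object Y \<and> \<not> isomorphic C X Y \<longrightarrow> \<phi> (K0_class C (add_of C T) Y) = 0)"
  shows "z = \<one>\<^bsub>K0_split C (add_of C T)\<^esub>"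
proof -
  let ?A = "add_of C T"
  obtain g0 where g0: "Poly_Mapping.keys g0 \<subseteq> ?A" "z = K0_coset ?A g0" 
    using z unfolding K0_carrier by (elim exE conjE)
  obtain g where g: "Poly_Mapping.keys g \<subseteq> iso_rep ` {X \<in> ?A. local_object X}"
      "g0 - g \<in> split_relations C ?A" 
    using K0_normal_form[OF g0(1)] by (elim exE conjE)
  have zg: "z = K0_coset ?A g" using K0_coset_eqI[OF g(2)] g0(2) by simp
  have loc: "local_object X" "X \<in> ?A" if X: "X \<in> Poly_Mapping.keys g" for X
  proof -
    obtain X' where "X' \<in> ?A" "local_object X'" "X = iso_rep X'"
      using subsetD[OF g(1) X] by (elim imageE CollectE conjE)
    thus "local_object X" "X \<in> ?A"
      using local_object_isomorphic[OF isomorphic_sym[OF isomorphic_iso_rep]]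
        add_of_isomorphic[OF _ isomorphic_iso_rep] by simp_all
  qed
  have "Poly_Mapping.keys g = {}"
  proof (rule ccontr)
    assume "Poly_Mapping.keys g \<noteq> {}"
    then obtain X where X: "X \<in> Poly_Mapping.keys g" by blast
    obtain \<phi> where \<phi>: "\<phi> \<in> hom (K0_split C ?A) integer_group" "\<phi> z = 0" "\<phi> (K0_class C ?A X) \<noteq> 0"
        "\<And>Y. Y \<in> ?A \<Longrightarrow> local_object Y \<Longrightarrow> \<not> isomorphic C X Y \<Longrightarrow> \<phi> (K0_class C ?A Y) = 0"
      using sep[OF loc(2)[OF X] loc(1)[OF X]] by (elim bexE conjE) blast
    have niso: "\<not> isomorphic C X Y" if Y: "Y \<in> Poly_Mapping.keys g" "Y \<noteq> X" for Y
    proof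
      assume iso: "isomorphic C X Y"
      obtain X' Y' where "X = iso_rep X'" "Y = iso_rep Y'"
        using subsetD[OF g(1) X] subsetD[OF g(1) Y(1)] by (elim imageE)
      hence iso': "isomorphic C X' Y'"
        using isomorphic_trans[OF isomorphic_trans[OF isomorphic_iso_rep[of X'] ] isomorphic_sym[OF isomorphic_iso_rep[of Y']]]
          iso by simp
      have "X = iso_rep Y'" using iso_rep_eq[OF iso'] \<open>X = iso_rep X'\<close> by (rule trans[rotated])
      hence "Y = X" using \<open>Y = iso_rep Y'\<close> by (rule trans[OF _ sym, rotated])
      with Y(2) show False ..
    qed
    have "Poly_Mapping.keys g \<subseteq> ?A" using loc(2) by (rule subsetI)
    from K0_hom_eval[OF \<phi>(1) this] have "\<phi> z = frag_eval (\<lambda>t. \<phi> (K0_class C ?A t)) g"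
      unfolding zg .
    also have "\<dots> = (\<Sum>Y\<in>{X}. Poly_Mapping.lookup g Y * \<phi> (K0_class C ?A Y))"
      unfolding frag_eval_def
    proof (rule sum.mono_neutral_right)
      show "\<forall>Y\<in>Poly_Mapping.keys g - {X}. Poly_Mapping.lookup g Y * \<phi> (K0_class C ?A Y) = 0"
        using niso \<phi>(4)[OF loc(2) loc(1)] by simp
    qed (use X in simp_all)
    finally show False using \<phi>(2,3) X by (simp add: in_keys_iff)
  qed
  hence "g = 0" by simp
  thus ?thesis using zg K0_one by simp
qed

end

section \<open>Additivity of the Euler form\<close>

context angulated_category
begin

lemma is_sum_Sob:
  assumes "is_sum C P X Y"
  shows "is_sum C (Sob C P) (Sob C X) (Sob C Y)"
proof -
  obtain i1 i2 p1 p2 where b: "biproduct C P X Y i1 i2 p1 p2" using assms unfolding is_sum_def by blast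
  have arr: "i1 \<in> Arr C X P" "i2 \<in> Arr C Y P" "p1 \<in> Arr C P X" "p2 \<in> Arr C P Y"
    using b by (auto simp: biproduct_def)
  have "Sarr C P P (Comp C P X P i1 p1 \<oplus>\<^bsub>Hom C P P\<^esub> Comp C P Y P i2 p2) =
      Sarr C P P (Comp C P X P i1 p1) \<oplus>\<^bsub>Hom C (Sob C P) (Sob C P)\<^esub> Sarr C P P (Comp C P Y P i2 p2)"
    using Sarr_hom[of P P] arr unfolding module_hom_def by auto
  hence "biproduct C (Sob C P) (Sob C X) (Sob C Y)
      (Sarr C X P i1) (Sarr C Y P i2) (Sarr C P X p1) (Sarr C P Y p2)"
    using b arr unfolding biproduct_def by (simp flip: Sarr_comp)
  thus ?thesis unfolding is_sum_def by blast
qed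

end

context hom_finite_angulated_category
begin

text \<open>The subspaces \<open>I X\<close> form a subfunctor of Hom(-, Y), which covers Hom and
  \<open>annihilated\<close> together. Restriction along \<open>i1\<close> is onto, and its kernel
  is the copy of \<open>I X'\<close> embedded by \<open>p2\<close>.\<close>

lemma sdim_is_sum:
  assumes I: "\<And>X. subspace K (I X) (Hom C X Y)"
    and closed: "\<And>X X' f g. g \<in> I X' \<Longrightarrow> f \<in> Arr C X X' \<Longrightarrow> Comp C X X' Y g f \<in> I X"
    and s: "is_sum C P X X'"
  shows "sdim K (Hom C P Y) (I P) = sdim K (Hom C X Y) (I X) + sdim K (Hom C X' Y) (I X')"
proof -
  obtain i1 i2 p1 p2 where b: "biproduct C P X X' i1 i2 p1 p2" using s unfolding is_sum_def by blast
  have arr: "i1 \<in> Arr C X P" "i2 \<in> Arr C X' P" "p1 \<in> Arr C P X" "p2 \<in> Arr C P X'"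
    and eqs: "Comp C X P X p1 i1 = Ident C X" "Comp C X' P X' p2 i2 = Ident C X'"
      "Comp C X P X' p2 i1 = Zero C X X'"
    and id: "Comp C P X P i1 p1 \<oplus>\<^bsub>Hom C P P\<^esub> Comp C P X' P i2 p2 = Ident C P"
    using b by (auto simp: biproduct_def)
  have sub: "f \<in> Arr C Z Y" if "f \<in> I Z" for f Z using subspace_subset[OF I] that by blast
  have im: "(\<lambda>g. Comp C X P Y g i1) ` I P = I X"
  proof (intro subset_antisym subsetI)
    fix f assume f: "f \<in> I X"
    have "f = Comp C X P Y (Comp C P X Y f p1) i1"
      using Comp_assoc[OF arr(1,3) sub[OF f]] eqs(1) Ident_right[OF sub[OF f]] by simp
    thus "f \<in> (\<lambda>g. Comp C X P Y g i1) ` I P" using closed[OF f arr(3)] by (rule image_eqI)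
  qed (use closed arr(1) in auto)
  have ker: "{g \<in> I P. Comp C X P Y g i1 = Zero C X Y} = (\<lambda>g. Comp C P X' Y g p2) ` I X'"
  proof (intro subset_antisym subsetI)
    fix g assume "g \<in> {g \<in> I P. Comp C X P Y g i1 = Zero C X Y}"
    hence g: "g \<in> I P" "Comp C X P Y g i1 = Zero C X Y" by auto
    have "g = Comp C P P Y g (Comp C P X P i1 p1 \<oplus>\<^bsub>Hom C P P\<^esub> Comp C P X' P i2 p2)"
      using Ident_right[OF sub[OF g(1)]] id by simp
    also have "\<dots> = Comp C P X' Y (Comp C X' P Y g i2) p2"
      using arr sub[OF g(1)] g(2) by (simp add: Comp_linear flip: Comp_assoc)
    finally show "g \<in> (\<lambda>g. Comp C P X' Y g p2) ` I X'" using closed[OF g(1) arr(2)] by (rule image_eqI)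
  next
    fix g assume "g \<in> (\<lambda>g. Comp C P X' Y g p2) ` I X'"
    then obtain f where f: "f \<in> I X'" "g = Comp C P X' Y f p2" by auto
    have "Comp C X P Y g i1 = Zero C X Y"
      using Comp_assoc[OF arr(1,4) sub[OF f(1)]] eqs(3) sub[OF f(1)] f(2) by simp
    thus "g \<in> {g \<in> I P. Comp C X P Y g i1 = Zero C X Y}" using closed[OF f(1) arr(4)] f(2) by simp
  qed
  have "inj_on (\<lambda>g. Comp C P X' Y g p2) (I X')"
  proof (rule inj_onI)
    fix g g' assume g: "g \<in> I X'" "g' \<in> I X'" "Comp C P X' Y g p2 = Comp C P X' Y g' p2"
    have inv: "Comp C X' P Y (Comp C P X' Y f p2) i2 = f" if "f \<in> I X'" for f
      unfolding Comp_assoc[OF arr(2,4) sub[OF that]] eqs(2) by (rule Ident_right[OF sub[OF that]])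
    have "g = Comp C X' P Y (Comp C P X' Y g p2) i2" by (rule inv[OF g(1), symmetric])
    also have "\<dots> = g'" unfolding g(3) by (rule inv[OF g(2)])
    finally show "g = g'" .
  qed
  hence "sdim K (Hom C P Y) ((\<lambda>g. Comp C P X' Y g p2) ` I X') = sdim K (Hom C X' Y) (I X')"
    by (rule sdim_image_inj[OF Hom_fin_dim I Hom_vectorspace Comp_linear_left[OF arr(4)]])
  thus ?thesis using rank_nullity_pre[OF arr(1) I[of P]] by (simp add: im ker)
qed

lemma hom_dim_is_sum:
  assumes "is_sum C P X X'"
  shows "hom_dim K C P Y = hom_dim K C X Y + hom_dim K C X' Y"
  unfolding hom_dim_sdim
  by (rule sdim_is_sum[where I = "\<lambda>X. Arr C X Y", OF subspace_carrier[OF Hom_vectorspace] _ assms]) blast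

lemma euler_form_is_sum:
  assumes "is_sum C P X X'"
  shows "euler_form A P Y = euler_form A X Y + euler_form A X' Y"
proof -
  have "ann_dim A P Y = ann_dim A X Y + ann_dim A X' Y" for Y
    by (rule sdim_is_sum[where I = "\<lambda>X. annihilated A X Y", OF annihilated_subspace annihilated_comp_right assms])
  thus ?thesis using hom_dim_is_sum[OF assms, of Y] by (simp add: euler_form_def algebra_simps)
qed

lemma euler_form_zero:
  assumes "zero_object C Z"
  shows "euler_form A Z Y = 0"
  using euler_form_is_sum[OF is_sum_zero[OF isomorphic_refl[of Z] assms], of A Y] by simp

lemma hom_dim_isomorphic:
  assumes "isomorphic C X X'"
  shows "hom_dim K C X Y = hom_dim K C X' Y"
proof -
  obtain Z where Z: "zero_object C Z" using zero_exists by blast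
  have "hom_dim K C Z Y = 0"
    using hom_dim_is_sum[OF is_sum_zero[OF isomorphic_refl[of Z] Z], of Y] by simp
  thus ?thesis using hom_dim_is_sum[OF is_sum_zero[OF assms Z], of Y] by simp
qed

lemma annihilated_shift:
  assumes "rigid A" "t \<in> A"
  shows "annihilated A (Sob C t) Y = Arr C (Sob C t) Y"
proof -
  have "Comp C W (Sob C t) Y f p = Zero C W Y" if "f \<in> Arr C (Sob C t) Y" "W \<in> A" "p \<in> Arr C W (Sob C t)" for f W p
    using rigid_zero[OF assms(1) that(2) assms(2) that(3)] that(1) by simp
  thus ?thesis unfolding annihilated_def by blast
qed

text \<open>On the shift of an object of \<open>A\<close> everything is \<open>annihilated\<close>:
  the first two terms of the form cancel and the third is a full Hom dimension.\<close>

lemma euler_form_shift: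
  assumes "rigid A" "t \<in> A"
  shows "euler_form A (Sob C t) Y = (- 1) ^ d * int (hom_dim K C t Y)"
  using hom_dim_Sob[of t Y]
  by (simp add: euler_form_def annihilated_shift[OF assms] flip: hom_dim_sdim)

lemma sum_additive_hom_dim: "sum_additive A (\<lambda>t. int (hom_dim K C t Y))"
  unfolding sum_additive_def using hom_dim_is_sum by simp

lemma factoring_through_source:
  assumes "X \<in> A" "f \<in> Arr C X Y"
  shows "f \<in> factoring_through C A X Y"
  unfolding factoring_through_def using assms Ident_right[OF assms(2)] Ident_closed[of X] by force

end

section \<open>Serre duality\<close>

lemma subspaceD:
  assumes "subspace K W V"
  shows "\<zero>\<^bsub>V\<^esub> \<in> W" "v \<in> W \<Longrightarrow> w \<in> W \<Longrightarrow> v \<oplus>\<^bsub>V\<^esub> w \<in> W"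
    "c \<in> carrier K \<Longrightarrow> v \<in> W \<Longrightarrow> c \<odot>\<^bsub>V\<^esub> v \<in> W"
  using assms by (auto simp: subspace_def submodule_def)

context hom_finite_angulated_category
begin

lemma Sarr_factoring_through:
  "Sarr C X Y ` factoring_through C A X Y = factoring_through C (Sob C ` A) (Sob C X) (Sob C Y)"
proof (intro subset_antisym subsetI)
  fix h assume "h \<in> Sarr C X Y ` factoring_through C A X Y"
  then obtain W f g where "W \<in> A" "f \<in> Arr C X W" "g \<in> Arr C W Y" "h = Sarr C X Y (Comp C X W Y g f)"
    unfolding factoring_through_def by auto
  thus "h \<in> factoring_through C (Sob C ` A) (Sob C X) (Sob C Y)"
    unfolding factoring_through_def using Sarr_comp[of f X W g Y] by blast
next
  fix h assume "h \<in> factoring_through C (Sob C ` A) (Sob C X) (Sob C Y)"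
  then obtain W f g where W: "W \<in> A" and f: "f \<in> Arr C (Sob C X) (Sob C W)" and g: "g \<in> Arr C (Sob C W) (Sob C Y)"
    and h: "h = Comp C (Sob C X) (Sob C W) (Sob C Y) g f"
    unfolding factoring_through_def by auto
  obtain f' where f': "f' \<in> Arr C X W" "f = Sarr C X W f'" using Sarr_surj[OF f] .
  obtain g' where g': "g' \<in> Arr C W Y" "g = Sarr C W Y g'" using Sarr_surj[OF g] .
  have "h = Sarr C X Y (Comp C X W Y g' f')" using Sarr_comp[OF f'(1) g'(1)] h f'(2) g'(2) by simp
  moreover have "Comp C X W Y g' f' \<in> factoring_through C A X Y"
    unfolding factoring_through_def using W f'(1) g'(1) by blast
  ultimately show "h \<in> Sarr C X Y ` factoring_through C A X Y" by (rule image_eqI)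
qed

lemma factoring_through_subset: "factoring_through C A X Y \<subseteq> Arr C X Y"
  unfolding factoring_through_def by auto

lemma Sarr_mem_factoring_through:
  assumes "f \<in> Arr C X Y"
  shows "Sarr C X Y f \<in> factoring_through C (Sob C ` A) (Sob C X) (Sob C Y) \<longleftrightarrow> f \<in> factoring_through C A X Y"
proof -
  have "Sarr C X Y f \<in> Sarr C X Y ` factoring_through C A X Y \<longleftrightarrow> f \<in> factoring_through C A X Y"
    by (rule inj_on_image_mem_iff[OF bij_betw_imp_inj_on[OF Sarr_bij] assms factoring_through_subset])
  thus ?thesis unfolding Sarr_factoring_through .
qed

text \<open>Closure under addition is not visible from factorizations, since two of them may use
  different objects of \<open>A\<close>. After one shift the factoring morphisms are the
  \<open>annihilated\<close> ones, where it is.\<close>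

lemma factoring_through_subspace:
  assumes "tilting A"
  shows "subspace K (factoring_through C A X Y) (Hom C X Y)"
proof (rule subspaceI[OF Hom_vectorspace factoring_through_subset])
  note ann = annihilated_eq_factoring[OF assms, of "Sob C X" "Sob C Y"]
  note sub = annihilated_subspace[of A "Sob C X" "Sob C Y", unfolded ann]
  note mem = Sarr_mem_factoring_through[of _ X Y A]
  note lin = Sarr_hom[of X Y]
  show "Zero C X Y \<in> factoring_through C A X Y"
    using mem[of "Zero C X Y"] subspaceD(1)[OF sub] by simp
  show "v \<oplus>\<^bsub>Hom C X Y\<^esub> w \<in> factoring_through C A X Y"
    if vw: "v \<in> factoring_through C A X Y" "w \<in> factoring_through C A X Y" for v w
  proof -
    have c: "v \<in> Arr C X Y" "w \<in> Arr C X Y" using vw factoring_through_subset by blast+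
    have "Sarr C X Y (v \<oplus>\<^bsub>Hom C X Y\<^esub> w) = Sarr C X Y v \<oplus>\<^bsub>Hom C (Sob C X) (Sob C Y)\<^esub> Sarr C X Y w"
      using lin c unfolding module_hom_def by auto
    thus ?thesis using mem[of "v \<oplus>\<^bsub>Hom C X Y\<^esub> w"] mem[OF c(1)] mem[OF c(2)] c vw subspaceD(2)[OF sub] by simp
  qed
  show "a \<odot>\<^bsub>Hom C X Y\<^esub> v \<in> factoring_through C A X Y"
    if av: "a \<in> carrier K" "v \<in> factoring_through C A X Y" for a v
  proof -
    have c: "v \<in> Arr C X Y" using av factoring_through_subset by blast
    have "Sarr C X Y (a \<odot>\<^bsub>Hom C X Y\<^esub> v) = a \<odot>\<^bsub>Hom C (Sob C X) (Sob C Y)\<^esub> Sarr C X Y v"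
      using lin c av(1) unfolding module_hom_def by auto
    thus ?thesis using mem[of "a \<odot>\<^bsub>Hom C X Y\<^esub> v"] mem[OF c] c av subspaceD(3)[OF sub] by simp
  qed
qed

lemma sdim_factoring_through:
  assumes "tilting A"
  shows "sdim K (Hom C X Y) (factoring_through C A X Y) = ann_dim A (Sob C X) (Sob C Y)"
proof -
  have "inj_on (Sarr C X Y) (factoring_through C A X Y)"
    by (rule inj_on_subset[OF bij_betw_imp_inj_on[OF Sarr_bij] factoring_through_subset])
  from sdim_image_inj[OF Hom_fin_dim factoring_through_subspace[OF assms] Hom_vectorspace Sarr_hom this]
  show ?thesis unfolding Sarr_factoring_through annihilated_eq_factoring[OF assms] ..
qed

end

locale calabi_yau_category = hom_finite_angulated_category K d C + krull_schmidt_category K C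
  for K :: "'k ring" and d :: nat and C :: "('k, 'o, 'm, 'z) angcat_scheme" +
  assumes calabi_yau: "calabi_yau K C"
begin

text \<open>Composing with the isomorphism between the Serre functor and Sigma^2d turns Serre
  duality into a pairing of Hom(Y, Sigma^2d X) with Hom(X, Y).\<close>

lemma exists_serre_pairing:
  "\<exists>\<eta>. \<forall>X Y. \<eta> X Y \<in> module_hom K (Hom C Y (Sob C (Sob C X))) (dual_space K (Hom C X Y)) \<and>
     bij_betw (\<eta> X Y) (Arr C Y (Sob C (Sob C X))) (carrier (dual_space K (Hom C X Y))) \<and>
     (\<forall>Y'. \<forall>k\<in>Arr C Y' Y. \<forall>g\<in>Arr C Y (Sob C (Sob C X)). \<forall>h\<in>Arr C X Y'.
        \<eta> X Y' (Comp C Y' Y (Sob C (Sob C X)) g k) h = \<eta> X Y g (Comp C X Y' Y k h))"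
proof -
  obtain F where F: "serre_functor K C F" "naturally_isomorphic C F (comp_functor (shift C) (shift C))"
    using calabi_yau unfolding calabi_yau_def by (elim exE conjE)
  have "\<exists>\<epsilon>. \<forall>X. \<exists>\<theta>. inverse_arrows C (fobj F X) (Sob C (Sob C X)) (\<epsilon> X) \<theta>"
    using F(2) unfolding naturally_isomorphic_def comp_functor_def by auto
  then obtain \<epsilon> \<theta> where iso: "\<And>X. inverse_arrows C (fobj F X) (Sob C (Sob C X)) (\<epsilon> X) (\<theta> X)" by metis
  obtain \<eta> where hom: "\<And>X Y. \<eta> X Y \<in> module_hom K (Hom C Y (fobj F X)) (dual_space K (Hom C X Y))"
    and bij: "\<And>X Y. bij_betw (\<eta> X Y) (Arr C Y (fobj F X)) (carrier (dual_space K (Hom C X Y)))"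
    and nat: "\<And>X Y Y' k g h. k \<in> Arr C Y' Y \<Longrightarrow> g \<in> Arr C Y (fobj F X) \<Longrightarrow> h \<in> Arr C X Y' \<Longrightarrow>
      \<eta> X Y' (Comp C Y' Y (fobj F X) g k) h = \<eta> X Y g (Comp C X Y' Y k h)"
    using F(1) unfolding serre_functor_def by (elim conjE exE) blast
  let ?\<theta> = "\<lambda>X Y. Comp C Y (Sob C (Sob C X)) (fobj F X) (\<theta> X)"
  have \<theta>: "\<theta> X \<in> Arr C (Sob C (Sob C X)) (fobj F X)" and \<epsilon>: "\<epsilon> X \<in> Arr C (fobj F X) (Sob C (Sob C X))" for X
    using iso[of X] by (auto simp: inverse_arrows_def)
  have bij\<theta>: "bij_betw (?\<theta> X Y) (Arr C Y (Sob C (Sob C X))) (Arr C Y (fobj F X))" for X Y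
  proof (rule bij_betw_byWitness[where f' = "Comp C Y (fobj F X) (Sob C (Sob C X)) (\<epsilon> X)"])
    show "\<forall>g\<in>Arr C Y (Sob C (Sob C X)). Comp C Y (fobj F X) (Sob C (Sob C X)) (\<epsilon> X) (?\<theta> X Y g) = g"
      using iso[of X] Comp_assoc[OF _ \<theta>[of X] \<epsilon>[of X], symmetric] Ident_left by (simp add: inverse_arrows_def)
    show "\<forall>g\<in>Arr C Y (fobj F X). ?\<theta> X Y (Comp C Y (fobj F X) (Sob C (Sob C X)) (\<epsilon> X) g) = g"
      using iso[of X] Comp_assoc[OF _ \<epsilon>[of X] \<theta>[of X], symmetric] Ident_left by (simp add: inverse_arrows_def)
  qed (use \<theta> \<epsilon> in auto)
  have "\<eta> X Y \<circ> ?\<theta> X Y \<in> module_hom K (Hom C Y (Sob C (Sob C X))) (dual_space K (Hom C X Y))" for X Y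
    using hom[of X Y] Comp_linear_right[OF \<theta>, of Y X] unfolding module_hom_def by (auto simp: Pi_iff)
  moreover have "bij_betw (\<eta> X Y \<circ> ?\<theta> X Y) (Arr C Y (Sob C (Sob C X))) (carrier (dual_space K (Hom C X Y)))" for X Y
    by (rule bij_betw_trans[OF bij\<theta> bij])
  moreover have "(\<eta> X Y' \<circ> ?\<theta> X Y') (Comp C Y' Y (Sob C (Sob C X)) g k) h = (\<eta> X Y \<circ> ?\<theta> X Y) g (Comp C X Y' Y k h)"
    if "k \<in> Arr C Y' Y" "g \<in> Arr C Y (Sob C (Sob C X))" "h \<in> Arr C X Y'" for X Y Y' k g h
    using Comp_assoc[OF that(1,2) \<theta>] nat[OF that(1) Comp_closed[OF that(2) \<theta>] that(3)] by simp
  ultimately show ?thesis by (intro exI[of _ "\<lambda>X Y. \<eta> X Y \<circ> ?\<theta> X Y"]) blast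
qed

definition serre :: "'o \<Rightarrow> 'o \<Rightarrow> 'm \<Rightarrow> 'm \<Rightarrow> 'k" where
  "serre = (SOME \<eta>. \<forall>X Y. \<eta> X Y \<in> module_hom K (Hom C Y (Sob C (Sob C X))) (dual_space K (Hom C X Y)) \<and>
     bij_betw (\<eta> X Y) (Arr C Y (Sob C (Sob C X))) (carrier (dual_space K (Hom C X Y))) \<and>
     (\<forall>Y'. \<forall>k\<in>Arr C Y' Y. \<forall>g\<in>Arr C Y (Sob C (Sob C X)). \<forall>h\<in>Arr C X Y'.
        \<eta> X Y' (Comp C Y' Y (Sob C (Sob C X)) g k) h = \<eta> X Y g (Comp C X Y' Y k h)))"

lemma serre_hom: "serre X Y \<in> module_hom K (Hom C Y (Sob C (Sob C X))) (dual_space K (Hom C X Y))"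
  and serre_bij: "bij_betw (serre X Y) (Arr C Y (Sob C (Sob C X))) (carrier (dual_space K (Hom C X Y)))"
  and serre_natural: "k \<in> Arr C Y' Y \<Longrightarrow> g \<in> Arr C Y (Sob C (Sob C X)) \<Longrightarrow> h \<in> Arr C X Y' \<Longrightarrow>
    serre X Y' (Comp C Y' Y (Sob C (Sob C X)) g k) h = serre X Y g (Comp C X Y' Y k h)"
  using someI_ex[OF exists_serre_pairing] unfolding serre_def[symmetric] by blast+

lemma serre_zero: "serre X Y (Zero C Y (Sob C (Sob C X))) = (\<lambda>h\<in>Arr C X Y. \<zero>\<^bsub>K\<^esub>)"
proof -
  have smult: "serre X Y (a \<odot>\<^bsub>Hom C Y (Sob C (Sob C X))\<^esub> g) = a \<odot>\<^bsub>dual_space K (Hom C X Y)\<^esub> serre X Y g"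
    if "a \<in> carrier K" "g \<in> Arr C Y (Sob C (Sob C X))" for a g
    using serre_hom[of X Y] that unfolding module_hom_def by auto
  have "serre X Y (Zero C Y (Sob C (Sob C X))) =
      \<zero>\<^bsub>K\<^esub> \<odot>\<^bsub>dual_space K (Hom C X Y)\<^esub> serre X Y (Zero C Y (Sob C (Sob C X)))"
    using smult[OF Hom.R.zero_closed Hom.zero_closed] by simp
  also have "\<dots> = (\<lambda>h\<in>Arr C X Y. \<zero>\<^bsub>K\<^esub> \<otimes>\<^bsub>K\<^esub> serre X Y (Zero C Y (Sob C (Sob C X))) h)"
    by (simp add: dual_space_def ring.func_space_def Hom.R.ring_axioms)
  also have "\<dots> = (\<lambda>h\<in>Arr C X Y. \<zero>\<^bsub>K\<^esub>)"
  proof (rule restrict_ext)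
    fix h assume "h \<in> Arr C X Y"
    moreover have "serre X Y (Zero C Y (Sob C (Sob C X))) \<in> carrier (dual_space K (Hom C X Y))"
      using serre_bij[of X Y] by (auto simp: bij_betw_def)
    ultimately have "serre X Y (Zero C Y (Sob C (Sob C X))) h \<in> carrier K"
      by (auto simp: dual_space_def module_hom_def regular_module_def)
    thus "\<zero>\<^bsub>K\<^esub> \<otimes>\<^bsub>K\<^esub> serre X Y (Zero C Y (Sob C (Sob C X))) h = \<zero>\<^bsub>K\<^esub>" by simp
  qed
  finally show ?thesis .
qed

lemma serre_eq_zero:
  assumes "g \<in> Arr C Y (Sob C (Sob C X))" "\<And>h. h \<in> Arr C X Y \<Longrightarrow> serre X Y g h = \<zero>\<^bsub>K\<^esub>"
  shows "g = Zero C Y (Sob C (Sob C X))"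
proof -
  have "serre X Y g \<in> extensional (Arr C X Y)"
    using serre_bij[of X Y] assms(1) by (auto simp: bij_betw_def dual_space_def)
  hence "serre X Y g = serre X Y (Zero C Y (Sob C (Sob C X)))"
    unfolding serre_zero using assms(2) by (intro extensionalityI[of _ "Arr C X Y"]) simp_all
  thus ?thesis using serre_bij[of X Y] assms(1) by (auto simp: bij_betw_def inj_on_def)
qed

text \<open>By naturality, pairing \<open>g\<close> with a composite of \<open>h\<close> and
  \<open>p\<close> equals pairing the composite of \<open>p\<close> and \<open>g\<close> with
  \<open>h\<close>. As the pairing is non-degenerate, \<open>g\<close> is orthogonal to all
  morphisms through W exactly when it kills all morphisms from W.\<close>

lemma serre_annihilator:
  "{g \<in> Arr C X (Sob C (Sob C Z)). \<forall>n\<in>factoring_through C B Z X. serre Z X g n = \<zero>\<^bsub>K\<^esub>} =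
    annihilated B X (Sob C (Sob C Z))"
proof (intro subset_antisym subsetI)
  fix g assume "g \<in> {g \<in> Arr C X (Sob C (Sob C Z)). \<forall>n\<in>factoring_through C B Z X. serre Z X g n = \<zero>\<^bsub>K\<^esub>}"
  hence g: "g \<in> Arr C X (Sob C (Sob C Z))" "\<And>n. n \<in> factoring_through C B Z X \<Longrightarrow> serre Z X g n = \<zero>\<^bsub>K\<^esub>" by auto
  have "Comp C W X (Sob C (Sob C Z)) g p = Zero C W (Sob C (Sob C Z))" if "W \<in> B" "p \<in> Arr C W X" for W p
  proof (rule serre_eq_zero[OF Comp_closed[OF that(2) g(1)]])
    fix h assume h: "h \<in> Arr C Z W"
    have "Comp C Z W X p h \<in> factoring_through C B Z X" unfolding factoring_through_def using that h by blast
    thus "serre Z W (Comp C W X (Sob C (Sob C Z)) g p) h = \<zero>\<^bsub>K\<^esub>"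
      using serre_natural[OF that(2) g(1) h] g(2) by simp
  qed
  thus "g \<in> annihilated B X (Sob C (Sob C Z))" unfolding annihilated_def using g(1) by blast
next
  fix g assume g: "g \<in> annihilated B X (Sob C (Sob C Z))"
  have gc: "g \<in> Arr C X (Sob C (Sob C Z))" using g by (simp add: annihilated_def)
  have "serre Z X g n = \<zero>\<^bsub>K\<^esub>" if n: "n \<in> factoring_through C B Z X" for n
  proof -
    obtain W f p where W: "W \<in> B" "f \<in> Arr C Z W" "p \<in> Arr C W X" "n = Comp C Z W X p f"
      using n unfolding factoring_through_def by blast
    have "Comp C W X (Sob C (Sob C Z)) g p = Zero C W (Sob C (Sob C Z))"
      using g W by (simp add: annihilated_def)
    thus ?thesis using serre_natural[OF W(3) gc W(2)] W(2,4) by (simp add: serre_zero)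
  qed
  thus "g \<in> {g \<in> Arr C X (Sob C (Sob C Z)). \<forall>n\<in>factoring_through C B Z X. serre Z X g n = \<zero>\<^bsub>K\<^esub>}"
    using gc by blast
qed

lemma ann_dim_serre:
  assumes "tilting B"
  shows "ann_dim B X (Sob C (Sob C Z)) + ann_dim B (Sob C Z) (Sob C X) = hom_dim K C Z X"
  using sdim_annihilator[OF Hom_vectorspace Hom_fin_dim Hom_vectorspace Hom_fin_dim serre_hom[of Z X] serre_bij
      factoring_through_subspace[OF assms]]
  unfolding serre_annihilator sdim_factoring_through[OF assms] hom_dim_def .

lemma quotient_hom_dim:
  assumes "tilting B"
  shows "hom_dim K (quotient_category C (factoring_through C (Sob C ` B))) X Y + ann_dim B X Y = hom_dim K C X Y"
  using dim_quotient(1)[OF Hom_vectorspace[of X Y] Hom_fin_dim annihilated_subspace[of B]]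
  by (simp add: hom_dim_def quotient_category_def annihilated_eq_factoring[OF assms])

lemma quotient_hom_zero:
  assumes "tilting B"
  shows "Arr (quotient_category C (factoring_through C (Sob C ` B))) X Y =
      {Zero (quotient_category C (factoring_through C (Sob C ` B))) X Y} \<longleftrightarrow> Arr C X Y = annihilated B X Y"
  using dim_quotient(2)[OF Hom_vectorspace[of X Y] Hom_fin_dim annihilated_subspace[of B]]
  by (simp add: quotient_category_def annihilated_eq_factoring[OF assms])

text \<open>Serre duality makes I(Sigma^d X, Sigma^2d Y) complementary in dimension to I(Sigma^d Y,
  Sigma^2d X) within Hom(Sigma^d Y, Sigma^2d X). So the third term of the form is the dimension of a
  quotient space, with source and target exchanged.\<close>

lemma euler_form_quotient:
  assumes "tilting B"
  shows "euler_form B (Sob C X) (Sob C Y) =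
    int (hom_dim K (quotient_category C (factoring_through C (Sob C ` B))) (Sob C X) (Sob C Y)) +
    (- 1) ^ d * int (hom_dim K (quotient_category C (factoring_through C (Sob C ` B))) (Sob C Y) (Sob C (Sob C X)))"
proof -
  have "hom_dim K (quotient_category C (factoring_through C (Sob C ` B))) (Sob C Y) (Sob C (Sob C X)) =
      ann_dim B (Sob C X) (Sob C (Sob C Y))"
    using quotient_hom_dim[OF assms, of "Sob C Y" "Sob C (Sob C X)"] ann_dim_serre[OF assms, of "Sob C X" Y]
      hom_dim_Sob[of Y "Sob C X"] by linarith
  thus ?thesis using quotient_hom_dim[OF assms, of "Sob C X" "Sob C Y"] by (simp add: euler_form_def)
qed

end

section \<open>Indices and homological c-vectors\<close>

lemma frag_eval_cong:
  "(\<And>x. x \<in> Poly_Mapping.keys g \<Longrightarrow> f x = f' x) \<Longrightarrow> frag_eval f g = frag_eval f' g"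
  unfolding frag_eval_def by (rule sum.cong) simp_all

lemma frag_eval_sum: "frag_eval (\<lambda>x. \<Sum>k\<in>J. a k * f k x) g = (\<Sum>k\<in>J. a k * frag_eval (f k) g)"
proof -
  have "frag_eval (\<lambda>x. \<Sum>k\<in>J. a k * f k x) g =
      (\<Sum>x\<in>Poly_Mapping.keys g. \<Sum>k\<in>J. a k * (Poly_Mapping.lookup g x * f k x))"
    unfolding frag_eval_def sum_distrib_left by (simp add: mult.left_commute)
  also have "\<dots> = (\<Sum>k\<in>J. a k * frag_eval (f k) g)"
    unfolding frag_eval_def sum_distrib_left by (rule sum.swap)
  finally show ?thesis .
qed

lemma int_dual_hom: "\<phi> \<in> int_dual G \<Longrightarrow> \<phi> \<in> hom G integer_group"
  by (simp add: int_dual_def)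

lemma hom_integer_group_finprod:
  assumes "comm_group G" "\<phi> \<in> hom G integer_group" "finite J" "\<And>i. i \<in> J \<Longrightarrow> x i \<in> carrier G"
  shows "\<phi> (\<Otimes>\<^bsub>G\<^esub>i\<in>J. x i [^]\<^bsub>G\<^esub> (n i :: int)) = (\<Sum>i\<in>J. n i * \<phi> (x i))"
proof -
  interpret G: comm_group G by fact
  interpret \<phi>: group_hom G integer_group \<phi>
    using assms(2) G.group_axioms by (simp add: group_hom_def group_hom_axioms_def)
  show ?thesis using assms(3,4)
  proof (induction rule: finite_induct)
    case (insert j F)
    have c: "x i [^]\<^bsub>G\<^esub> n i \<in> carrier G" if "i \<in> insert j F" for i using insert.prems that by simp
    have "\<phi> (\<Otimes>\<^bsub>G\<^esub>i\<in>insert j F. x i [^]\<^bsub>G\<^esub> n i) = \<phi> (x j [^]\<^bsub>G\<^esub> n j \<otimes>\<^bsub>G\<^esub> (\<Otimes>\<^bsub>G\<^esub>i\<in>F. x i [^]\<^bsub>G\<^esub> n i))"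
      by (subst G.finprod_insert) (use insert.hyps c in auto)
    also have "\<dots> = \<phi> (x j [^]\<^bsub>G\<^esub> n j) + \<phi> (\<Otimes>\<^bsub>G\<^esub>i\<in>F. x i [^]\<^bsub>G\<^esub> n i)"
      using \<phi>.hom_mult[OF c[of j] G.finprod_closed[of "\<lambda>i. x i [^]\<^bsub>G\<^esub> n i" F]] c by simp
    also have "\<dots> = n j * \<phi> (x j) + (\<Sum>i\<in>F. n i * \<phi> (x i))"
      using insert.IH insert.prems \<phi>.hom_int_pow[of "x j" "n j"] by simp
    finally show ?case using insert.hyps by simp
  qed (use \<phi>.hom_one in simp)
qed

context linear_category
begin

text \<open>The functional on the Grothendieck group induced by \<open>f\<close>, meaningful for
  \<open>f\<close> additive on sums.\<close>

definition K0_ext :: "'o set \<Rightarrow> ('o \<Rightarrow> int) \<Rightarrow> ('o \<Rightarrow>\<^sub>0 int) set \<Rightarrow> int" where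
  "K0_ext A f = (SOME \<phi>. \<phi> \<in> int_dual (K0_split C A) \<and> (\<forall>t\<in>A. \<phi> (K0_class C A t) = f t))"

lemma K0_ext:
  assumes "sum_additive A f"
  shows K0_ext_dual: "K0_ext A f \<in> int_dual (K0_split C A)"
    and K0_ext_class: "t \<in> A \<Longrightarrow> K0_ext A f (K0_class C A t) = f t"
proof -
  have "\<exists>\<phi>. \<phi> \<in> int_dual (K0_split C A) \<and> (\<forall>t\<in>A. \<phi> (K0_class C A t) = f t)"
    using K0_dual_exists[OF assms] by (elim bexE) (rule exI, rule conjI)
  from someI_ex[OF this] show "K0_ext A f \<in> int_dual (K0_split C A)"
      "t \<in> A \<Longrightarrow> K0_ext A f (K0_class C A t) = f t"
    unfolding K0_ext_def[symmetric] by simp_all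
qed

lemmas K0_ext_hom = int_dual_hom[OF K0_ext_dual]

lemma K0_ext_eval:
  assumes "sum_additive A f" "Poly_Mapping.keys g \<subseteq> A"
  shows "K0_ext A f (K0_coset A g) = frag_eval f g"
  unfolding K0_hom_eval[OF K0_ext_hom[OF assms(1)] assms(2)]
  by (rule frag_eval_cong) (rule K0_ext_class[OF assms(1) subsetD[OF assms(2)]])

lemma K0_ext_sum:
  assumes "\<And>k. k \<in> J \<Longrightarrow> sum_additive A (f k)" "sum_additive A (\<lambda>t. \<Sum>k\<in>J. a k * f k t)"
    and "z \<in> carrier (K0_split C A)"
  shows "K0_ext A (\<lambda>t. \<Sum>k\<in>J. a k * f k t) z = (\<Sum>k\<in>J. a k * K0_ext A (f k) z)"
proof -
  obtain g where g: "Poly_Mapping.keys g \<subseteq> A" "z = K0_coset A g"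
    using assms(3) unfolding K0_carrier by (elim exE conjE)
  show ?thesis
    unfolding g(2) K0_ext_eval[OF assms(2) g(1)] frag_eval_sum
    by (rule sum.cong) (simp_all add: K0_ext_eval[OF assms(1) g(1)])
qed

lemma sum_additive_sum:
  assumes "\<And>k. k \<in> J \<Longrightarrow> sum_additive A (f k)"
  shows "sum_additive A (\<lambda>t. \<Sum>k\<in>J. a k * f k t)"
  using assms unfolding sum_additive_def by (simp add: distrib_left sum.distrib)

lemma int_dual_eqI:
  assumes \<phi>: "\<phi> \<in> int_dual (K0_split C A)" "\<psi> \<in> int_dual (K0_split C A)"
    and eq: "\<And>t. t \<in> A \<Longrightarrow> \<phi> (K0_class C A t) = \<psi> (K0_class C A t)"
  shows "\<phi> = \<psi>"
proof (rule extensionalityI)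
  show "\<phi> \<in> extensional (carrier (K0_split C A))" "\<psi> \<in> extensional (carrier (K0_split C A))"
    using \<phi> by (simp_all add: int_dual_def)
  fix z assume "z \<in> carrier (K0_split C A)"
  then obtain g where g: "Poly_Mapping.keys g \<subseteq> A" "z = K0_coset A g"
    unfolding K0_carrier by (elim exE conjE)
  show "\<phi> z = \<psi> z"
    unfolding g(2) K0_hom_eval[OF int_dual_hom[OF \<phi>(1)] g(1)] K0_hom_eval[OF int_dual_hom[OF \<phi>(2)] g(1)]
    by (rule frag_eval_cong) (rule eq[OF subsetD[OF g(1)]])
qed

end

context hom_finite_angulated_category
begin

lemma post_rank_eq_0:
  assumes "f \<in> Arr C X X'"
  shows "post_rank X X' f Y = 0 \<longleftrightarrow> (\<forall>g\<in>Arr C Y X. Comp C Y X X' f g = Zero C Y X')"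
proof -
  let ?I = "Comp C Y X X' f ` Arr C Y X"
  have "subspace K ?I (Hom C Y X')"
  proof (rule subspaceI[OF Hom_vectorspace])
    show "Zero C Y X' \<in> ?I" by (rule image_eqI[of _ _ "Zero C Y X"]) (simp_all add: assms)
    show "v \<oplus>\<^bsub>Hom C Y X'\<^esub> w \<in> ?I" if vw: "v \<in> ?I" "w \<in> ?I" for v w
    proof -
      obtain v' w' where "v' \<in> Arr C Y X" "w' \<in> Arr C Y X" "v = Comp C Y X X' f v'" "w = Comp C Y X X' f w'"
        using vw by (elim imageE)
      thus ?thesis using Comp_add_right[OF assms, of v' Y w'] by (intro image_eqI[of _ _ "v' \<oplus>\<^bsub>Hom C Y X\<^esub> w'"]) simp_all
    qed
    show "a \<odot>\<^bsub>Hom C Y X'\<^esub> v \<in> ?I" if av: "a \<in> carrier K" "v \<in> ?I" for a v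
    proof -
      obtain v' where "v' \<in> Arr C Y X" "v = Comp C Y X X' f v'" using av(2) by (elim imageE)
      thus ?thesis using Comp_smult_right[OF assms, of v' Y a] av(1)
        by (intro image_eqI[of _ _ "a \<odot>\<^bsub>Hom C Y X\<^esub> v'"]) simp_all
    qed
  qed (use assms in blast)
  hence "post_rank X X' f Y = 0 \<longleftrightarrow> ?I = {Zero C Y X'}"
    unfolding post_rank_def by (rule sdim_eq_0[OF Hom_fin_dim])
  also have "?I = {Zero C Y X'} \<longleftrightarrow> (\<forall>g\<in>Arr C Y X. Comp C Y X X' f g = Zero C Y X')"
  proof
    assume I: "?I = {Zero C Y X'}"
    show "\<forall>g\<in>Arr C Y X. Comp C Y X X' f g = Zero C Y X'"
    proof
      fix g assume "g \<in> Arr C Y X"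
      hence "Comp C Y X X' f g \<in> ?I" by (rule imageI)
      thus "Comp C Y X X' f g = Zero C Y X'" unfolding I by (rule singletonD)
    qed
  next
    assume z: "\<forall>g\<in>Arr C Y X. Comp C Y X X' f g = Zero C Y X'"
    hence "?I = (\<lambda>_. Zero C Y X') ` Arr C Y X" by (intro image_cong) simp_all
    thus "?I = {Zero C Y X'}" using Hom.zero_closed[of Y X] by (simp add: image_constant)
  qed
  finally show ?thesis .
qed

abbreviation hom_char :: "'o set \<Rightarrow> 'o \<Rightarrow> ('o \<Rightarrow>\<^sub>0 int) set \<Rightarrow> int" where
  "hom_char A Y \<equiv> K0_ext A (\<lambda>t. int (hom_dim K C t Y))"

lemma hom_char_mult:
  assumes "x \<in> carrier (K0_split C A)" "y \<in> carrier (K0_split C A)"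
  shows "hom_char A Y (x \<otimes>\<^bsub>K0_split C A\<^esub> y) = hom_char A Y x + hom_char A Y y"
  using hom_mult[OF K0_ext_hom[OF sum_additive_hom_dim] assms] by simp

end

section \<open>Separation of classes by dimensions of morphism spaces\<close>

context calabi_yau_category
begin

text \<open>Under Serre duality \<open>\<sigma>\<close> corresponds to a functional on the
  endomorphisms of \<open>x\<close> that vanishes on the radical but not at the identity. A morphism
  factoring through another indecomposable lies in the radical.\<close>

lemma exists_radical_functional:
  assumes x: "local_object x"
  shows "\<exists>\<sigma>\<in>Arr C x (Sob C (Sob C x)). \<sigma> \<noteq> Zero C x (Sob C (Sob C x)) \<and>
    (\<forall>t f. local_object t \<and> \<not> isomorphic C x t \<and> f \<in> Arr C t x \<longrightarrow>
      Comp C t x (Sob C (Sob C x)) \<sigma> f = Zero C t (Sob C (Sob C x)))"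
proof -
  \<comment> \<open>The radical of the local endomorphism ring, described as the set of
    endomorphisms without a left inverse.\<close>
  define N where "N = {a \<in> Arr C x x. \<forall>g\<in>Arr C x x. Comp C x x x g a \<noteq> Ident C x}"
  have nz: "Ident C x \<noteq> Zero C x x" using x by (simp add: local_object_def zero_object_def)
  have "subspace K N (Hom C x x)"
  proof (rule subspaceI[OF Hom_vectorspace])
    show "N \<subseteq> Arr C x x" by (auto simp: N_def)
    show "Zero C x x \<in> N" using nz by (auto simp: N_def)
    show "a \<oplus>\<^bsub>Hom C x x\<^esub> b \<in> N" if "a \<in> N" "b \<in> N" for a b
    proof -
      have ab: "a \<in> Arr C x x" "b \<in> Arr C x x" using that by (auto simp: N_def)
      \<comment> \<open>If \<open>g\<close> were a left inverse of the sum, locality would make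
        \<open>g\<close> composed with one of the two summands invertible, and that summand would
        have a left inverse.\<close>
      have "False" if g: "g \<in> Arr C x x" and e: "Comp C x x x g (a \<oplus>\<^bsub>Hom C x x\<^esub> b) = Ident C x" for g
      proof -
        have "Comp C x x x g a \<oplus>\<^bsub>Hom C x x\<^esub> Comp C x x x g b = Ident C x"
          using e Comp_add_right[OF g ab] by simp
        hence "auto_arrow x (Comp C x x x g a) \<or> auto_arrow x (Comp C x x x g b)"
          using x ab g unfolding local_object_def by blast
        then obtain w h where w: "w \<in> N" "h \<in> Arr C x x" "Comp C x x x h (Comp C x x x g w) = Ident C x"
          using \<open>a \<in> N\<close> \<open>b \<in> N\<close> unfolding auto_arrow_def inverse_arrows_def by blast
        have "Comp C x x x (Comp C x x x h g) w = Ident C x"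
          using Comp_assoc[of w x x g x h x] w g by (simp add: N_def)
        moreover have "Comp C x x x h g \<in> Arr C x x" using w(2) g by simp
        ultimately show False using w(1) by (simp add: N_def)
      qed
      thus ?thesis using ab unfolding N_def by blast
    qed
    show "a \<odot>\<^bsub>Hom C x x\<^esub> v \<in> N" if "a \<in> carrier K" "v \<in> N" for a v
    proof -
      have v: "v \<in> Arr C x x" using that by (simp add: N_def)
      have "Comp C x x x g (a \<odot>\<^bsub>Hom C x x\<^esub> v) \<noteq> Ident C x" if g: "g \<in> Arr C x x" for g
      proof -
        have "Comp C x x x g (a \<odot>\<^bsub>Hom C x x\<^esub> v) = Comp C x x x (a \<odot>\<^bsub>Hom C x x\<^esub> g) v"
          using Comp_smult_right[OF g v] Comp_smult_left[OF v g] \<open>a \<in> carrier K\<close> by simp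
        moreover have "a \<odot>\<^bsub>Hom C x x\<^esub> g \<in> Arr C x x" using g \<open>a \<in> carrier K\<close> by simp
        ultimately show ?thesis using \<open>v \<in> N\<close> by (simp add: N_def)
      qed
      thus ?thesis using v \<open>a \<in> carrier K\<close> by (simp add: N_def)
    qed
  qed
  moreover have "Ident C x \<notin> N" using Ident_closed[of x] Ident_left[OF Ident_closed[of x]] by (auto simp: N_def)
  ultimately obtain \<phi> where \<phi>: "\<phi> \<in> carrier (dual_space K (Hom C x x))" "\<And>n. n \<in> N \<Longrightarrow> \<phi> n = \<zero>\<^bsub>K\<^esub>"
      "\<phi> (Ident C x) \<noteq> \<zero>\<^bsub>K\<^esub>"
    using exists_functional_vanishing[OF Hom_vectorspace Hom_fin_dim _ Ident_closed] by blast
  obtain \<sigma> where \<sigma>: "\<sigma> \<in> Arr C x (Sob C (Sob C x))" "\<phi> = serre x x \<sigma>"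
    using serre_bij[of x x] \<phi>(1) unfolding bij_betw_def by (metis imageE)
  have "\<sigma> \<noteq> Zero C x (Sob C (Sob C x))"
  proof
    assume "\<sigma> = Zero C x (Sob C (Sob C x))"
    with \<phi>(3) show False unfolding \<sigma>(2) by (simp add: serre_zero Ident_closed)
  qed
  moreover have "Comp C t x (Sob C (Sob C x)) \<sigma> f = Zero C t (Sob C (Sob C x))"
    if t: "local_object t" "\<not> isomorphic C x t" "f \<in> Arr C t x" for t f
  proof (rule serre_eq_zero[OF Comp_closed[OF t(3) \<sigma>(1)]])
    fix h assume h: "h \<in> Arr C x t"
    \<comment> \<open>Otherwise \<open>x\<close> would be a retract of the local object
      \<open>t\<close> and hence isomorphic to it.\<close>
    have "Comp C x x x g (Comp C x t x f h) \<noteq> Ident C x" if g: "g \<in> Arr C x x" for g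
    proof
      assume "Comp C x x x g (Comp C x t x f h) = Ident C x"
      hence "Comp C x t x (Comp C t x x g f) h = Ident C x" using Comp_assoc[OF h t(3) g] by simp
      hence "retract x t" unfolding retract_def using h t(3) g by blast
      thus False using retract_local_isomorphic[OF t(1)] x t(2) by (simp add: local_object_def)
    qed
    hence "Comp C x t x f h \<in> N" using h t(3) by (simp add: N_def)
    thus "serre x t (Comp C t x (Sob C (Sob C x)) \<sigma> f) h = \<zero>\<^bsub>K\<^esub>"
      using serre_natural[OF t(3) \<sigma>(1) h] \<phi>(2) \<sigma>(2) by simp
  qed
  ultimately show ?thesis using \<sigma>(1) by blast
qed

text \<open>
  The separating function is the alternating sum over the remaining terms of an angle starting
  with the almost vanishing morphism \<open>x \<rightarrow> \<Sigma>\<^sup>2\<^sup>d x\<close>.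
\<close>

lemma exists_separating_sum:
  assumes A: "rigid A" and x: "x \<in> A" "local_object x"
  shows "\<exists>c. (\<Sum>k\<le>d. (- 1) ^ k * int (hom_dim K C x (c k))) \<noteq> 0 \<and>
    (\<forall>t\<in>A. local_object t \<and> \<not> isomorphic C x t \<longrightarrow> (\<Sum>k\<le>d. (- 1) ^ k * int (hom_dim K C t (c k))) = 0)"
proof -
  obtain \<sigma> where \<sigma>: "\<sigma> \<in> Arr C x (Sob C (Sob C x))" "\<sigma> \<noteq> Zero C x (Sob C (Sob C x))"
      "\<And>t f. local_object t \<Longrightarrow> \<not> isomorphic C x t \<Longrightarrow> f \<in> Arr C t x \<Longrightarrow>
        Comp C t x (Sob C (Sob C x)) \<sigma> f = Zero C t (Sob C (Sob C x))"
    using exists_radical_functional[OF x(2)] by blast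
  obtain c \<gamma> where c: "angle C c \<gamma>" "c 0 = x" "c 1 = Sob C (Sob C x)" "\<gamma> 0 = \<sigma>"
    using N1_extend[OF \<sigma>(1)] by blast
  have ex: "hexact c \<gamma>" by (rule hexact_angle[OF c(1)])
  \<comment> \<open>In the exact sequence of Hom(t, -) the right end contributes nothing, since
    morphisms from \<open>t\<close> to the shift of \<open>x\<close> vanish by rigidity. What
    remains is the rank of composition with \<open>\<sigma>\<close> on Hom(t, x).\<close>
  have D: "(\<Sum>k\<le>d. (- 1) ^ k * int (hom_dim K C t (c (Suc k)))) = int (post_rank x (Sob C (Sob C x)) \<sigma> t)"
    if t: "t \<in> A" for t
  proof -
    define r where "r k = post_rank (c k) (c (Suc k)) (\<gamma> k) t" for k
    have h: "int (hom_dim K C t (c (Suc k))) = int (r k) + int (r (Suc k))" if "k \<le> d" for k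
      using hexact_post_dim[OF ex that, of t] by (simp add: r_def)
    \<comment> \<open>The telescoping sum runs up to a successor; its ranks are \<open>r\<close>
      moved by one place, and \<open>r 0\<close> is the boundary term.\<close>
    obtain n where n: "d = Suc n" using d_pos by (cases d) auto
    have "(\<Sum>k\<le>Suc n. (- 1) ^ k * int (hom_dim K C t (c (Suc k)))) = int (r 0) + (- 1) ^ Suc n * int (r (Suc (Suc n)))"
      by (rule alternating_sum_telescope) (use h n in simp_all)
    moreover have "r (Suc d) = 0"
      unfolding r_def post_rank_eq_0[OF hexact_arr[OF ex order_refl]]
    proof
      fix g assume "g \<in> Arr C t (c (Suc d))"
      hence "Comp C t (c (Suc d)) (c (Suc (Suc d))) (\<gamma> (Suc d)) g \<in> Arr C t (c (Suc (Suc d)))"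
        using hexact_arr[OF ex order_refl] by (rule Comp_closed)
      thus "Comp C t (c (Suc d)) (c (Suc (Suc d))) (\<gamma> (Suc d)) g = Zero C t (c (Suc (Suc d)))"
        unfolding hexact_last[OF ex] c(2) by (rule rigid_zero[OF A t x(1)])
    qed
    ultimately show ?thesis using c n by (simp add: r_def)
  qed
  show ?thesis
  proof (intro exI[of _ "\<lambda>k. c (Suc k)"] conjI ballI impI)
    show "(\<Sum>k\<le>d. (- 1) ^ k * int (hom_dim K C x (c (Suc k)))) \<noteq> 0"
      unfolding D[OF x(1)] of_nat_eq_0_iff post_rank_eq_0[OF \<sigma>(1)]
    proof
      assume "\<forall>g\<in>Arr C x x. Comp C x x (Sob C (Sob C x)) \<sigma> g = Zero C x (Sob C (Sob C x))"
      from bspec[OF this Ident_closed[of x]] show False using \<sigma>(2) unfolding Ident_right[OF \<sigma>(1)] by contradiction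
    qed
    fix t assume t: "t \<in> A" "local_object t \<and> \<not> isomorphic C x t"
    show "(\<Sum>k\<le>d. (- 1) ^ k * int (hom_dim K C t (c (Suc k)))) = 0"
      unfolding D[OF t(1)] of_nat_eq_0_iff post_rank_eq_0[OF \<sigma>(1)] using \<sigma>(3) t(2) by blast
  qed
qed

text \<open>The separating functionals are integral combinations of the \<open>hom_char\<close>
  functionals, so they vanish at \<open>z\<close> too.\<close>

lemma hom_char_eq_0:
  assumes T: "rigid (add_of C T)" and z: "z \<in> carrier (K0_split C (add_of C T))"
    and 0: "\<And>Y. hom_char (add_of C T) Y z = 0"
  shows "z = \<one>\<^bsub>K0_split C (add_of C T)\<^esub>"
proof (rule K0_separation[OF z])
  fix X assume X: "X \<in> add_of C T" "local_object X"
  let ?A = "add_of C T"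
  obtain c where c: "(\<Sum>k\<le>d. (- 1) ^ k * int (hom_dim K C X (c k))) \<noteq> 0"
      "\<And>t. t \<in> ?A \<Longrightarrow> local_object t \<Longrightarrow> \<not> isomorphic C X t \<Longrightarrow> (\<Sum>k\<le>d. (- 1) ^ k * int (hom_dim K C t (c k))) = 0"
    using exists_separating_sum[OF T X] by (elim exE conjE) blast
  let ?f = "\<lambda>t. \<Sum>k\<in>{..d}. (- 1) ^ k * int (hom_dim K C t (c k))"
  have f: "sum_additive ?A ?f" by (rule sum_additive_sum[OF sum_additive_hom_dim])
  have "K0_ext ?A ?f z = 0"
    unfolding K0_ext_sum[OF sum_additive_hom_dim f z] using 0 by simp
  thus "\<exists>\<phi> \<in> hom (K0_split C ?A) integer_group. \<phi> z = 0 \<and> \<phi> (K0_class C ?A X) \<noteq> 0 \<and>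
      (\<forall>Y\<in>?A. local_object Y \<and> \<not> isomorphic C X Y \<longrightarrow> \<phi> (K0_class C ?A Y) = 0)"
    using K0_ext_class[OF f] c X(1) by (intro bexI[OF _ K0_ext_hom[OF f]]) simp
qed

lemma hom_char_eqI:
  assumes T: "rigid (add_of C T)" and k: "k \<in> carrier (K0_split C (add_of C T))" "l \<in> carrier (K0_split C (add_of C T))"
    and eq: "\<And>Y. hom_char (add_of C T) Y k = hom_char (add_of C T) Y l"
  shows "k = l"
proof -
  let ?G = "K0_split C (add_of C T)"
  interpret G: comm_group ?G by (rule K0_comm_group)
  have "hom_char (add_of C T) Y (k \<otimes>\<^bsub>?G\<^esub> inv\<^bsub>?G\<^esub> l) = 0" for Y
  proof -
    have "hom_char (add_of C T) Y ((k \<otimes>\<^bsub>?G\<^esub> inv\<^bsub>?G\<^esub> l) \<otimes>\<^bsub>?G\<^esub> l) = hom_char (add_of C T) Y k"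
      using k by (simp add: G.m_assoc)
    thus ?thesis using hom_char_mult[of "k \<otimes>\<^bsub>?G\<^esub> inv\<^bsub>?G\<^esub> l" "add_of C T" l Y] k eq[of Y] by simp
  qed
  hence "k \<otimes>\<^bsub>?G\<^esub> inv\<^bsub>?G\<^esub> l = \<one>\<^bsub>?G\<^esub>" using k by (intro hom_char_eq_0[OF T]) simp_all
  hence "(k \<otimes>\<^bsub>?G\<^esub> inv\<^bsub>?G\<^esub> l) \<otimes>\<^bsub>?G\<^esub> l = l" using k by simp
  thus ?thesis using k by (simp add: G.m_assoc)
qed

end

section \<open>The index, and existence and uniqueness of the c-vector\<close>

context calabi_yau_category
begin

lemma alternating_class_closed:
  assumes "resolution d C A v c \<gamma>"
  shows "(\<Otimes>\<^bsub>K0_split C A\<^esub> i \<in> {..d}. K0_class C A (c (d - i)) [^]\<^bsub>K0_split C A\<^esub> ((- 1) ^ i :: int)) \<in> carrier (K0_split C A)"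
proof -
  interpret G: comm_group "K0_split C A" by (rule K0_comm_group)
  have "K0_class C A (c (d - i)) [^]\<^bsub>K0_split C A\<^esub> ((- 1) ^ i :: int) \<in> carrier (K0_split C A)" for i
    by (intro G.int_pow_closed K0_class_closed resolutionD(3)[OF assms]) simp
  thus ?thesis by (intro G.finprod_closed) simp
qed

lemma hom_alternating_class:
  assumes "resolution d C A v c \<gamma>" "\<phi> \<in> hom (K0_split C A) integer_group"
  shows "\<phi> (\<Otimes>\<^bsub>K0_split C A\<^esub> i \<in> {..d}. K0_class C A (c (d - i)) [^]\<^bsub>K0_split C A\<^esub> ((- 1) ^ i :: int)) =
    (\<Sum>i\<le>d. (- 1) ^ i * \<phi> (K0_class C A (c (d - i))))"
  by (rule hom_integer_group_finprod[OF K0_comm_group assms(2) finite_atMost])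
    (intro K0_class_closed resolutionD(3)[OF assms(1)], simp)

lemma hom_char_alternating_class:
  assumes A: "rigid A" and r: "resolution d C A v c \<gamma>"
  shows "hom_char A Y (\<Otimes>\<^bsub>K0_split C A\<^esub> i \<in> {..d}. K0_class C A (c (d - i)) [^]\<^bsub>K0_split C A\<^esub> ((- 1) ^ i :: int)) =
    euler_form A v Y"
proof -
  have "hom_char A Y (K0_class C A (c (d - i))) = int (hom_dim K C (c (d - i)) Y)" for i
    by (rule K0_ext_class[OF sum_additive_hom_dim resolutionD(3)[OF r]]) simp
  thus ?thesis
    unfolding hom_alternating_class[OF r K0_ext_hom[OF sum_additive_hom_dim]]
    by (simp add: euler_form_resolution[OF A r])
qed

text \<open>Whatever the resolution, \<open>hom_char\<close> sends its alternating class to the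
  Euler form of \<open>v\<close>, in which the resolution does not occur. These values determine the
  class, so the definite description has a unique solution.\<close>

lemma index_resolution:
  assumes T: "rigid (add_of C T)" and r: "resolution d C (add_of C T) v c \<gamma>"
  shows "index d C (add_of C T) v = (\<Otimes>\<^bsub>K0_split C (add_of C T)\<^esub> i \<in> {..d}.
    K0_class C (add_of C T) (c (d - i)) [^]\<^bsub>K0_split C (add_of C T)\<^esub> ((- 1) ^ i :: int))"
  unfolding index_def
proof (rule the_equality)
  fix k assume "\<exists>c \<gamma>. resolution d C (add_of C T) v c \<gamma> \<and> k = (\<Otimes>\<^bsub>K0_split C (add_of C T)\<^esub> i \<in> {..d}.
    K0_class C (add_of C T) (c (d - i)) [^]\<^bsub>K0_split C (add_of C T)\<^esub> ((- 1) ^ i :: int))"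
  then obtain c' \<gamma>' where r': "resolution d C (add_of C T) v c' \<gamma>'" and k: "k = (\<Otimes>\<^bsub>K0_split C (add_of C T)\<^esub> i \<in> {..d}.
    K0_class C (add_of C T) (c' (d - i)) [^]\<^bsub>K0_split C (add_of C T)\<^esub> ((- 1) ^ i :: int))"
    by (elim exE conjE)
  show "k = (\<Otimes>\<^bsub>K0_split C (add_of C T)\<^esub> i \<in> {..d}.
    K0_class C (add_of C T) (c (d - i)) [^]\<^bsub>K0_split C (add_of C T)\<^esub> ((- 1) ^ i :: int))"
    unfolding k
    by (rule hom_char_eqI[OF T alternating_class_closed[OF r'] alternating_class_closed[OF r]])
      (unfold hom_char_alternating_class[OF T r'] hom_char_alternating_class[OF T r], rule refl)
qed (rule exI[of _ c], rule exI[of _ \<gamma>], rule conjI[OF r refl])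

lemma index_closed:
  assumes "tilting (add_of C T)"
  shows "index d C (add_of C T) v \<in> carrier (K0_split C (add_of C T))"
proof -
  obtain c \<gamma> where r: "resolution d C (add_of C T) v c \<gamma>" by (rule tilting_resolution[OF assms])
  show ?thesis unfolding index_resolution[OF tilting_rigid[OF assms] r] by (rule alternating_class_closed[OF r])
qed

lemma hom_char_index:
  assumes "tilting (add_of C T)"
  shows "hom_char (add_of C T) Y (index d C (add_of C T) v) = euler_form (add_of C T) v Y"
proof -
  obtain c \<gamma> where r: "resolution d C (add_of C T) v c \<gamma>" by (rule tilting_resolution[OF assms])
  show ?thesis unfolding index_resolution[OF tilting_rigid[OF assms] r]
    by (rule hom_char_alternating_class[OF tilting_rigid[OF assms] r])
qed

lemma index_zero:
  assumes "tilting (add_of C T)" "zero_object C Z"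
  shows "index d C (add_of C T) Z = \<one>\<^bsub>K0_split C (add_of C T)\<^esub>"
  by (rule hom_char_eq_0[OF tilting_rigid[OF assms(1)] index_closed[OF assms(1)]])
    (unfold hom_char_index[OF assms(1)], rule euler_form_zero[OF assms(2)])

text \<open>Both sides are compared through \<open>hom_char\<close>, where additivity is that of the
  Euler form; direct sums of resolutions are never formed.\<close>

lemma index_is_sum:
  assumes T: "tilting (add_of C T)" and s: "is_sum C P X Y"
  shows "index d C (add_of C T) P =
    index d C (add_of C T) X \<otimes>\<^bsub>K0_split C (add_of C T)\<^esub> index d C (add_of C T) Y"
proof -
  interpret G: comm_group "K0_split C (add_of C T)" by (rule K0_comm_group)
  show ?thesis
    by (rule hom_char_eqI[OF tilting_rigid[OF T] index_closed[OF T] G.m_closed[OF index_closed[OF T] index_closed[OF T]]])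
      (unfold hom_char_mult[OF index_closed[OF T] index_closed[OF T]] hom_char_index[OF T], rule euler_form_is_sum[OF s])
qed

text \<open>The Euler form of the shift of \<open>t\<close> is, up to (-1)^d, the dimension of
  Hom(t, Y), and it is additive on the resolution by \<open>B\<close>. For \<open>B\<close> the
  objects of U, every [t] becomes a combination of their indices.\<close>

lemma K0_class_index:
  assumes T: "tilting (add_of C T)" and t: "t \<in> add_of C T" and r: "resolution d C B (Sob C t) c \<gamma>"
  shows "K0_class C (add_of C T) t = (\<Otimes>\<^bsub>K0_split C (add_of C T)\<^esub> i \<in> {..d}.
    index d C (add_of C T) (c (d - i)) [^]\<^bsub>K0_split C (add_of C T)\<^esub> ((- 1) ^ d * (- 1) ^ i :: int))"
    (is "_ = ?p")
proof (rule hom_char_eqI[OF tilting_rigid[OF T] K0_class_closed[OF t]])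
  let ?A = "add_of C T"
  interpret G: comm_group "K0_split C ?A" by (rule K0_comm_group)
  have "index d C ?A (c (d - i)) [^]\<^bsub>K0_split C ?A\<^esub> ((- 1) ^ d * (- 1) ^ i :: int) \<in> carrier (K0_split C ?A)" for i
    by (intro G.int_pow_closed index_closed[OF T])
  thus "?p \<in> carrier (K0_split C ?A)" by (intro G.finprod_closed) simp
  fix Y
  note res = resolutionD[OF r]
  \<comment> \<open>The last morphism starts at the shift of \<open>t\<close>, an object of Sigma^d
    T, so it factors through its own source.\<close>
  have "\<gamma> (Suc d) \<in> factoring_through C (Sob C ` ?A) (c (Suc d)) (Sob C (c 0))"
    using hexact_arr[OF res(1) order_refl] t by (intro factoring_through_source) (simp_all add: hexact_last[OF res(1)] res(2))
  from euler_form_additive[OF res(1) T this, of Y]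
  have e: "(\<Sum>i\<le>d. (- 1) ^ i * euler_form ?A (c (d - i)) Y) = (- 1) ^ d * int (hom_dim K C t Y)"
    unfolding res(2) euler_form_shift[OF tilting_rigid[OF T] t] .
  have "hom_char ?A Y ?p = (\<Sum>i\<le>d. (- 1) ^ d * (- 1) ^ i * hom_char ?A Y (index d C ?A (c (d - i))))"
    by (rule hom_integer_group_finprod[OF K0_comm_group K0_ext_hom[OF sum_additive_hom_dim] finite_atMost index_closed[OF T]])
  also have "\<dots> = (- 1) ^ d * (\<Sum>i\<le>d. (- 1) ^ i * euler_form ?A (c (d - i)) Y)"
    unfolding hom_char_index[OF T] sum_distrib_left mult.assoc ..
  also have "\<dots> = int (hom_dim K C t Y)" unfolding e by (simp flip: mult.assoc power_add)
  finally show "hom_char ?A Y (K0_class C ?A t) = hom_char ?A Y ?p"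
    using K0_ext_class[OF sum_additive_hom_dim t, of Y] by simp
qed

text \<open>Additivity of the index extends agreement from the indecomposables to all objects of U;
  \<open>K0_class_index\<close> then carries it to every generator [t].\<close>

lemma int_dual_index_eqI:
  assumes T: "tilting (add_of C T)" and U: "tilting (add_of C U)"
    and \<phi>: "\<phi> \<in> int_dual (K0_split C (add_of C T))" "\<psi> \<in> int_dual (K0_split C (add_of C T))"
    and eq: "\<And>v. v \<in> Indec C (add_of C U) \<Longrightarrow> \<phi> (index d C (add_of C T) v) = \<psi> (index d C (add_of C T) v)"
  shows "\<phi> = \<psi>"
proof (rule int_dual_eqI[OF \<phi>])
  let ?A = "add_of C T" and ?G = "K0_split C (add_of C T)"
  interpret G: comm_group ?G by (rule K0_comm_group)
  interpret \<phi>: group_hom ?G integer_group \<phi>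
    using int_dual_hom[OF \<phi>(1)] G.group_axioms by (simp add: group_hom_def group_hom_axioms_def)
  interpret \<psi>: group_hom ?G integer_group \<psi>
    using int_dual_hom[OF \<phi>(2)] G.group_axioms by (simp add: group_hom_def group_hom_axioms_def)
  note clo = index_closed[OF T]
  have sum: "\<phi> (index d C ?A W) = \<psi> (index d C ?A W)"
    if "list_sum W Xs" "\<And>X. X \<in> set Xs \<Longrightarrow> local_object X" "W \<in> add_of C U" for W Xs
    using that
  proof (induction rule: list_sum.induct)
    case (list_sum_Nil P)
    thus ?case using index_zero[OF T] \<phi>.hom_one \<psi>.hom_one by simp
  next
    case (list_sum_Cons P X R Xs)
    have "X \<in> add_of C U" "R \<in> add_of C U"
      using add_of_summand[OF list_sum_Cons.prems(2)] list_sum_Cons.hyps(1) is_sum_comm by blast+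
    moreover have "indecomposable C X" using list_sum_Cons.prems(1) local_object_indecomposable by simp
    ultimately have "\<phi> (index d C ?A X) = \<psi> (index d C ?A X)" "\<phi> (index d C ?A R) = \<psi> (index d C ?A R)"
      using eq list_sum_Cons.IH list_sum_Cons.prems(1) by (simp_all add: Indec_def)
    thus ?case using index_is_sum[OF T list_sum_Cons.hyps(1)] \<phi>.hom_mult[OF clo clo] \<psi>.hom_mult[OF clo clo] by simp
  qed
  have all: "\<phi> (index d C ?A W) = \<psi> (index d C ?A W)" if W: "W \<in> add_of C U" for W
  proof -
    obtain Xs where "list_sum W Xs" "\<And>X. X \<in> set Xs \<Longrightarrow> local_object X"
      using local_decomposition[of W] by metis
    thus ?thesis by (rule sum[OF _ _ W])
  qed
  fix t assume t: "t \<in> ?A"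
  obtain c \<gamma> where r: "resolution d C (add_of C U) (Sob C t) c \<gamma>" by (rule tilting_resolution[OF U])
  show "\<phi> (K0_class C ?A t) = \<psi> (K0_class C ?A t)"
    unfolding K0_class_index[OF T t r] hom_integer_group_finprod[OF K0_comm_group \<phi>.homh finite_atMost clo]
      hom_integer_group_finprod[OF K0_comm_group \<psi>.homh finite_atMost clo]
    by (rule sum.cong[OF refl]) (simp add: all[OF resolutionD(3)[OF r]])
qed

lemma c_vector_eqI:
  assumes "tilting (add_of C T)" "tilting (add_of C U)" "\<phi> \<in> int_dual (K0_split C (add_of C T))"
    and "\<And>v. v \<in> Indec C (add_of C U) \<Longrightarrow> \<phi> (index d C (add_of C T) v) = (if isomorphic C u v then 1 else 0)"
  shows "c_vector d C (add_of C T) u (add_of C U) = \<phi>"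
  unfolding c_vector_def
proof (rule the_equality)
  fix \<psi> assume \<psi>: "\<psi> \<in> int_dual (K0_split C (add_of C T)) \<and> (\<forall>v\<in>Indec C (add_of C U).
    \<psi> (index d C (add_of C T) v) = (if isomorphic C u v then 1 else 0))"
  show "\<psi> = \<phi>"
    by (rule int_dual_index_eqI[OF assms(1,2) conjunct1[OF \<psi>] assms(3)]) (simp only: conjunct2[OF \<psi>, rule_format] assms(4))
qed (use assms in blast)

lemma c_vector_euler_form:
  assumes T: "tilting (add_of C T)" and U: "tilting (add_of C U)"
    and h: "\<And>v. v \<in> Indec C (add_of C U) \<Longrightarrow> hom_dim K C v (Sob C u') = (if isomorphic C u v then 1 else 0)"
    and t: "t \<in> add_of C T"
  shows "c_vector d C (add_of C T) u (add_of C U) (K0_class C (add_of C T) t) =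
    (- 1) ^ d * euler_form (add_of C U) (Sob C t) (Sob C u')"
proof -
  let ?A = "add_of C T" and ?B = "add_of C U"
  define f where "f t = (- 1) ^ d * euler_form ?B (Sob C t) (Sob C u')" for t
  have f: "sum_additive ?A f"
    unfolding sum_additive_def f_def using euler_form_is_sum[OF is_sum_Sob] by (simp add: distrib_left)
  have "K0_ext ?A f (index d C ?A v) = (if isomorphic C u v then 1 else 0)" if v: "v \<in> Indec C ?B" for v
  proof -
    have vB: "v \<in> ?B" using v by (simp add: Indec_def)
    obtain c \<gamma> where r: "resolution d C ?A v c \<gamma>" by (rule tilting_resolution[OF T])
    note res = resolutionD[OF r]
    have "K0_ext ?A f (index d C ?A v) = (\<Sum>i\<le>d. (- 1) ^ i * K0_ext ?A f (K0_class C ?A (c (d - i))))"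
      unfolding index_resolution[OF tilting_rigid[OF T] r] by (rule hom_alternating_class[OF r K0_ext_hom[OF f]])
    also have "\<dots> = (\<Sum>i\<le>d. (- 1) ^ i * f (c (d - i)))"
      by (rule sum.cong[OF refl]) (simp add: K0_ext_class[OF f res(3)])
    also have "\<dots> = (- 1) ^ d * (\<Sum>i\<le>d. (- 1) ^ i * euler_form ?B (Sob C (c (d - i))) (Sob C u'))"
      unfolding f_def sum_distrib_left by (simp add: mult.left_commute)
    also have "(\<Sum>i\<le>d. (- 1) ^ i * euler_form ?B (Sob C (c (d - i))) (Sob C u')) = euler_form ?B (Sob C (c (Suc d))) (Sob C u')"
    proof (rule euler_form_additive[OF hexact_shift[OF res(1)] U])
      \<comment> \<open>After the shift, the last morphism starts at the shift of \<open>v\<close>,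
        and \<open>v\<close> belongs to U; this puts it into the ideal required for the form of
        U.\<close>
      show "Sarr C (c (Suc d)) (c (Suc (Suc d))) (\<gamma> (Suc d))
          \<in> factoring_through C (Sob C ` ?B) (Sob C (c (Suc d))) (Sob C (Sob C (c 0)))"
        using hexact_arr[OF hexact_shift[OF res(1)] order_refl] vB
        by (intro factoring_through_source) (simp_all add: hexact_last[OF res(1)] res(2))
    qed
    \<comment> \<open>The form is evaluated at the shift of an object of U and reduces to a Hom
      dimension; its sign cancels the one in the definition of \<open>f\<close>.\<close>
    also have "\<dots> = (- 1) ^ d * int (hom_dim K C v (Sob C u'))"
      unfolding res(2) by (rule euler_form_shift[OF tilting_rigid[OF U] vB])
    finally show ?thesis using h[OF v] by (simp flip: mult.assoc power_add)
  qed
  hence "c_vector d C ?A u ?B = K0_ext ?A f" by (intro c_vector_eqI[OF T U K0_ext_dual[OF f]])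
  thus ?thesis using K0_ext_class[OF f t] by (simp add: f_def)
qed

end

section \<open>Exchange pairs\<close>

context hom_finite_angulated_category
begin

text \<open>The last morphism of a resolution of \<open>Y\<close> detects the ideal: if it killed
  \<open>f\<close>, exactness would lift \<open>f\<close> to the term \<open>c d\<close> of
  \<open>A\<close>.\<close>

lemma exists_arrow_to_shift:
  assumes A: "tilting A" and f: "f \<in> Arr C X Y" "f \<notin> factoring_through C A X Y"
  obtains W q where "W \<in> A" "q \<in> Arr C Y (Sob C W)" "Comp C X Y (Sob C W) q f \<noteq> Zero C X (Sob C W)"
proof -
  obtain c \<gamma> where r: "resolution d C A Y c \<gamma>" by (rule tilting_resolution[OF A])
  note res = resolutionD[OF r]
  have g: "\<gamma> (Suc d) \<in> Arr C Y (Sob C (c 0))"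
    using hexact_arr[OF res(1) order_refl] unfolding hexact_last[OF res(1)] res(2) .
  have "Comp C X Y (Sob C (c 0)) (\<gamma> (Suc d)) f \<noteq> Zero C X (Sob C (c 0))"
  proof
    assume "Comp C X Y (Sob C (c 0)) (\<gamma> (Suc d)) f = Zero C X (Sob C (c 0))"
    then obtain h where "h \<in> Arr C X (c d)" "f = Comp C X (c d) Y (\<gamma> d) h"
      using hexact_co[OF res(1) order_refl, of f X] f(1) unfolding hexact_last[OF res(1)] res(2) by blast
    moreover have "\<gamma> d \<in> Arr C (c d) Y" using hexact_arr[OF res(1), of d] unfolding res(2) by simp
    ultimately have "f \<in> factoring_through C A X Y"
      unfolding factoring_through_def using res(3)[of d] by blast
    with f(2) show False by contradiction
  qed
  thus thesis using that[OF res(3)[of 0] g] by simp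
qed

end

context calabi_yau_category
begin

text \<open>A non-zero morphism into the shift of a sum has a non-zero component; splitting off one
  summand at a time reaches an indecomposable one.\<close>

lemma exists_arrow_to_shifted_summand:
  assumes "list_sum W Xs" "\<And>V. V \<in> set Xs \<Longrightarrow> local_object V" "W \<in> add_of C U"
    and "f \<in> Arr C X Y" "q \<in> Arr C Y (Sob C W)" "Comp C X Y (Sob C W) q f \<noteq> Zero C X (Sob C W)"
  shows "\<exists>v \<in> Indec C (add_of C U). \<exists>q \<in> Arr C Y (Sob C v). Comp C X Y (Sob C v) q f \<noteq> Zero C X (Sob C v)"
  using assms(1,2,3,5,6)
proof (induction arbitrary: q rule: list_sum.induct)
  case (list_sum_Nil P)
  have "Comp C X Y (Sob C P) q f = Zero C X (Sob C P)"
    by (rule zero_object_arr_to[OF zero_object_Sob[OF list_sum_Nil.hyps] Comp_closed[OF assms(4) list_sum_Nil.prems(3)]])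
  with list_sum_Nil.prems(4) show ?case by contradiction
next
  case (list_sum_Cons P V R Xs)
  have in_add: "V \<in> add_of C U" "R \<in> add_of C U"
    using add_of_summand[OF list_sum_Cons.prems(2)] list_sum_Cons.hyps(1) is_sum_comm by blast+
  obtain i1 i2 p1 p2 where b: "biproduct C (Sob C P) (Sob C V) (Sob C R) i1 i2 p1 p2"
    using is_sum_Sob[OF list_sum_Cons.hyps(1)] unfolding is_sum_def by (elim exE)
  have arr: "i1 \<in> Arr C (Sob C V) (Sob C P)" "i2 \<in> Arr C (Sob C R) (Sob C P)"
      "p1 \<in> Arr C (Sob C P) (Sob C V)" "p2 \<in> Arr C (Sob C P) (Sob C R)"
    and id: "Comp C (Sob C P) (Sob C V) (Sob C P) i1 p1 \<oplus>\<^bsub>Hom C (Sob C P) (Sob C P)\<^esub>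
        Comp C (Sob C P) (Sob C R) (Sob C P) i2 p2 = Ident C (Sob C P)"
    using b unfolding biproduct_def by auto
  define h where "h = Comp C X Y (Sob C P) q f"
  have h: "h \<in> Arr C X (Sob C P)" unfolding h_def using assms(4) list_sum_Cons.prems(3) by (rule Comp_closed)
  have assoc: "Comp C X (Sob C P) Z p h = Comp C X Y Z (Comp C Y (Sob C P) Z p q) f" if "p \<in> Arr C (Sob C P) Z" for p Z
    unfolding h_def by (rule Comp_assoc[OF assms(4) list_sum_Cons.prems(3) that, symmetric])
  have clo: "Comp C Y (Sob C P) Z p q \<in> Arr C Y Z" if "p \<in> Arr C (Sob C P) Z" for p Z
    using list_sum_Cons.prems(3) that by (rule Comp_closed)
  show ?case
  proof (cases "Comp C X (Sob C P) (Sob C V) p1 h = Zero C X (Sob C V)")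
    case False
    have "indecomposable C V" using list_sum_Cons.prems(1) local_object_indecomposable by simp
    hence "V \<in> Indec C (add_of C U)" using in_add(1) by (simp add: Indec_def)
    thus ?thesis using False clo[OF arr(3)] unfolding assoc[OF arr(3)] by blast
  next
    case True
    have "Comp C X (Sob C P) (Sob C R) p2 h \<noteq> Zero C X (Sob C R)"
    proof
      assume 0: "Comp C X (Sob C P) (Sob C R) p2 h = Zero C X (Sob C R)"
      have "h = Comp C X (Sob C P) (Sob C P) (Comp C (Sob C P) (Sob C V) (Sob C P) i1 p1 \<oplus>\<^bsub>Hom C (Sob C P) (Sob C P)\<^esub>
          Comp C (Sob C P) (Sob C R) (Sob C P) i2 p2) h"
        unfolding id by (rule Ident_left[OF h, symmetric])
      also have "\<dots> = Zero C X (Sob C P)"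
        using arr h True 0 by (simp add: Comp_add_left Comp_assoc)
      finally show False using list_sum_Cons.prems(4) unfolding h_def by contradiction
    qed
    hence "Comp C X Y (Sob C R) (Comp C Y (Sob C P) (Sob C R) p2 q) f \<noteq> Zero C X (Sob C R)"
      unfolding assoc[OF arr(4)] .
    thus ?thesis using list_sum_Cons.IH[OF _ in_add(2) clo[OF arr(4)]] list_sum_Cons.prems(1) by simp
  qed
qed

lemma exists_arrow_to_shifted_indecomposable:
  assumes "W \<in> add_of C U" "f \<in> Arr C X Y" "q \<in> Arr C Y (Sob C W)" "Comp C X Y (Sob C W) q f \<noteq> Zero C X (Sob C W)"
  obtains v q where "v \<in> Indec C (add_of C U)" "q \<in> Arr C Y (Sob C v)" "Comp C X Y (Sob C v) q f \<noteq> Zero C X (Sob C v)"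
proof -
  obtain Xs where Xs: "list_sum W Xs" "\<And>V. V \<in> set Xs \<Longrightarrow> local_object V"
    using local_decomposition[of W] by metis
  from exists_arrow_to_shifted_summand[OF Xs assms] show thesis using that by blast
qed

lemma arrow_to_shift_isomorphic:
  assumes "isomorphic C u v" "f \<in> Arr C X Y" "q \<in> Arr C Y (Sob C v)" "Comp C X Y (Sob C v) q f \<noteq> Zero C X (Sob C v)"
  obtains q' where "q' \<in> Arr C Y (Sob C u)" "Comp C X Y (Sob C u) q' f \<noteq> Zero C X (Sob C u)"
proof -
  obtain a b where ab: "a \<in> Arr C u v" "b \<in> Arr C v u" "Comp C v u v a b = Ident C v"
    using assms(1) unfolding isomorphic_def inverse_arrows_def by blast
  let ?q = "Comp C Y (Sob C v) (Sob C u) (Sarr C v u b) q"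
  have b: "Sarr C v u b \<in> Arr C (Sob C v) (Sob C u)" and a: "Sarr C u v a \<in> Arr C (Sob C u) (Sob C v)"
    using ab by auto
  have q: "?q \<in> Arr C Y (Sob C u)" using assms(3) b by (rule Comp_closed)
  have qf: "Comp C X Y (Sob C v) q f \<in> Arr C X (Sob C v)" using assms(2,3) by (rule Comp_closed)
  have "Comp C X Y (Sob C u) ?q f \<noteq> Zero C X (Sob C u)"
  proof
    assume "Comp C X Y (Sob C u) ?q f = Zero C X (Sob C u)"
    hence 0: "Comp C X (Sob C v) (Sob C u) (Sarr C v u b) (Comp C X Y (Sob C v) q f) = Zero C X (Sob C u)"
      unfolding Comp_assoc[OF assms(2,3) b] .
    have "Comp C X Y (Sob C v) q f = Comp C X (Sob C v) (Sob C v) (Comp C (Sob C v) (Sob C u) (Sob C v) (Sarr C u v a) (Sarr C v u b))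
        (Comp C X Y (Sob C v) q f)"
      unfolding Sarr_comp[OF ab(2,1), symmetric] ab(3) Sarr_ident by (rule Ident_left[OF qf, symmetric])
    also have "\<dots> = Zero C X (Sob C v)"
      unfolding Comp_assoc[OF qf b a] 0 by (rule Comp_zero_right[OF a])
    finally show False using assms(4) by contradiction
  qed
  thus thesis by (rule that[OF q])
qed

text \<open>A functional that vanishes on the factoring morphisms but not at \<open>g\<close> is
  represented by some \<open>k\<close> under Serre duality. Its value at \<open>g\<close> is the
  pairing of the composite of \<open>g\<close> and \<open>k\<close> with the identity, so this
  composite is non-zero.\<close>

lemma exists_annihilated_arrow:
  assumes B: "tilting B" and g: "g \<in> Arr C Z X" "g \<notin> factoring_through C B Z X"
  obtains k where "k \<in> annihilated B X (Sob C (Sob C Z))" "Comp C Z X (Sob C (Sob C Z)) k g \<noteq> Zero C Z (Sob C (Sob C Z))"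
proof -
  obtain \<phi> where \<phi>: "\<phi> \<in> carrier (dual_space K (Hom C Z X))"
      "\<forall>n\<in>factoring_through C B Z X. \<phi> n = \<zero>\<^bsub>K\<^esub>" "\<phi> g \<noteq> \<zero>\<^bsub>K\<^esub>"
    using exists_functional_vanishing[OF Hom_vectorspace Hom_fin_dim factoring_through_subspace[OF B] g] by blast
  obtain k where k: "k \<in> Arr C X (Sob C (Sob C Z))" "\<phi> = serre Z X k"
    using serre_bij[of Z X] \<phi>(1) unfolding bij_betw_def by (metis imageE)
  have "k \<in> annihilated B X (Sob C (Sob C Z))"
    unfolding serre_annihilator[symmetric] using k \<phi>(2) by simp
  moreover have "Comp C Z X (Sob C (Sob C Z)) k g \<noteq> Zero C Z (Sob C (Sob C Z))"
  proof
    assume 0: "Comp C Z X (Sob C (Sob C Z)) k g = Zero C Z (Sob C (Sob C Z))"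
    have "\<phi> g = serre Z X k (Comp C Z Z X g (Ident C Z))" unfolding k(2) Ident_right[OF g(1)] ..
    also have "\<dots> = serre Z Z (Zero C Z (Sob C (Sob C Z))) (Ident C Z)"
      using serre_natural[OF g(1) k(1) Ident_closed] unfolding 0 by (rule sym)
    also have "\<dots> = \<zero>\<^bsub>K\<^esub>" by (simp add: serre_zero Ident_closed)
    finally show False using \<phi>(3) by contradiction
  qed
  ultimately show thesis by (rule that)
qed

text \<open>The two detecting morphisms have different origins: \<open>e\<close> comes from a
  U-resolution of \<open>u'\<close>, whereas \<open>l\<close> comes from Serre duality, as a
  component of the first factor of a morphism through Sigma^d U. In both cases the vanishing for
  other summands singles out \<open>u\<close>.\<close>

lemma exchange_vanishing:
  assumes U: "tilting (add_of C U)"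
    and 1: "hom_dim K C u' (Sob C u) = 1"
    and van: "\<And>v f. v \<in> Indec C (add_of C U) \<Longrightarrow> \<not> isomorphic C u v \<Longrightarrow> f \<in> Arr C u' (Sob C v) \<Longrightarrow> f = Zero C u' (Sob C v)"
    and t: "Arr C t (Sob C t) = {Zero C t (Sob C t)}"
  shows "Arr C (Sob C t) (Sob C u') = annihilated (add_of C U) (Sob C t) (Sob C u') \<or>
    Arr C (Sob C u') (Sob C (Sob C t)) = annihilated (add_of C U) (Sob C u') (Sob C (Sob C t))"
proof (rule ccontr)
  let ?B = "add_of C U"
  assume neg: "\<not> ?thesis"
  \<comment> \<open>Both spaces in question consist of shifted morphisms. Unshifted, failing to be
    \<open>annihilated\<close> means not factoring through U itself.\<close>
  have ex: "\<exists>f\<in>Arr C X Y. f \<notin> factoring_through C ?B X Y"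
    if ne: "Arr C (Sob C X) (Sob C Y) \<noteq> annihilated ?B (Sob C X) (Sob C Y)" for X Y
  proof -
    have "annihilated ?B (Sob C X) (Sob C Y) \<subseteq> Arr C (Sob C X) (Sob C Y)" by (rule subspace_subset[OF annihilated_subspace])
    then obtain g where g: "g \<in> Arr C (Sob C X) (Sob C Y)" "g \<notin> annihilated ?B (Sob C X) (Sob C Y)" using ne by blast
    obtain f where f: "f \<in> Arr C X Y" "g = Sarr C X Y f" by (rule Sarr_surj[OF g(1)])
    have "f \<notin> factoring_through C ?B X Y"
      using g(2) unfolding annihilated_eq_factoring[OF U] f(2) Sarr_mem_factoring_through[OF f(1)] .
    thus ?thesis using f(1) by blast
  qed
  obtain f where f: "f \<in> Arr C t u'" "f \<notin> factoring_through C ?B t u'" using neg ex[of t u'] by blast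
  obtain g where g: "g \<in> Arr C u' (Sob C t)" "g \<notin> factoring_through C ?B u' (Sob C t)" using neg ex[of u' "Sob C t"] by blast
  obtain W q where W: "W \<in> ?B" "q \<in> Arr C u' (Sob C W)" "Comp C t u' (Sob C W) q f \<noteq> Zero C t (Sob C W)"
    by (rule exists_arrow_to_shift[OF U f])
  obtain v q1 where q1: "v \<in> Indec C ?B" "q1 \<in> Arr C u' (Sob C v)" "Comp C t u' (Sob C v) q1 f \<noteq> Zero C t (Sob C v)"
    by (rule exists_arrow_to_shifted_indecomposable[OF W(1) f(1) W(2,3)])
  have "isomorphic C u v"
  proof (rule ccontr)
    assume "\<not> isomorphic C u v"
    from van[OF q1(1) this q1(2)] show False using q1(3) Comp_zero_left[OF f(1)] by simp
  qed
  then obtain e where e: "e \<in> Arr C u' (Sob C u)" "Comp C t u' (Sob C u) e f \<noteq> Zero C t (Sob C u)"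
    by (rule arrow_to_shift_isomorphic[OF _ f(1) q1(2,3)])
  obtain k where k: "k \<in> annihilated ?B (Sob C t) (Sob C (Sob C u'))"
      "Comp C u' (Sob C t) (Sob C (Sob C u')) k g \<noteq> Zero C u' (Sob C (Sob C u'))"
    by (rule exists_annihilated_arrow[OF U g])
  obtain W' k1 r where k1: "W' \<in> ?B" "k1 \<in> Arr C (Sob C t) (Sob C W')" "r \<in> Arr C (Sob C W') (Sob C (Sob C u'))"
      "k = Comp C (Sob C t) (Sob C W') (Sob C (Sob C u')) r k1"
    using k(1) unfolding annihilated_eq_factoring[OF U] factoring_through_def by blast
  \<comment> \<open>\<open>k\<close> is \<open>k1\<close> followed by \<open>r\<close>, so a
    non-zero composite of \<open>g\<close> with \<open>k\<close> forces a non-zero composite with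
    \<open>k1\<close>.\<close>
  have "Comp C u' (Sob C t) (Sob C W') k1 g \<noteq> Zero C u' (Sob C W')"
    using k(2) Comp_zero_right[OF k1(3)] unfolding k1(4) Comp_assoc[OF g(1) k1(2,3)] by auto
  then obtain v' k2 where k2: "v' \<in> Indec C ?B" "k2 \<in> Arr C (Sob C t) (Sob C v')"
      "Comp C u' (Sob C t) (Sob C v') k2 g \<noteq> Zero C u' (Sob C v')"
    by (rule exists_arrow_to_shifted_indecomposable[OF k1(1) g(1) k1(2)])
  have "isomorphic C u v'"
  proof (rule ccontr)
    assume "\<not> isomorphic C u v'"
    from van[OF k2(1) this Comp_closed[OF g(1) k2(2)]] show False using k2(3) by contradiction
  qed
  then obtain l where l: "l \<in> Arr C (Sob C t) (Sob C u)" "Comp C u' (Sob C t) (Sob C u) l g \<noteq> Zero C u' (Sob C u)"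
    by (rule arrow_to_shift_isomorphic[OF _ g(1) k2(2,3)])
  have lg: "Comp C u' (Sob C t) (Sob C u) l g \<in> Arr C u' (Sob C u)" using g(1) l(1) by (rule Comp_closed)
  obtain a where a: "a \<in> carrier K" "e = a \<odot>\<^bsub>Hom C u' (Sob C u)\<^esub> Comp C u' (Sob C t) (Sob C u) l g"
    using dim_1_span[OF Hom_vectorspace Hom_fin_dim 1[unfolded hom_dim_def] lg l(2) e(1)] by blast
  have gf: "Comp C t u' (Sob C t) g f = Zero C t (Sob C t)" using Comp_closed[OF f(1) g(1)] unfolding t by (rule singletonD)
  have "Comp C t u' (Sob C u) (Comp C u' (Sob C t) (Sob C u) l g) f = Zero C t (Sob C u)"
    unfolding Comp_assoc[OF f(1) g(1) l(1)] gf by (rule Comp_zero_right[OF l(1)])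
  hence "Comp C t u' (Sob C u) e f = Zero C t (Sob C u)"
    unfolding a(2) using Comp_smult_left[OF f(1) lg a(1)] a(1) by simp
  with e(2) show False by contradiction
qed

end

context calabi_yau_category
begin

lemma tilting_OT_cluster_tilting: "OT_cluster_tilting d C T \<longleftrightarrow> tilting (add_of C T)"
  by (simp add: OT_cluster_tilting_def tilting_def rigid_def)

text \<open>Both \<open>v\<close> and \<open>u'\<close> are summands of the mutated cluster tilting
  object, and its rigidity gives the vanishing in both directions.\<close>

lemma mutation_zero:
  assumes "mutation d C U u u'" "v \<in> Indec C (add_of C U)" "\<not> isomorphic C u v"
  shows "Arr C v (Sob C u') = {Zero C v (Sob C u')}" "Arr C u' (Sob C v) = {Zero C u' (Sob C v)}"
proof -
  obtain V where V: "OT_cluster_tilting d C V"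
      "\<And>X. indec_summand C X V \<longleftrightarrow> (indec_summand C X U \<and> \<not> isomorphic C X u) \<or> (indecomposable C X \<and> isomorphic C X u')"
    and u': "indecomposable C u'"
    using assms(1) unfolding mutation_def by blast
  have "\<not> isomorphic C v u" using assms(3) isomorphic_sym by blast
  hence "indec_summand C v V" using V(2) assms(2) indec_summand_iff_Indec by blast
  hence v: "v \<in> add_of C V" by (simp add: indec_summand_iff_Indec Indec_def)
  have "indec_summand C u' V" using V(2) u' isomorphic_refl by blast
  hence "u' \<in> add_of C V" by (simp add: indec_summand_iff_Indec Indec_def)
  thus "Arr C v (Sob C u') = {Zero C v (Sob C u')}" "Arr C u' (Sob C v) = {Zero C u' (Sob C v)}"
    using V(1) v unfolding OT_cluster_tilting_def by blast+
qed

lemma mutation_hom_dim: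
  assumes "mutation d C U u u'" "hom_dim K C u (Sob C u') = 1" "v \<in> Indec C (add_of C U)"
  shows "hom_dim K C v (Sob C u') = (if isomorphic C u v then 1 else 0)"
proof (cases "isomorphic C u v")
  case True
  thus ?thesis using hom_dim_isomorphic[OF True] assms(2) by simp
next
  case False
  thus ?thesis using mutation_zero(1)[OF assms(1,3) False] hom_dim_eq_0 by simp
qed

end

theorem lemma4p4:
  fixes K :: "'k ring" and d :: nat and C :: "('k, 'o, 'm) angcat" and T U u u' t :: 'o
  assumes "algebraically_closed K"
    and "angulated_category K d C"
    and "hom_finite K C"
    and "krull_schmidt C"
    and "calabi_yau K C"
    and "basic C T" and "OT_cluster_tilting d C T"
    and "basic C U" and "OT_cluster_tilting d C U"
    and "odd d"
    and "mutation d C U u u'"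
    and "exchange_pair K d C U u u'"
    and "t \<in> add_of C T"
  shows
    "let \<T> = add_of C T; \<U> = add_of C U;
         Q = quotient_category C (factoring_through C (Sob C ` \<U>))
     in c_vector d C \<T> u \<U> (K0_class C \<T> t) =
          (- 1) ^ d * (int (hom_dim K Q (Sob C t) (Sob C u')) +
            (- 1) ^ d * int (hom_dim K Q (Sob C u') (Sob C (Sob C t)))) \<and>
        (Arr Q (Sob C t) (Sob C u') = {Zero Q (Sob C t) (Sob C u')} \<or>
         Arr Q (Sob C u') (Sob C (Sob C t)) = {Zero Q (Sob C u') (Sob C (Sob C t))})"
proof -
  interpret angulated_category K d C by fact
  interpret calabi_yau_category K d C
    by unfold_locales (fact assms)+
  let ?A = "add_of C T" and ?B = "add_of C U"
  let ?Q = "quotient_category C (factoring_through C (Sob C ` ?B))"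
  have T: "tilting ?A" and U: "tilting ?B" using assms by (simp_all add: tilting_OT_cluster_tilting)
  have h: "hom_dim K C u (Sob C u') = 1" "hom_dim K C u' (Sob C u) = 1"
    using assms unfolding exchange_pair_def by blast+
  have "c_vector d C ?A u ?B (K0_class C ?A t) =
      (- 1) ^ d * (int (hom_dim K ?Q (Sob C t) (Sob C u')) + (- 1) ^ d * int (hom_dim K ?Q (Sob C u') (Sob C (Sob C t))))"
    unfolding euler_form_quotient[OF U, symmetric]
    by (rule c_vector_euler_form[OF T U mutation_hom_dim[OF assms(11) h(1)] assms(13)])
  moreover have "Arr ?Q (Sob C t) (Sob C u') = {Zero ?Q (Sob C t) (Sob C u')} \<or>
      Arr ?Q (Sob C u') (Sob C (Sob C t)) = {Zero ?Q (Sob C u') (Sob C (Sob C t))}"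
    unfolding quotient_hom_zero[OF U]
  proof (rule exchange_vanishing[OF U h(2)])
    show "f = Zero C u' (Sob C v)" if "v \<in> Indec C ?B" "\<not> isomorphic C u v" "f \<in> Arr C u' (Sob C v)" for v f
      using mutation_zero(2)[OF assms(11) that(1,2)] that(3) by simp
    show "Arr C t (Sob C t) = {Zero C t (Sob C t)}" using T assms(13) by (simp add: tilting_def rigid_def)
  qed
  ultimately show ?thesis unfolding Let_def ..
qed

end
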